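(* Let $\{(h_\alpha,\lambda_\alpha,\varrho_\alpha)\}_{\alpha\in\mathbb{R}_+}$ be such that $h_\alpha,\lambda_\alpha\in(0,\frac12]$ and $\varrho_\alpha\ge1+\lambda_\alpha^{1/2}h_\alpha^{1/4}$. Assume that $h_\alpha\ll(\varrho_\alpha-1)^{-2/3}\lambda_\alpha^{3/2}$ as $\alpha\to\infty$, and let $\{\phi^\alpha\}_{\alpha\in\mathbb{R}_+}$ satisfy $$\phi^\alpha\in A^{vKD}_{\lambda_\alpha,\varrho_\alpha,\infty}\quad\text{and}\quad E^{vKD}_{h_\alpha}(\phi^\alpha)=\min_{A^{vKD}_{\lambda_\alpha,\varrho_\alpha,\infty}}E^{vKD}_{h_\alpha}.$$ Then $$(\varrho_\alpha-1)^{1/7}h_\alpha^{-2/7}\lambda_\alpha^{3/7}\ \lesssim\ \|D\phi^\alpha_\rho\|_{L^\infty(\Omega)}\quad\text{as }\alpha\to\infty.$$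
   Context: Let $I_\theta=[0,2\pi]$, $I_z=[-\frac12,\frac12]$, $\Omega=I_\theta\times I_z$ with coordinates $(\theta,z)$. $H^k_{\mathrm{per}}(\Omega)$ is the space of ($\Omega$-)periodic $L^2$-based Sobolev functions of order $k$ on $\Omega$. For a displacement $\phi=(\phi_\rho,\phi_\theta,\phi_z):\Omega\to\mathbb{R}^3$ (cylindrical components), the von Kármán–Donnell strain $\epsilon$ is the symmetric $2\times2$ matrix with entries $\epsilon_{\theta\theta}=\partial_\theta\phi_\theta+\frac12(\partial_\theta\phi_\rho)^2+\phi_\rho$, $\epsilon_{zz}=\partial_z\phi_z+\frac12(\partial_z\phi_\rho)^2$, $\epsilon_{\theta z}=\frac12(\partial_\theta\phi_z+\partial_z\phi_\theta)+\frac12\partial_\theta\phi_\rho\,\partial_z\phi_\rho$. The energy is $E^{vKD}_h(\phi)=\int_\Omega |\epsilon|^2+h^2|D^2\phi_\rho|^2\,d\theta\,dz$ (Euclidean matrix norms). The admissible set $A^{vKD}_{\lambda,\varrho,\infty}$ consists of all $\phi:\Omega\to\mathbb{R}^3$ with $\phi_\rho\in H^2_{\mathrm{per}}(\Omega)$, $\phi_\theta\in H^1_{\mathrm{per}}(\Omega)$, $\phi_z+\lambda z\in H^1_{\mathrm{per}}(\Omega)$ and $\phi_\rho\ge\varrho-1$. For positive quantities, $a_\alpha\ll b_\alpha$ as $\alpha\to\infty$ means $a_\alpha/b_\alpha\to0$; $a_\alpha\lesssim b_\alpha$ as $\alpha\to\infty$ means there is a numerical constant $C>0$ such that $a_\alpha\le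 Cb_\alpha$ for all sufficiently large $\alpha$ (the right-hand side may be $+\infty$). *)

theory Defs
  imports "HOL-Analysis.Analysis" "HOL-Probability.Essential_Supremum"
begin

text \<open>Points of the reference domain are pairs \<open>(\<theta>, z)\<close>; \<open>(1, 0)\<close> and \<open>(0, 1)\<close> are
  the two coordinate directions.\<close>

definition Omega :: "(real \<times> real) set" where
  "Omega = {0..2 * pi} \<times> {- 1/2..1/2}"

section \<open>Weak derivatives\<close>

primrec C_k :: "nat \<Rightarrow> (real \<times> real \<Rightarrow> real) \<Rightarrow> bool" where
  "C_k 0 f \<longleftrightarrow> continuous_on UNIV f"
| "C_k (Suc k) f \<longleftrightarrow> (\<forall>x. f differentiable (at x)) \<and>
     (\<forall>v\<in>Basis. C_k k (\<lambda>x. frechet_derivative f (at x) v))"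

definition test_function :: "(real \<times> real) set \<Rightarrow> (real \<times> real \<Rightarrow> real) \<Rightarrow> bool" where
  "test_function U \<psi> \<longleftrightarrow> (\<forall>k. C_k k \<psi>) \<and>
     (\<exists>K. compact K \<and> K \<subseteq> U \<and> (\<forall>x. x \<notin> K \<longrightarrow> \<psi> x = 0))"

definition locally_integrable_on ::
    "(real \<times> real \<Rightarrow> real) \<Rightarrow> (real \<times> real) set \<Rightarrow> bool" where
  "locally_integrable_on f U \<longleftrightarrow> (\<forall>K. compact K \<and> K \<subseteq> U \<longrightarrow> f absolutely_integrable_on K)"

definition has_weak_derivative ::
    "(real \<times> real) set \<Rightarrow> real \<times> real \<Rightarrow> (real \<times> real \<Rightarrow> real) \<Rightarrow> (real \<times> real \<Rightarrow> real) \<Rightarrow> bool" where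
  "has_weak_derivative U v f g \<longleftrightarrow>
     locally_integrable_on f U \<and> locally_integrable_on g U \<and>
     (\<forall>\<psi>. test_function U \<psi> \<longrightarrow>
       (LINT x:U|lebesgue. f x * frechet_derivative \<psi> (at x) v) = - (LINT x:U|lebesgue. g x * \<psi> x))"

text \<open>A weak derivative is determined only almost everywhere. \<open>wderiv\<close> picks a representative of
  the weak derivative on the interior of \<open>Omega\<close>; the boundary is a null set, and everything below
  is insensitive to the choice.\<close>

definition wderiv :: "real \<times> real \<Rightarrow> (real \<times> real \<Rightarrow> real) \<Rightarrow> real \<times> real \<Rightarrow> real" where
  "wderiv v f = (SOME g. has_weak_derivative (interior Omega) v f g)"

abbreviation d_theta :: "(real \<times> real \<Rightarrow> real) \<Rightarrow> real \<times> real \<Rightarrow> real" where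
  "d_theta \<equiv> wderiv (1, 0)"

abbreviation d_z :: "(real \<times> real \<Rightarrow> real) \<Rightarrow> real \<times> real \<Rightarrow> real" where
  "d_z \<equiv> wderiv (0, 1)"

section \<open>Periodic Sobolev spaces\<close>

definition L2_loc :: "(real \<times> real \<Rightarrow> real) \<Rightarrow> bool" where
  "L2_loc F \<longleftrightarrow> F \<in> borel_measurable lebesgue \<and>
     (\<forall>K. compact K \<longrightarrow> (\<lambda>x. (F x)\<^sup>2) absolutely_integrable_on K)"

primrec H_loc :: "nat \<Rightarrow> (real \<times> real \<Rightarrow> real) \<Rightarrow> bool" where
  "H_loc 0 F \<longleftrightarrow> L2_loc F"
| "H_loc (Suc k) F \<longleftrightarrow> L2_loc F \<and>
     (\<forall>v\<in>Basis. \<exists>G. has_weak_derivative UNIV v F G \<and> H_loc k G)"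

definition Omega_periodic :: "(real \<times> real \<Rightarrow> real) \<Rightarrow> bool" where
  "Omega_periodic F \<longleftrightarrow> (\<forall>\<theta> z. F (\<theta> + 2 * pi, z) = F (\<theta>, z) \<and> F (\<theta>, z + 1) = F (\<theta>, z))"

text \<open>A function on \<open>Omega\<close> belongs to the periodic Sobolev space of order \<open>k\<close> iff its periodic
  extension to the plane is locally Sobolev of order \<open>k\<close>. In particular, traces (for \<open>k = 2\<close> also
  those of the gradient) match on opposite sides of \<open>Omega\<close>. Functions on \<open>Omega\<close> are total
  functions on the plane whose values outside \<open>Omega\<close> are irrelevant.\<close>

definition H_per :: "nat \<Rightarrow> (real \<times> real \<Rightarrow> real) \<Rightarrow> bool" where
  "H_per k f \<longleftrightarrow> (\<exists>F. Omega_periodic F \<and> H_loc k F \<and> (AE x in lebesgue_on Omega. f x = F x))"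

section \<open>The von Karman-Donnell model\<close>

text \<open>Displacements have the cylindrical components \<open>(\<phi>\<^sub>\<rho>, \<phi>\<^sub>\<theta>, \<phi>\<^sub>z)\<close>, in this order.\<close>

abbreviation comp_rho :: "(real \<times> real \<Rightarrow> real^3) \<Rightarrow> real \<times> real \<Rightarrow> real" where
  "comp_rho \<phi> \<equiv> (\<lambda>x. \<phi> x $ 1)"

abbreviation comp_theta :: "(real \<times> real \<Rightarrow> real^3) \<Rightarrow> real \<times> real \<Rightarrow> real" where
  "comp_theta \<phi> \<equiv> (\<lambda>x. \<phi> x $ 2)"

abbreviation comp_z :: "(real \<times> real \<Rightarrow> real^3) \<Rightarrow> real \<times> real \<Rightarrow> real" where
  "comp_z \<phi> \<equiv> (\<lambda>x. \<phi> x $ 3)"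

definition strain_tt :: "(real \<times> real \<Rightarrow> real^3) \<Rightarrow> real \<times> real \<Rightarrow> real" where
  "strain_tt \<phi> x =
     d_theta (comp_theta \<phi>) x + 1/2 * (d_theta (comp_rho \<phi>) x)\<^sup>2 + comp_rho \<phi> x"

definition strain_zz :: "(real \<times> real \<Rightarrow> real^3) \<Rightarrow> real \<times> real \<Rightarrow> real" where
  "strain_zz \<phi> x = d_z (comp_z \<phi>) x + 1/2 * (d_z (comp_rho \<phi>) x)\<^sup>2"

definition strain_tz :: "(real \<times> real \<Rightarrow> real^3) \<Rightarrow> real \<times> real \<Rightarrow> real" where
  "strain_tz \<phi> x =
     1/2 * (d_theta (comp_z \<phi>) x + d_z (comp_theta \<phi>) x)
     + 1/2 * d_theta (comp_rho \<phi>) x * d_z (comp_rho \<phi>) x"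

text \<open>The norm on \<open>real^2^2\<close> is the Euclidean (Frobenius) matrix norm.\<close>

definition strain :: "(real \<times> real \<Rightarrow> real^3) \<Rightarrow> real \<times> real \<Rightarrow> real^2^2" where
  "strain \<phi> x =
     vector [vector [strain_tt \<phi> x, strain_tz \<phi> x],
             vector [strain_tz \<phi> x, strain_zz \<phi> x]]"

definition grad :: "(real \<times> real \<Rightarrow> real) \<Rightarrow> real \<times> real \<Rightarrow> real \<times> real" where
  "grad f x = (d_theta f x, d_z f x)"

definition hess :: "(real \<times> real \<Rightarrow> real) \<Rightarrow> real \<times> real \<Rightarrow> real^2^2" where
  "hess f x =
     vector [vector [d_theta (d_theta f) x, d_theta (d_z f) x],
             vector [d_z (d_theta f) x, d_z (d_z f) x]]"

definition E_vKD :: "real \<Rightarrow> (real \<times> real \<Rightarrow> real^3) \<Rightarrow> ennreal" where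
  "E_vKD h \<phi> =
     (\<integral>\<^sup>+ x\<in>Omega. ennreal ((norm (strain \<phi> x))\<^sup>2 + h\<^sup>2 * (norm (hess (comp_rho \<phi>) x))\<^sup>2) \<partial>lebesgue)"

definition A_vKD :: "real \<Rightarrow> real \<Rightarrow> (real \<times> real \<Rightarrow> real^3) set" where
  "A_vKD lam vrho =
     {\<phi>. H_per 2 (comp_rho \<phi>) \<and> H_per 1 (comp_theta \<phi>) \<and>
         H_per 1 (\<lambda>x. comp_z \<phi> x + lam * snd x) \<and>
         (AE x in lebesgue_on Omega. comp_rho \<phi> x \<ge> vrho - 1)}"

definition Linf_norm :: "(real \<times> real \<Rightarrow> real \<times> real) \<Rightarrow> ennreal" where
  "Linf_norm G = esssup (lebesgue_on Omega) (\<lambda>x. ennreal (norm (G x)))"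

end

theory Submission
  imports Defs
begin

text \<open>Write \<open>m = vrho - 1 > 0\<close> and \<open>f = \<phi>\<^sub>\<rho> - m \<ge> 0\<close>. Every admissible displacement pays at least the energy
\<open>2 \<pi> m\<^sup>2\<close>, and the excess over it controls everything that is needed. The hoop strain is
\<open>\<epsilon>\<^sub>\<theta>\<^sub>\<theta> = \<partial>\<^sub>\<theta> \<phi>\<^sub>\<theta> + (\<partial>\<^sub>\<theta> f)\<^sup>2 / 2 + f + m\<close>; expand its square around \<open>m\<close> and use that the periodic function
\<open>\<phi>\<^sub>\<theta>\<close> has a \<open>\<theta>\<close>-derivative of mean zero. The result is
\<open>E \<ge> 2 \<pi> m\<^sup>2 + \<integral> 2 m f + \<epsilon>\<^sub>z\<^sub>z\<^sup>2 + h\<^sup>2 (\<partial>\<^sub>z\<^sup>2 f)\<^sup>2\<close> (lemma \<open>slope_bound\<close>).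

The compression \<open>lam\<close> has to be absorbed on almost every line of constant \<open>\<theta>\<close>: the mean of \<open>\<epsilon>\<^sub>z\<^sub>z\<close> over
such a line is \<open>P / 2 - lam\<close> with \<open>P = \<integral> (\<partial>\<^sub>z f)\<^sup>2\<close>, so that a small excess forces \<open>P \<ge> lam\<close> on a suitable
line. With \<open>a = \<integral> f\<close>, \<open>b = \<integral> (\<partial>\<^sub>z\<^sup>2 f)\<^sup>2\<close> and \<open>L = sup \<bar>\<partial>\<^sub>z f\<bar>\<close> on that line, integration by parts gives
\<open>P = - \<integral> f \<partial>\<^sub>z\<^sup>2 f\<close>, where \<open>f\<close> may be replaced by \<open>f - min f\<close>, whose square is at most \<open>2 L a\<close>; hence
\<open>P\<^sup>4 \<le> 2 L a\<^sup>3 b\<^sup>2\<close> (lemma \<open>interpolation_1d\<close>). If the excess is at most \<open>\<delta>\<close>, then \<open>a \<le> \<delta> / (2 m)\<close> and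
\<open>b \<le> \<delta> / h\<^sup>2\<close> on a suitable line, and a lower bound for \<open>L\<close> in terms of \<open>\<delta>\<close> results.

An upper bound for the excess of a minimizer comes from a competitor: one axisymmetric outward fold of
width \<open>s\<close> and height about \<open>(lam s)\<^sup>1\<^sup>/\<^sup>2\<close>, which absorbs all of the compression without
axial strain (lemma \<open>single_fold_competitor\<close>). Its excess is of the order
\<open>m lam\<^sup>1\<^sup>/\<^sup>2 s\<^sup>3\<^sup>/\<^sup>2 + lam s\<^sup>2 + h\<^sup>2 lam / s\<^sup>2\<close>. The choice \<open>m\<^sup>2 s\<^sup>7 = h\<^sup>4 lam\<close> makes the first and the last term
equal, and \<open>m \<ge> lam\<^sup>1\<^sup>/\<^sup>2 h\<^sup>1\<^sup>/\<^sup>4\<close> means \<open>s\<^sup>2 \<le> h\<close>, so that the middle term does not exceed them. With \<open>\<delta>\<close> a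
multiple of \<open>h\<^sup>2 lam / s\<^sup>2\<close> the lower bound for \<open>L\<close> becomes a multiple of the square root of \<open>lam / s\<close>,
which is the asserted rate; and \<open>\<delta>\<close> is small compared with \<open>lam\<^sup>2\<close> exactly because
\<open>h\<close> is small compared with \<open>m\<^sup>-\<^sup>2\<^sup>/\<^sup>3 lam\<^sup>3\<^sup>/\<^sup>2\<close>.

Weak derivatives are known only through integrals against test functions. Smooth cutoffs and the
fundamental lemma of the calculus of variations identify the derivatives selected in the energy up to
null sets (lemma \<open>wderiv_eq\<close>), and the restriction of a function to almost every line is recovered from
its weak derivative as an indefinite integral (lemma \<open>line_representation\<close>). Only test functions that
are products of functions of one variable are ever used to extract information.\<close>

section \<open>Smooth functions of one variable\<close>

primrec C_k_real :: "nat \<Rightarrow> (real \<Rightarrow> real) \<Rightarrow> bool" where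
  "C_k_real 0 f \<longleftrightarrow> continuous_on UNIV f"
| "C_k_real (Suc k) f \<longleftrightarrow> (\<exists>g. (\<forall>x. (f has_real_derivative g x) (at x)) \<and> C_k_real k g)"

definition smooth :: "(real \<Rightarrow> real) \<Rightarrow> bool" where
  "smooth f \<longleftrightarrow> (\<forall>k. C_k_real k f)"

lemma C_k_realE:
  assumes "C_k_real (Suc k) f"
  obtains g where "\<And>x. (f has_real_derivative g x) (at x)" "C_k_real k g"
  using assms by auto

lemma C_k_realI: "(\<And>x. (f has_real_derivative g x) (at x)) \<Longrightarrow> C_k_real k g \<Longrightarrow> C_k_real (Suc k) f"
  by auto

lemma C_k_real_Suc_imp: "C_k_real (Suc k) f \<Longrightarrow> C_k_real k f"
proof (induction k arbitrary: f)
  case 0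
  obtain g where "\<And>x. (f has_real_derivative g x) (at x)" using C_k_realE[OF 0] by blast
  then have "continuous_on UNIV f"
    by (intro DERIV_continuous_on[OF has_field_derivative_at_within])
  then show ?case by simp
next
  case (Suc k)
  obtain g where g: "\<And>x. (f has_real_derivative g x) (at x)" "C_k_real (Suc k) g"
    using C_k_realE[OF Suc.prems] by blast
  then have "C_k_real k g" using Suc.IH by blast
  with g(1) show ?case by auto
qed

lemma smooth_antiderivative:
  assumes "\<And>x. (f has_real_derivative g x) (at x)" "smooth g"
  shows "smooth f"
  unfolding smooth_def
proof
  fix k
  have "C_k_real (Suc k) f" using C_k_realI[OF assms(1)] assms(2) unfolding smooth_def by blast
  then show "C_k_real k f" by (rule C_k_real_Suc_imp)
qed

lemma smooth_derivative:
  assumes "\<And>x. (f has_real_derivative g x) (at x)" "smooth f"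
  shows "smooth g"
  unfolding smooth_def
proof
  fix k
  obtain g' where g': "\<And>x. (f has_real_derivative g' x) (at x)" "C_k_real k g'"
    using assms(2) C_k_realE[of k f] unfolding smooth_def by blast
  have "g = g'" using assms(1) g'(1) DERIV_unique by blast
  then show "C_k_real k g" using g' by simp
qed

lemma smooth_has_derivative:
  assumes "smooth f"
  obtains g where "\<And>x. (f has_real_derivative g x) (at x)" "smooth g"
proof -
  have "C_k_real (Suc 0) f" using assms smooth_def by blast
  from C_k_realE[OF this] obtain g where "\<And>x. (f has_real_derivative g x) (at x)" by blast
  with smooth_derivative[OF this assms] that show ?thesis by blast
qed

lemma smooth_continuous: "smooth f \<Longrightarrow> continuous_on A f"
  unfolding smooth_def using C_k_real.simps(1) continuous_on_subset subset_UNIV by blast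

lemma C_k_real_const: "C_k_real k (\<lambda>_. c)"
proof (induction k arbitrary: c)
  case (Suc k)
  show ?case by (rule C_k_realI[OF _ Suc.IH[of 0]]) simp
qed simp

lemma C_k_real_add: "C_k_real k f \<Longrightarrow> C_k_real k g \<Longrightarrow> C_k_real k (\<lambda>x. f x + g x)"
proof (induction k arbitrary: f g)
  case 0 then show ?case using continuous_on_add by simp
next
  case (Suc k)
  obtain f' where f': "\<And>x. (f has_real_derivative f' x) (at x)" "C_k_real k f'"
    using C_k_realE[OF Suc.prems(1)] by blast
  obtain g' where g': "\<And>x. (g has_real_derivative g' x) (at x)" "C_k_real k g'"
    using C_k_realE[OF Suc.prems(2)] by blast
  show ?case by (rule C_k_realI[OF DERIV_add[OF f'(1) g'(1)] Suc.IH[OF f'(2) g'(2)]])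
qed

lemma C_k_real_mult: "C_k_real k f \<Longrightarrow> C_k_real k g \<Longrightarrow> C_k_real k (\<lambda>x. f x * g x)"
proof (induction k arbitrary: f g)
  case 0 then show ?case using continuous_on_mult by simp
next
  case (Suc k)
  obtain f' where f': "\<And>x. (f has_real_derivative f' x) (at x)" "C_k_real k f'"
    using C_k_realE[OF Suc.prems(1)] by blast
  obtain g' where g': "\<And>x. (g has_real_derivative g' x) (at x)" "C_k_real k g'"
    using C_k_realE[OF Suc.prems(2)] by blast
  have "C_k_real k (\<lambda>x. f x * g' x + f' x * g x)"
    by (rule C_k_real_add[OF Suc.IH[OF C_k_real_Suc_imp[OF Suc.prems(1)] g'(2)] Suc.IH[OF f'(2) C_k_real_Suc_imp[OF Suc.prems(2)]]])
  then show ?case by (rule C_k_realI[OF DERIV_mult'[OF f'(1) g'(1)]])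
qed

lemma smooth_const: "smooth (\<lambda>_. c)"
  and smooth_add: "smooth f \<Longrightarrow> smooth g \<Longrightarrow> smooth (\<lambda>x. f x + g x)"
  and smooth_mult: "smooth f \<Longrightarrow> smooth g \<Longrightarrow> smooth (\<lambda>x. f x * g x)"
  by (auto simp: smooth_def C_k_real_const C_k_real_add C_k_real_mult)

lemma smooth_cmult: "smooth f \<Longrightarrow> smooth (\<lambda>x. c * f x)"
  by (intro smooth_mult smooth_const)

lemma smooth_diff: "smooth f \<Longrightarrow> smooth g \<Longrightarrow> smooth (\<lambda>x. f x - g x)"
  using smooth_add[of f "\<lambda>x. (-1) * g x"] smooth_cmult[of g "-1"] by simp

lemma smooth_affine:
  assumes "smooth f" shows "smooth (\<lambda>x. f (c * x + d))"
proof -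
  have "C_k_real k f \<Longrightarrow> C_k_real k (\<lambda>x. f (c * x + d))" for k and f :: "real \<Rightarrow> real"
  proof (induction k arbitrary: f)
    case 0
    have "continuous_on UNIV (\<lambda>x. c * x + d)" by (intro continuous_intros)
    from continuous_on_compose2[OF 0[unfolded C_k_real.simps] this] show ?case by simp
  next
    case (Suc k)
    obtain f' where *: "\<And>x. (f has_real_derivative f' x) (at x)" "C_k_real k f'"
      using C_k_realE[OF Suc.prems] by blast
    have "((\<lambda>x. f (c * x + d)) has_real_derivative c * f' (c * x + d)) (at x)" for x
    proof -
      have "((\<lambda>x. c * x + d) has_real_derivative c) (at x)"
        by (auto intro!: derivative_eq_intros)
      from DERIV_chain2[OF *(1) this] show ?thesis by (simp add: mult.commute)
    qed
    then show ?case by (rule C_k_realI[OF _ C_k_real_mult[OF C_k_real_const Suc.IH[OF *(2)]]])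
  qed
  with assms show ?thesis by (auto simp: smooth_def)
qed

text \<open>Up to linear combinations this family is closed under differentiation, so that one induction over the
order of differentiability, with \<open>n\<close> arbitrary, shows that every member is smooth.\<close>

definition flat :: "nat \<Rightarrow> real \<Rightarrow> real" where
  "flat n x = (if x > 0 then (1 / x) ^ n * exp (- (1 / x)) else 0)"

lemma flat_tendsto_0: "(flat n \<longlongrightarrow> 0) (at_right 0)"
proof -
  have "((\<lambda>y::real. y ^ n / exp y) \<longlongrightarrow> 0) at_top"
    by (rule tendsto_power_div_exp_0)
  moreover have "filterlim (\<lambda>x::real. 1 / x) at_top (at_right 0)"
    using filterlim_inverse_at_top_right by (simp add: inverse_eq_divide)
  ultimately have "((\<lambda>x::real. (1/x) ^ n / exp (1/x)) \<longlongrightarrow> 0) (at_right 0)"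
    by (rule filterlim_compose)
  moreover have "\<forall>\<^sub>F x in at_right 0. (1/x) ^ n / exp (1/x) = flat n x"
    unfolding eventually_at_filter by (auto simp: flat_def exp_minus field_simps)
  ultimately show ?thesis by (rule Lim_transform_eventually)
qed

text \<open>At the origin the difference quotient is \<open>flat (n + 1)\<close> on the right, which tends to zero because the
exponential beats every power, and zero on the left.\<close>

lemma flat_has_derivative:
  "(flat n has_real_derivative flat (n + 2) x - real n * flat (n + 1) x) (at x)"
proof -
  consider "x > 0" | "x < 0" | "x = 0" by linarith
  then show ?thesis
  proof cases
    case 1
    have "((\<lambda>x. (1 / x) ^ n * exp (- (1 / x))) has_real_derivative
            flat (n + 2) x - real n * flat (n + 1) x) (at x)"
    proof -
      have i: "((\<lambda>x. 1 / x) has_real_derivative - ((1 / x)\<^sup>2)) (at x)"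
        using DERIV_inverse[of x UNIV] 1 by (simp add: inverse_eq_divide power2_eq_square)
      have e: "((\<lambda>x. exp (- (1 / x))) has_real_derivative exp (- (1 / x)) * (1 / x)\<^sup>2) (at x)"
        using DERIV_chain2[OF DERIV_exp DERIV_minus[OF i]] by simp
      have p: "((\<lambda>x. (1 / x) ^ n) has_real_derivative - (real n * (1 / x) ^ (n + 1))) (at x)"
        using DERIV_power[OF i, of n] by (cases n) (simp_all add: power2_eq_square algebra_simps)
      have "(1 / x) ^ n * (exp (- (1 / x)) * (1 / x)\<^sup>2) + - (real n * (1 / x) ^ (n + 1)) * exp (- (1 / x))
          = flat (n + 2) x - real n * flat (n + 1) x"
        using 1 by (simp add: flat_def power_add power2_eq_square)
      with DERIV_mult'[OF p e] show ?thesis by simp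
    qed
    then show ?thesis
      by (rule has_field_derivative_transform_within_open[of _ _ _ "{0<..}"])
         (use 1 in \<open>auto simp: flat_def\<close>)
  next
    case 2
    have "((\<lambda>x. 0) has_real_derivative flat (n + 2) x - real n * flat (n + 1) x) (at x)"
      using 2 by (auto simp: flat_def)
    then show ?thesis
      by (rule has_field_derivative_transform_within_open[of _ _ _ "{..<0}"])
         (use 2 in \<open>auto simp: flat_def\<close>)
  next
    case 3
    have "((\<lambda>y. flat n y / y) \<longlongrightarrow> 0) (at_right 0)"
    proof (rule Lim_transform_eventually[OF flat_tendsto_0[of "Suc n"]])
      show "\<forall>\<^sub>F x in at_right 0. flat (Suc n) x = flat n x / x"
        unfolding eventually_at_filter by (auto simp: flat_def field_simps)
    qed
    moreover have "((\<lambda>y. flat n y / y) \<longlongrightarrow> 0) (at_left 0)"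
      by (rule Lim_transform_eventually[OF tendsto_const])
         (auto simp: eventually_at_filter flat_def)
    ultimately have "((\<lambda>y. flat n y / y) \<longlongrightarrow> 0) (at 0)"
      by (simp add: filterlim_split_at)
    then show ?thesis unfolding 3 by (simp add: DERIV_def flat_def)
  qed
qed

lemma smooth_flat: "smooth (flat n)"
  unfolding smooth_def
proof
  fix k show "C_k_real k (flat n)"
  proof (induction k arbitrary: n)
    case 0
    have "continuous_on UNIV (flat n)"
      by (rule DERIV_continuous_on[OF has_field_derivative_at_within[OF flat_has_derivative]])
    then show ?case by simp
  next
    case (Suc k)
    have "C_k_real k (\<lambda>x. flat (n + 2) x + (- real n) * flat (n + 1) x)"
      by (intro C_k_real_add C_k_real_mult C_k_real_const Suc.IH)
    then show ?case using C_k_realI[OF flat_has_derivative[of n]] by simp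
  qed
qed

definition is_unit_step :: "(real \<Rightarrow> real) \<Rightarrow> bool" where
  "is_unit_step H \<longleftrightarrow> smooth H \<and> (\<forall>x\<le>0. H x = 0) \<and> (\<forall>x\<ge>1. H x = 1) \<and> (\<forall>x. 0 \<le> H x \<and> H x \<le> 1)"

text \<open>The function \<open>flat 0 x * flat 0 (1 - x)\<close> is a smooth bump on the unit interval; its normalized
antiderivative is the step.\<close>

lemma unit_step_exists: "\<exists>H. is_unit_step H"
proof -
  define b where "b x = flat 0 x * flat 0 (-1 * x + 1)" for x
  have sb: "smooth b" unfolding b_def
    by (intro smooth_mult smooth_flat smooth_affine)
  have b0: "b x \<ge> 0" for x by (simp add: b_def flat_def)
  have bpos: "b x > 0" if "0 < x" "x < 1" for x using that by (simp add: b_def flat_def)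
  have bz: "b x = 0" if "x \<le> 0 \<or> x \<ge> 1" for x using that by (auto simp: b_def flat_def)
  have "continuous_on UNIV b" using sb smooth_continuous by blast
  then have "\<exists>F. \<forall>x. -\<infinity> < ereal x \<longrightarrow> ereal x < \<infinity> \<longrightarrow> (F has_vector_derivative b x) (at x)"
    by (intro einterval_antiderivative) (auto simp: continuous_on_eq_continuous_at)
  then obtain F where F: "\<And>x. (F has_real_derivative b x) (at x)"
    by (auto simp: has_real_derivative_iff_has_vector_derivative)
  have mono: "F x \<le> F y" if "x \<le> y" for x y
    by (rule DERIV_nonneg_imp_nondecreasing[OF that]) (use F b0 in blast)
  have lt: "F 0 < F 1"
  proof (rule DERIV_pos_imp_increasing_open[OF zero_less_one])
    show "\<And>x. 0 < x \<Longrightarrow> x < 1 \<Longrightarrow> \<exists>y. (F has_real_derivative y) (at x) \<and> 0 < y"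
      using F bpos by blast
    show "continuous_on {0..1} F"
      by (rule DERIV_continuous_on[OF has_field_derivative_at_within[OF F]])
  qed
  have antimono: "F y \<le> F x" if "x \<le> y" "\<And>t. x \<le> t \<Longrightarrow> t \<le> y \<Longrightarrow> b t = 0" for x y
  proof (rule DERIV_nonpos_imp_nonincreasing[OF that(1)])
    fix t assume "x \<le> t" "t \<le> y"
    then show "\<exists>d. (F has_real_derivative d) (at t) \<and> d \<le> 0"
      using F[of t] that(2)[of t] by auto
  qed
  have c0: "F x = F 0" if "x \<le> 0" for x
    using mono[OF that] antimono[OF that] bz by (simp add: antisym)
  have c1: "F x = F 1" if "x \<ge> 1" for x
    using mono[OF that] antimono[OF that] bz by (simp add: antisym)
  define H where "H x = (1 / (F 1 - F 0)) * (F x - F 0)" for x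
  have "is_unit_step H"
    unfolding is_unit_step_def
  proof (intro conjI allI impI)
    show "smooth H" unfolding H_def
      by (intro smooth_cmult smooth_diff smooth_const smooth_antiderivative[OF F sb])
    show "H x = 0" if "x \<le> 0" for x using c0[OF that] by (simp add: H_def)
    show "H x = 1" if "1 \<le> x" for x using c1[OF that] lt by (simp add: H_def)
    show "0 \<le> H x" for x
      using mono[of 0 x] c0[of x] lt by (cases "x \<le> 0") (auto simp: H_def)
    show "H x \<le> 1" for x
      using mono[of x 1] c1[of x] lt by (cases "x \<ge> 1") (auto simp: H_def)
  qed
  then show ?thesis by blast
qed

lemma box_real2: "box (a, c) (b, d) = {a<..<b} \<times> {c<..<d::real}" for a b :: real
  by (auto simp: mem_box Basis_prod_def)

lemma DERIV_locally_constant: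
  fixes f :: "real \<Rightarrow> real"
  assumes d: "(f has_real_derivative d) (at x)" and S: "open S" "x \<in> S" and c: "\<And>y. y \<in> S \<Longrightarrow> f y = c"
  shows "d = 0"
proof -
  have "((\<lambda>_. c) has_real_derivative 0) (at x)" by simp
  then have "(f has_real_derivative 0) (at x)"
    by (rule has_field_derivative_transform_within_open[OF _ S]) (use c in auto)
  then show ?thesis using DERIV_unique[OF d] by blast
qed

definition unit_step :: "real \<Rightarrow> real" where
  "unit_step = (SOME H. is_unit_step H)"

definition step :: "real \<Rightarrow> real \<Rightarrow> real \<Rightarrow> real" where
  "step a b x = unit_step ((x - a) / (b - a))"

lemma unit_step:
  "smooth unit_step" "x \<le> 0 \<Longrightarrow> unit_step x = 0" "x \<ge> 1 \<Longrightarrow> unit_step x = 1"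
  "0 \<le> unit_step x" "unit_step x \<le> 1"
proof -
  have "is_unit_step unit_step"
    using unit_step_exists unfolding unit_step_def by (rule someI_ex)
  then show "smooth unit_step" "x \<le> 0 \<Longrightarrow> unit_step x = 0" "x \<ge> 1 \<Longrightarrow> unit_step x = 1"
    "0 \<le> unit_step x" "unit_step x \<le> 1"
    by (simp_all add: is_unit_step_def)
qed

lemma smooth_step: "smooth (step a b)"
proof -
  have "step a b = (\<lambda>x. unit_step (1 / (b - a) * x + (- a / (b - a))))"
    by (rule ext) (simp add: step_def diff_divide_distrib)
  then show ?thesis by (simp only: smooth_affine[OF unit_step(1)])
qed

lemma step_bounds: "0 \<le> step a b x" "step a b x \<le> 1"
  by (simp_all add: step_def unit_step)

lemma step_eq_0: "a < b \<Longrightarrow> x \<le> a \<Longrightarrow> step a b x = 0"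
  by (simp add: step_def unit_step(2) divide_nonpos_pos)

lemma step_eq_1: "a < b \<Longrightarrow> b \<le> x \<Longrightarrow> step a b x = 1"
  by (simp add: step_def unit_step(3))

text \<open>The transition layer shrinks to the point \<open>a\<close> from the right and from the left, respectively. The
convergence holds at every point, hence the different limits at \<open>a\<close> itself.\<close>

lemma step_tendsto:
  "(\<lambda>n. step a (a + inverse (real (Suc n))) x) \<longlonglongrightarrow> indicator {a<..} x"
  "(\<lambda>n. step (a - inverse (real (Suc n))) a x) \<longlonglongrightarrow> indicator {a..} x"
proof -
  have small: "\<forall>\<^sub>F n in sequentially. inverse (real (Suc n)) < e" if "0 < e" for e :: real
    using order_tendstoD(2)[OF LIMSEQ_inverse_real_of_nat that] .
  show "(\<lambda>n. step a (a + inverse (real (Suc n))) x) \<longlonglongrightarrow> indicator {a<..} x"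
  proof (cases "x \<le> a")
    case False
    then have "\<forall>\<^sub>F n in sequentially. step a (a + inverse (real (Suc n))) x = indicator {a<..} x"
      using small[of "x - a"] by (auto elim!: eventually_mono intro!: step_eq_1)
    then show ?thesis by (rule tendsto_eventually)
  qed (simp add: step_eq_0)
  show "(\<lambda>n. step (a - inverse (real (Suc n))) a x) \<longlonglongrightarrow> indicator {a..} x"
  proof (cases "a \<le> x")
    case False
    then have "\<forall>\<^sub>F n in sequentially. step (a - inverse (real (Suc n))) a x = indicator {a..} x"
      using small[of "a - x"] by (auto elim!: eventually_mono intro!: step_eq_0)
    then show ?thesis by (rule tendsto_eventually)
  qed (simp add: step_eq_1)
qed

lemma step_derivative:
  assumes "a < b"
  obtains j where "\<And>x. (step a b has_real_derivative j x) (at x)" "smooth j" "\<And>x. x \<notin> {a..b} \<Longrightarrow> j x = 0"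
proof -
  obtain j where j: "\<And>x. (step a b has_real_derivative j x) (at x)" "smooth j"
    using smooth_has_derivative[OF smooth_step] by blast
  have "j x = 0" if "x \<notin> {a..b}" for x
  proof (cases "x < a")
    case True
    show ?thesis by (rule DERIV_locally_constant[OF j(1), of "{..<a}"]) (use True assms step_eq_0 in auto)
  next
    case False
    show ?thesis by (rule DERIV_locally_constant[OF j(1), of "{b<..}"]) (use False that assms step_eq_1 in auto)
  qed
  with j show ?thesis by (rule that)
qed

text \<open>Approximation of the indicator of an open interval from inside: since the support never leaves
\<open>{a..b}\<close>, the cutoffs are test functions in every open set around that interval.\<close>

definition cutoff :: "real \<Rightarrow> real \<Rightarrow> nat \<Rightarrow> real \<Rightarrow> real" where
  "cutoff a b n x = step a (a + inverse (real (Suc n))) x * (1 - step (b - inverse (real (Suc n))) b x)"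

lemma cutoff:
  "smooth (cutoff a b n)" "0 \<le> cutoff a b n x" "cutoff a b n x \<le> 1"
  "x \<notin> {a<..<b} \<Longrightarrow> cutoff a b n x = 0" "(\<lambda>n. cutoff a b n x) \<longlonglongrightarrow> indicator {a<..<b} x"
proof -
  show "smooth (cutoff a b n)" unfolding cutoff_def
    by (intro smooth_mult smooth_diff smooth_const smooth_step)
  show "0 \<le> cutoff a b n x" "cutoff a b n x \<le> 1"
    unfolding cutoff_def by (auto intro!: mult_le_one simp: step_bounds)
  show "x \<notin> {a<..<b} \<Longrightarrow> cutoff a b n x = 0"
    by (cases "x \<le> a") (simp_all add: cutoff_def step_eq_0 step_eq_1)
  have "(\<lambda>n. cutoff a b n x) \<longlonglongrightarrow> indicator {a<..} x * (1 - indicator {b..} x)"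
    unfolding cutoff_def by (intro tendsto_mult tendsto_diff tendsto_const step_tendsto)
  moreover have "indicator {a<..} x * (1 - indicator {b..} x) = (indicator {a<..<b} x :: real)"
    by (auto simp: indicator_def)
  ultimately show "(\<lambda>n. cutoff a b n x) \<longlonglongrightarrow> indicator {a<..<b} x" by simp
qed

lemma borel_measurable_fst_snd [measurable]:
  "(fst :: real \<times> real \<Rightarrow> real) \<in> borel_measurable borel"
  "(snd :: real \<times> real \<Rightarrow> real) \<in> borel_measurable borel"
  by (intro borel_measurable_continuous_onI continuous_intros)+

section \<open>The fundamental lemma of the calculus of variations\<close>

lemma integral_UNIV_boxes:
  fixes f :: "'a::euclidean_space \<Rightarrow> real"
  assumes f: "integrable lborel f" and z: "\<And>p q. (LBINT x. indicator (box p q) x * f x) = 0"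
  shows "(LBINT x. f x) = 0"
proof -
  define B :: "nat \<Rightarrow> 'a set" where "B n = box (- real n *\<^sub>R One) (real n *\<^sub>R One)" for n
  have "(\<lambda>n. \<integral>x. indicator (B n) x * f x \<partial>lborel) \<longlonglongrightarrow> (LBINT x. f x)"
  proof (rule integral_dominated_convergence[where w="\<lambda>x. norm (f x)"])
    show "AE x in lborel. (\<lambda>n. indicator (B n) x * f x) \<longlonglongrightarrow> f x"
    proof (rule AE_I2)
      fix x :: 'a
      obtain N :: nat where "norm x < real N" using reals_Archimedean2 by blast
      have "x \<in> B n" if "n \<ge> N" for n
        unfolding B_def mem_box
      proof
        fix i :: 'a assume i: "i \<in> Basis"
        have "One \<bullet> i = 1" using i by (simp add: inner_sum_left_Basis)
        moreover have "\<bar>x \<bullet> i\<bar> < real n"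
          using Basis_le_norm[OF i, of x] \<open>norm x < real N\<close> \<open>n \<ge> N\<close>
            of_nat_le_iff[of N n, where 'a=real] by linarith
        ultimately show "(- real n *\<^sub>R One) \<bullet> i < x \<bullet> i \<and> x \<bullet> i < (real n *\<^sub>R One) \<bullet> i"
          by (auto simp: abs_less_iff)
      qed
      then have "\<forall>\<^sub>F n in sequentially. indicator (B n) x * f x = f x"
        unfolding eventually_sequentially by (intro exI[of _ N]) auto
      then show "(\<lambda>n. indicator (B n) x * f x) \<longlonglongrightarrow> f x" by (rule tendsto_eventually)
    qed
  qed (use f in \<open>auto simp: B_def indicator_def\<close>)
  moreover have "(LBINT x. indicator (B n) x * f x) = 0" for n
    unfolding B_def by (rule z)
  ultimately show ?thesis by (simp add: LIMSEQ_const_iff)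
qed

text \<open>Boxes generate the Borel sets and are stable under intersection, so the vanishing of the integrals
extends from boxes to all Borel sets.\<close>

lemma AE_zero_if_box_integrals_zero:
  fixes f :: "'a::euclidean_space \<Rightarrow> real"
  assumes f: "integrable lborel f" and z: "\<And>p q. (LBINT x. indicator (box p q) x * f x) = 0"
  shows "AE x in lborel. f x = 0"
proof (rule sigma_finite_measure.density_zero[OF sigma_finite_lborel f])
  fix A :: "'a set" assume "A \<in> sets lborel"
  have fA: "integrable lborel (\<lambda>x. indicator A x * f x)" if "A \<in> sets borel" for A
    using integrable_mult_indicator[of A lborel f] f that by simp
  have "Int_stable (range (\<lambda>(a, b). box a b :: 'a set))"
    by (auto simp: Int_stable_def box_Int_box)
  moreover have "(range (\<lambda>(a, b). box a b :: 'a set)) \<subseteq> Pow UNIV" by auto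
  moreover have "A \<in> sigma_sets UNIV (range (\<lambda>(a, b). box a b))"
    using \<open>A \<in> sets lborel\<close> unfolding sets_lborel borel_eq_box by simp
  ultimately have "(LBINT x. indicator A x * f x) = 0"
  proof (induction rule: sigma_sets_induct_disjoint)
    case (basic A) then show ?case using z by auto
  next
    case empty then show ?case by simp
  next
    case (compl A)
    then have A: "A \<in> sets borel" by (simp add: borel_eq_box)
    have "(LBINT x. indicator (UNIV - A) x * f x) = (LBINT x. f x - indicator A x * f x)"
      by (rule Bochner_Integration.integral_cong) (auto simp: indicator_def)
    also have "\<dots> = 0"
      using compl integral_UNIV_boxes[OF f z] by (simp add: Bochner_Integration.integral_diff[OF f fA[OF A]])
    finally show ?case .
  next
    case (union F)
    then have F: "\<And>i. F i \<in> sets lborel" by (simp add: borel_eq_box subset_eq)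
    have si: "set_integrable lborel (\<Union>i. F i) f"
      unfolding set_integrable_def using f F
      by (intro integrable_mult_indicator) auto
    have "(\<Sum>i. set_lebesgue_integral lborel (F i) f) = set_lebesgue_integral lborel (\<Union>i. F i) f"
      by (rule lebesgue_integral_countable_add[symmetric, OF _ _ si])
        (use F union.hyps in \<open>auto simp: disjoint_family_on_def\<close>)
    then show ?case using union by (simp add: set_lebesgue_integral_def)
  qed
  then show "set_lebesgue_integral lborel A f = 0" by (simp add: set_lebesgue_integral_def)
qed

text \<open>Products of one-dimensional cutoffs converge boundedly to the indicator of a box. Only such products are
tested, since the derivative of a product in a coordinate direction is again a product.\<close>

lemma tensor_fundamental_lemma:
  fixes D :: "real \<times> real \<Rightarrow> real"
  assumes D: "integrable lborel D"
    and z: "\<And>\<psi> \<eta>. smooth \<psi> \<Longrightarrow> smooth \<eta> \<Longrightarrow> (\<And>x. x \<notin> {a<..<b} \<Longrightarrow> \<psi> x = 0) \<Longrightarrow>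
      (\<And>x. x \<notin> {c<..<d} \<Longrightarrow> \<eta> x = 0) \<Longrightarrow> (LBINT p. D p * (\<psi> (fst p) * \<eta> (snd p))) = 0"
  shows "AE p in lborel. p \<in> {a<..<b} \<times> {c<..<d} \<longrightarrow> D p = 0"
proof -
  have [measurable]: "cutoff a b n \<in> borel_measurable borel" for a b n
    by (intro borel_measurable_continuous_onI smooth_continuous cutoff)
  have [measurable]: "D \<in> borel_measurable borel" using D by auto
  define D' where "D' p = indicator (box (a, c) (b, d)) p * D p" for p
  have D': "integrable lborel D'"
    unfolding D'_def using integrable_mult_indicator[of "box (a,c) (b,d)" lborel D] D by simp
  have "(LBINT x. indicator (box p q) x * D' x) = 0" for p q
  proof -
    define s where "s = max (fst p) a" define t where "t = min (fst q) b"
    define u where "u = max (snd p) c" define v where "v = min (snd q) d"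
    have eq: "box p q \<inter> box (a, c) (b, d) = {s<..<t} \<times> {u<..<v}"
      by (cases p; cases q) (auto simp: box_real2 s_def t_def u_def v_def)
    have "(\<lambda>n. \<integral>x. D x * (cutoff s t n (fst x) * cutoff u v n (snd x)) \<partial>lborel) \<longlonglongrightarrow>
       (LBINT x. indicator (box p q) x * D' x)"
    proof (rule integral_dominated_convergence[where w="\<lambda>x. norm (D x)"])
      show "AE x in lborel. (\<lambda>n. D x * (cutoff s t n (fst x) * cutoff u v n (snd x))) \<longlonglongrightarrow> indicator (box p q) x * D' x"
      proof (rule AE_I2)
        fix x
        have "(\<lambda>n. D x * (cutoff s t n (fst x) * cutoff u v n (snd x))) \<longlonglongrightarrow>
          D x * (indicator {s<..<t} (fst x) * indicator {u<..<v} (snd x))"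
          by (intro tendsto_intros cutoff)
        moreover have "indicator (box p q) x * D' x = indicator (box p q \<inter> box (a, c) (b, d)) x * D x"
          by (simp add: D'_def indicator_inter_arith)
        moreover have "\<dots> = D x * (indicator {s<..<t} (fst x) * indicator {u<..<v} (snd x))"
          unfolding eq by (cases x) (simp add: indicator_times)
        ultimately show "(\<lambda>n. D x * (cutoff s t n (fst x) * cutoff u v n (snd x))) \<longlonglongrightarrow> indicator (box p q) x * D' x"
          by simp
      qed
      show "AE x in lborel. norm (D x * (cutoff s t n (fst x) * cutoff u v n (snd x))) \<le> norm (D x)" for n
      proof (rule AE_I2)
        fix x
        have "\<bar>cutoff s t n (fst x) * cutoff u v n (snd x)\<bar> \<le> 1"
          using cutoff(2,3) by (simp add: abs_mult mult_le_one)
        then show "norm (D x * (cutoff s t n (fst x) * cutoff u v n (snd x))) \<le> norm (D x)"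
          by (simp add: abs_mult[of "D x"] mult_left_le)
      qed
    qed (use D D' in \<open>auto simp: borel_measurable_integrable\<close>)
    moreover have "(LBINT x. D x * (cutoff s t n (fst x) * cutoff u v n (snd x))) = 0" for n
    proof (rule z[OF cutoff(1) cutoff(1)])
      show "cutoff s t n x = 0" if "x \<notin> {a<..<b}" for x
        by (rule cutoff(4)) (use that in \<open>auto simp: s_def t_def\<close>)
      show "cutoff u v n x = 0" if "x \<notin> {c<..<d}" for x
        by (rule cutoff(4)) (use that in \<open>auto simp: u_def v_def\<close>)
    qed
    ultimately show ?thesis by (simp add: LIMSEQ_const_iff)
  qed
  from AE_zero_if_box_integrals_zero[OF D' this]
  show ?thesis by eventually_elim (auto simp: D'_def box_real2)
qed

lemma integrable_mult_bounded:
  fixes R h :: "'a \<Rightarrow> real"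
  assumes R: "integrable M R" and h: "h \<in> borel_measurable M" and B: "\<And>x. \<bar>h x\<bar> \<le> B"
  shows "integrable M (\<lambda>x. R x * h x)"
proof (rule Bochner_Integration.integrable_bound)
  show "integrable M (\<lambda>x. B * R x)" using R by simp
  show "(\<lambda>x. R x * h x) \<in> borel_measurable M"
    using borel_measurable_integrable[OF R] h by (rule borel_measurable_times)
  show "AE x in M. norm (R x * h x) \<le> norm (B * R x)"
  proof (rule AE_I2)
    fix x
    have "\<bar>h x\<bar> \<le> \<bar>B\<bar>" using B[of x] by linarith
    then show "norm (R x * h x) \<le> norm (B * R x)"
      by (simp add: abs_mult mult.commute[of "\<bar>R x\<bar>"] mult_right_mono)
  qed
qed

lemma integral_indicator_singleton:
  fixes f :: "real \<Rightarrow> real"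
  shows "(LBINT s. indicator {a..a} s * f s) = 0"
proof -
  have "(\<lambda>s. indicator {a..a} s * f s) = (\<lambda>s. f a * indicator {a} s)" by (auto simp: indicator_def)
  then show ?thesis by simp
qed

lemma AE_measure_preserving:
  assumes f: "f \<in> M \<rightarrow>\<^sub>M N" and d: "distr M N f = N" and P: "AE y in N. P y"
  shows "AE x in M. P (f x)"
proof -
  obtain A where A: "{y \<in> space N. \<not> P y} \<subseteq> A" "emeasure N A = 0" "A \<in> sets N"
    using P by (auto elim!: AE_E)
  have "AE y in N. y \<notin> A" using A by (intro AE_not_in) auto
  then have "AE y in distr M N f. y \<notin> A" by (subst d)
  then have "AE x in M. f x \<notin> A" using A(3) by (subst (asm) AE_distr_iff[OF f]) auto
  then show ?thesis using AE_space by eventually_elim (use A(1) measurable_space[OF f] in auto)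
qed

text \<open>Because the Lebesgue measure is complete, \<open>g\<close> inherits measurability from \<open>f\<close>.\<close>

lemma lebesgue_integrable_cong_AE:
  fixes f g :: "'a::euclidean_space \<Rightarrow> real"
  assumes f: "integrable lebesgue f" and eq: "AE x in lebesgue. f x = g x"
  shows "integrable lebesgue g" "(\<integral>x. g x \<partial>lebesgue) = (\<integral>x. f x \<partial>lebesgue)"
proof -
  obtain N where N: "N \<in> null_sets lebesgue" "{x. f x \<noteq> g x} \<subseteq> N"
    using eq by (auto elim!: AE_E2 simp: eventually_ae_filter)
  have "f absolutely_integrable_on UNIV" using f by (simp add: set_integrable_def)
  then have "g absolutely_integrable_on UNIV"
    by (rule absolutely_integrable_spike[of _ _ N]) (use N in \<open>simp add: negligible_iff_null_sets\<close>, use N in force)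
  then show g: "integrable lebesgue g" by (simp add: set_integrable_def)
  show "(\<integral>x. g x \<partial>lebesgue) = (\<integral>x. f x \<partial>lebesgue)"
    by (rule integral_cong_AE) (use f g eq in \<open>auto intro: borel_measurable_integrable elim: eventually_mono\<close>)
qed

section \<open>Test functions and uniqueness of weak derivatives\<close>

lemma Basis_real2: "(Basis :: (real \<times> real) set) = {(1, 0), (0, 1)}"
  by (auto simp: Basis_prod_def)

definition tensor :: "(real \<Rightarrow> real) \<Rightarrow> (real \<Rightarrow> real) \<Rightarrow> real \<times> real \<Rightarrow> real" where
  "tensor \<psi> \<eta> p = \<psi> (fst p) * \<eta> (snd p)"

lemma tensor_has_derivative:
  assumes "\<And>x. (\<psi> has_real_derivative \<psi>' x) (at x)" "\<And>x. (\<eta> has_real_derivative \<eta>' x) (at x)"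
  shows "(tensor \<psi> \<eta> has_derivative (\<lambda>v. fst v * tensor \<psi>' \<eta> p + snd v * tensor \<psi> \<eta>' p)) (at p)"
proof -
  have 1: "((\<lambda>p. \<psi> (fst p)) has_derivative (\<lambda>v. \<psi>' (fst p) * fst v)) (at p)"
    using has_derivative_compose[OF has_derivative_fst[OF has_derivative_ident]
      assms(1)[unfolded has_field_derivative_def], of p UNIV] by simp
  have 2: "((\<lambda>p. \<eta> (snd p)) has_derivative (\<lambda>v. \<eta>' (snd p) * snd v)) (at p)"
    using has_derivative_compose[OF has_derivative_snd[OF has_derivative_ident]
      assms(2)[unfolded has_field_derivative_def], of p UNIV] by simp
  show ?thesis
    using has_derivative_mult[OF 1 2] unfolding tensor_def by (simp add: algebra_simps)
qed

lemma frechet_derivative_tensor: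
  assumes "\<And>x. (\<psi> has_real_derivative \<psi>' x) (at x)" "\<And>x. (\<eta> has_real_derivative \<eta>' x) (at x)"
  shows "frechet_derivative (tensor \<psi> \<eta>) (at p) (1, 0) = tensor \<psi>' \<eta> p"
    and "frechet_derivative (tensor \<psi> \<eta>) (at p) (0, 1) = tensor \<psi> \<eta>' p"
  using frechet_derivative_at[OF tensor_has_derivative[OF assms, of p], symmetric] by simp_all

lemma C_k_tensor: "C_k_real k \<psi> \<Longrightarrow> C_k_real k \<eta> \<Longrightarrow> C_k k (tensor \<psi> \<eta>)"
proof (induction k arbitrary: \<psi> \<eta>)
  case 0
  then have "continuous_on UNIV \<psi>" "continuous_on UNIV \<eta>" by auto
  then have "continuous_on UNIV (\<lambda>p :: real \<times> real. \<psi> (fst p))" "continuous_on UNIV (\<lambda>p :: real \<times> real. \<eta> (snd p))"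
    by (auto intro!: continuous_on_compose2[of UNIV \<psi> _ fst] continuous_on_compose2[of UNIV \<eta> _ snd]
        continuous_on_fst continuous_on_snd continuous_on_id)
  then show ?case unfolding tensor_def by (simp add: continuous_on_mult)
next
  case (Suc k)
  obtain \<psi>' where \<psi>': "\<And>x. (\<psi> has_real_derivative \<psi>' x) (at x)" "C_k_real k \<psi>'"
    using C_k_realE[OF Suc.prems(1)] by blast
  obtain \<eta>' where \<eta>': "\<And>x. (\<eta> has_real_derivative \<eta>' x) (at x)" "C_k_real k \<eta>'"
    using C_k_realE[OF Suc.prems(2)] by blast
  have "tensor \<psi> \<eta> differentiable at p" for p
    using tensor_has_derivative[OF \<psi>'(1) \<eta>'(1)] unfolding differentiable_def by blast
  moreover have "C_k k (tensor \<psi>' \<eta>)" "C_k k (tensor \<psi> \<eta>')"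
    using Suc.IH \<psi>'(2) \<eta>'(2) Suc.prems[THEN C_k_real_Suc_imp] by blast+
  ultimately show ?case
    by (simp add: Basis_real2 frechet_derivative_tensor[OF \<psi>'(1) \<eta>'(1)])
qed

lemma test_function_tensor:
  assumes "smooth \<psi>" "smooth \<eta>" "\<And>x. x \<notin> {a..b} \<Longrightarrow> \<psi> x = 0" "\<And>x. x \<notin> {c..d} \<Longrightarrow> \<eta> x = 0"
    and "{a..b} \<times> {c..d} \<subseteq> U"
  shows "test_function U (tensor \<psi> \<eta>)"
  unfolding test_function_def
proof (intro conjI allI exI[of _ "{a..b} \<times> {c..d}"] impI)
  show "C_k k (tensor \<psi> \<eta>)" for k using assms(1,2) C_k_tensor smooth_def by blast
  show "compact ({a..b} \<times> {c..d})" by (intro compact_Times compact_Icc)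
  show "tensor \<psi> \<eta> x = 0" if "x \<notin> {a..b} \<times> {c..d}" for x
    using that assms(3)[of "fst x"] assms(4)[of "snd x"] by (cases x) (auto simp: tensor_def)
qed (rule assms(5))

lemma interior_Omega: "interior Omega = {0<..<2 * pi} \<times> {- 1/2<..<1/2}"
  by (simp add: Omega_def interior_Times)

lemma AE_interior_Omega:
  assumes "AE x in lebesgue. x \<in> interior Omega \<longrightarrow> P x"
  shows "AE x in lebesgue. x \<in> Omega \<longrightarrow> P x"
proof -
  have "convex Omega" unfolding Omega_def by (intro convex_Times convex_real_interval)
  then have "negligible (frontier Omega)" by (rule negligible_convex_frontier)
  then have "AE x in lebesgue. x \<notin> frontier Omega"
    by (simp add: AE_not_in negligible_iff_null_sets)
  moreover have "closed Omega" unfolding Omega_def by (intro closed_Times closed_atLeastAtMost)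
  ultimately show ?thesis using assms
    by (auto elim!: eventually_elim2 simp: frontier_def closure_closed)
qed

lemma test_function_integrable:
  assumes g: "locally_integrable_on g U" and K: "compact K" "K \<subseteq> U"
    and z: "\<And>x. x \<notin> K \<Longrightarrow> h x = 0" and h: "continuous_on UNIV h"
  shows "integrable lebesgue (\<lambda>x. g x * h x)"
proof -
  have "g absolutely_integrable_on K" using g K by (auto simp: locally_integrable_on_def)
  then have gi: "integrable lebesgue (\<lambda>x. indicator K x * g x)" by (simp add: set_integrable_def)
  have "bounded (h ` K)" using K h compact_continuous_image compact_imp_bounded continuous_on_subset
    by (metis subset_UNIV)
  then obtain B where "\<forall>y\<in>h ` K. norm y \<le> B" unfolding bounded_iff by auto
  then have B: "\<bar>h x\<bar> \<le> \<bar>B\<bar>" for x using z[of x] by (cases "x \<in> K") force+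
  have "h \<in> borel_measurable lebesgue"
    using h by (intro measurable_completion) (simp add: borel_measurable_continuous_onI)
  then have "integrable lebesgue (\<lambda>x. (indicator K x * g x) * h x)"
    by (rule integrable_mult_bounded[OF gi _ B])
  moreover have "(\<lambda>x. (indicator K x * g x) * h x) = (\<lambda>x. g x * h x)"
  proof
    fix x show "(indicator K x * g x) * h x = g x * h x" using z[of x] by (cases "x \<in> K") auto
  qed
  ultimately show ?thesis by simp
qed

lemma test_functionE:
  assumes "test_function U \<psi>"
  obtains K where "compact K" "K \<subseteq> U" "\<And>x. x \<notin> K \<Longrightarrow> \<psi> x = 0"
    "\<And>x v. x \<notin> K \<Longrightarrow> frechet_derivative \<psi> (at x) v = 0"
    "continuous_on UNIV \<psi>" "\<And>v. v \<in> Basis \<Longrightarrow> continuous_on UNIV (\<lambda>x. frechet_derivative \<psi> (at x) v)"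
    "\<And>x. (\<psi> has_derivative frechet_derivative \<psi> (at x)) (at x)"
proof -
  obtain K where K: "compact K" "K \<subseteq> U" "\<And>x. x \<notin> K \<Longrightarrow> \<psi> x = 0"
    using assms by (auto simp: test_function_def)
  have C: "C_k 0 \<psi>" "C_k (Suc 0) \<psi>" using assms by (auto simp: test_function_def simp del: C_k.simps)
  have d: "(\<psi> has_derivative frechet_derivative \<psi> (at x)) (at x)" for x
  proof -
    have "\<psi> differentiable at x" using C(2) unfolding C_k.simps by blast
    then show ?thesis by (simp only: frechet_derivative_works)
  qed
  have "frechet_derivative \<psi> (at x) v = 0" if "x \<notin> K" for x v
  proof -
    have "open (- K)" using K(1) compact_imp_closed by blast
    then have "((\<lambda>_. 0) has_derivative (\<lambda>_. 0)) (at x)" by simp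
    then have "(\<psi> has_derivative (\<lambda>_. 0)) (at x)"
      by (rule has_derivative_transform_within_open[OF _ \<open>open (- K)\<close>]) (use that K(3) in auto)
    then show ?thesis using has_derivative_unique[OF d] by metis
  qed
  with K C d that show ?thesis by auto
qed

lemma set_integral_supported:
  "(\<And>x. x \<notin> U \<Longrightarrow> h x = (0::real)) \<Longrightarrow> (LINT x:U|M. h x) = (\<integral>x. h x \<partial>M)"
  unfolding set_lebesgue_integral_def
  by (rule Bochner_Integration.integral_cong) (auto simp: indicator_def)

lemma weak_derivative_integrals:
  assumes "has_weak_derivative U v f g" "test_function U \<psi>"
  shows "(\<integral>x. f x * frechet_derivative \<psi> (at x) v \<partial>lebesgue) = - (\<integral>x. g x * \<psi> x \<partial>lebesgue)"
proof -
  obtain K where K: "compact K" "K \<subseteq> U" "\<And>x. x \<notin> K \<Longrightarrow> \<psi> x = 0"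
    "\<And>x v. x \<notin> K \<Longrightarrow> frechet_derivative \<psi> (at x) v = 0"
    "continuous_on UNIV \<psi>" "\<And>v. v \<in> Basis \<Longrightarrow> continuous_on UNIV (\<lambda>x. frechet_derivative \<psi> (at x) v)"
    "\<And>x. (\<psi> has_derivative frechet_derivative \<psi> (at x)) (at x)"
    by (rule test_functionE[OF assms(2)]) (rule that; simp)
  have "(LINT x:U|lebesgue. f x * frechet_derivative \<psi> (at x) v) = - (LINT x:U|lebesgue. g x * \<psi> x)"
    using assms by (auto simp: has_weak_derivative_def)
  moreover have "(LINT x:U|lebesgue. f x * frechet_derivative \<psi> (at x) v) = (\<integral>x. f x * frechet_derivative \<psi> (at x) v \<partial>lebesgue)"
    by (rule set_integral_supported) (metis K(2,3,4) mult_zero_right subsetD)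
  moreover have "(LINT x:U|lebesgue. g x * \<psi> x) = (\<integral>x. g x * \<psi> x \<partial>lebesgue)"
    by (rule set_integral_supported) (metis K(2,3,4) mult_zero_right subsetD)
  ultimately show ?thesis by simp
qed

text \<open>Weak derivatives on the open rectangle are integrable only on compact subsets. The fundamental lemma is
applied on closed rectangles that exhaust it; the boundary of \<open>Omega\<close> is a null set.\<close>

lemma weak_derivative_unique:
  assumes 1: "has_weak_derivative (interior Omega) v f g" and 2: "has_weak_derivative (interior Omega) v f g'"
  shows "AE x in lebesgue. x \<in> Omega \<longrightarrow> g x = g' x"
proof -
  define U where "U = interior Omega"
  have li: "locally_integrable_on g U" "locally_integrable_on g' U"
    using 1 2 by (auto simp: has_weak_derivative_def U_def)
  have loc: "AE x in lebesgue. x \<in> {a<..<b} \<times> {c<..<d} \<longrightarrow> g x = g' x"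
    if abcd: "0 < a" "b < 2 * pi" "- 1/2 < c" "d < 1/2" for a b c d :: real
  proof -
    define K where "K = {a..b} \<times> {c..d}"
    have K: "compact K" "K \<subseteq> U" unfolding K_def U_def interior_Omega
      using abcd by (auto intro!: compact_Times)
    have "integrable lebesgue (\<lambda>x. indicator K x * g x)" "integrable lebesgue (\<lambda>x. indicator K x * g' x)"
      using li K unfolding locally_integrable_on_def set_integrable_def by auto
    then have Di: "integrable lebesgue (\<lambda>x. indicator K x * g x - indicator K x * g' x)" by auto
    then obtain D where D: "D \<in> borel_measurable lborel"
      "AE x in lborel. indicator K x * g x - indicator K x * g' x = D x"
      using completion_ex_borel_measurable_real[OF borel_measurable_integrable[OF Di]] by blast
    have D': "AE x in lebesgue. indicator K x * g x - indicator K x * g' x = D x"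
      using D(2) by (rule AE_completion)
    have "integrable lebesgue D" by (rule lebesgue_integrable_cong_AE[OF Di D'])
    then have D_int: "integrable lborel D" using integrable_completion D(1) by blast
    have "AE p in lborel. p \<in> {a<..<b} \<times> {c<..<d} \<longrightarrow> D p = 0"
    proof (rule tensor_fundamental_lemma[OF D_int])
      fix \<psi> \<eta> assume t: "smooth \<psi>" "smooth \<eta>" "\<And>x. x \<notin> {a<..<b} \<Longrightarrow> \<psi> x = 0" "\<And>x. x \<notin> {c<..<d} \<Longrightarrow> \<eta> x = 0"
      have tU: "test_function U (tensor \<psi> \<eta>)"
        by (rule test_function_tensor[of _ _ a b c d]) (use t K in \<open>auto simp: K_def\<close>)
      have cont: "continuous_on UNIV (tensor \<psi> \<eta>)" by (rule test_functionE[OF tU])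
      have z: "tensor \<psi> \<eta> x = 0" if "x \<notin> K" for x
        using that t(3)[of "fst x"] t(4)[of "snd x"] unfolding K_def by (cases x) (auto simp: tensor_def)
      note ints = test_function_integrable[OF li(1) K z cont] test_function_integrable[OF li(2) K z cont]
      have "(LBINT p. D p * (\<psi> (fst p) * \<eta> (snd p))) = (LBINT p. D p * tensor \<psi> \<eta> p)"
        by (simp add: tensor_def)
      also have "\<dots> = (\<integral>p. D p * tensor \<psi> \<eta> p \<partial>lebesgue)"
        using D(1) borel_measurable_continuous_onI[OF cont]
        by (intro integral_completion[symmetric] borel_measurable_times) auto
      also have "\<dots> = (\<integral>x. g x * tensor \<psi> \<eta> x - g' x * tensor \<psi> \<eta> x \<partial>lebesgue)"
      proof (rule lebesgue_integrable_cong_AE)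
        show "integrable lebesgue (\<lambda>x. g x * tensor \<psi> \<eta> x - g' x * tensor \<psi> \<eta> x)" using ints by simp
        show "AE x in lebesgue. g x * tensor \<psi> \<eta> x - g' x * tensor \<psi> \<eta> x = D x * tensor \<psi> \<eta> x"
          using D'
        proof eventually_elim
          case (elim x)
          show ?case
          proof (cases "x \<in> K")
            case True
            then have "D x = g x - g' x" using elim by simp
            then show ?thesis by (simp add: left_diff_distrib)
          next
            case False
            then show ?thesis using z[of x] by simp
          qed
        qed
      qed
      also have "\<dots> = (\<integral>x. g x * tensor \<psi> \<eta> x \<partial>lebesgue) - (\<integral>x. g' x * tensor \<psi> \<eta> x \<partial>lebesgue)"
        using ints by simp
      also have "\<dots> = 0"
        using weak_derivative_integrals[OF 1 tU[unfolded U_def]] weak_derivative_integrals[OF 2 tU[unfolded U_def]] by simp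
      finally show "(LBINT p. D p * (\<psi> (fst p) * \<eta> (snd p))) = 0" .
    qed
    then have "AE p in lebesgue. p \<in> {a<..<b} \<times> {c<..<d} \<longrightarrow> D p = 0" by (rule AE_completion)
    with D' show ?thesis
      by eventually_elim (auto simp: K_def indicator_def)
  qed
  have "AE x in lebesgue. \<forall>n::nat. x \<in> {1/(n+1)<..<2*pi - 1/(n+1)} \<times> {-1/2 + 1/(n+1)<..<1/2 - 1/(n+1)} \<longrightarrow> g x = g' x"
    unfolding AE_all_countable by (intro allI loc) auto
  then have "AE x in lebesgue. x \<in> interior Omega \<longrightarrow> g x = g' x"
  proof eventually_elim
    case (elim x)
    show ?case
    proof
      assume "x \<in> interior Omega"
      then obtain s t where x: "x = (s, t)" "0 < s" "s < 2*pi" "-1/2 < t" "t < 1/2"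
        unfolding interior_Omega by (cases x) auto
      define e where "e = min (min s (2*pi - s)) (min (t + 1/2) (1/2 - t))"
      have "e > 0" using x by (auto simp: e_def)
      then obtain n :: nat where "1 / (real n + 1) < e"
        using reals_Archimedean[of e] by (auto simp: inverse_eq_divide add.commute)
      then have "1 / (real n + 1) < s" "1 / (real n + 1) < 2 * pi - s"
        "1 / (real n + 1) < t + 1/2" "1 / (real n + 1) < 1/2 - t"
        unfolding e_def by linarith+
      then have "x \<in> {1/(real n+1)<..<2*pi - 1/(real n+1)} \<times> {-1/2 + 1/(real n+1)<..<1/2 - 1/(real n+1)}"
        unfolding x(1) mem_Times_iff fst_conv snd_conv greaterThanLessThan_iff by linarith
      then show "g x = g' x" using elim by blast
    qed
  qed
  then show ?thesis by (rule AE_interior_Omega)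
qed

lemma has_weak_derivative_restrict:
  assumes w: "has_weak_derivative UNIV v F G" and v: "v \<in> Basis"
    and eq: "AE x in lebesgue. x \<in> Omega \<longrightarrow> f x = F x"
  shows "has_weak_derivative (interior Omega) v f G"
  unfolding has_weak_derivative_def
proof (intro conjI allI impI)
  have liF: "locally_integrable_on F UNIV" and liG: "locally_integrable_on G UNIV"
    using w by (auto simp: has_weak_derivative_def)
  show "locally_integrable_on G (interior Omega)" using liG by (auto simp: locally_integrable_on_def)
  show "locally_integrable_on f (interior Omega)"
    unfolding locally_integrable_on_def set_integrable_def
  proof (intro allI impI)
    fix K assume K: "compact K \<and> K \<subseteq> interior Omega"
    have "integrable lebesgue (\<lambda>x. indicator K x *\<^sub>R F x)"
      using liF K by (auto simp: locally_integrable_on_def set_integrable_def)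
    moreover have "AE x in lebesgue. indicator K x *\<^sub>R F x = indicator K x *\<^sub>R f x"
      using eq by eventually_elim (use K interior_subset in \<open>auto simp: indicator_def\<close>)
    ultimately show "integrable lebesgue (\<lambda>x. indicator K x *\<^sub>R f x)"
      by (rule lebesgue_integrable_cong_AE)
  qed
  fix \<psi> assume t: "test_function (interior Omega) \<psi>"
  then have tU: "test_function UNIV \<psi>" by (auto simp: test_function_def)
  obtain K where K: "compact K" "K \<subseteq> interior Omega" "\<And>x. x \<notin> K \<Longrightarrow> \<psi> x = 0"
    "\<And>x v. x \<notin> K \<Longrightarrow> frechet_derivative \<psi> (at x) v = 0"
    "continuous_on UNIV \<psi>" "\<And>v. v \<in> Basis \<Longrightarrow> continuous_on UNIV (\<lambda>x. frechet_derivative \<psi> (at x) v)"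
    "\<And>x. (\<psi> has_derivative frechet_derivative \<psi> (at x)) (at x)"
    by (rule test_functionE[OF t]) (rule that; simp)
  have "(LINT x:interior Omega|lebesgue. f x * frechet_derivative \<psi> (at x) v) = (\<integral>x. f x * frechet_derivative \<psi> (at x) v \<partial>lebesgue)"
    by (rule set_integral_supported) (metis K(2,3,4) mult_zero_right subsetD)
  also have "\<dots> = (\<integral>x. F x * frechet_derivative \<psi> (at x) v \<partial>lebesgue)"
  proof (rule lebesgue_integrable_cong_AE)
    show "integrable lebesgue (\<lambda>x. F x * frechet_derivative \<psi> (at x) v)"
      by (rule test_function_integrable[OF liF K(1)]) (use K v in auto)
    show "AE x in lebesgue. F x * frechet_derivative \<psi> (at x) v = f x * frechet_derivative \<psi> (at x) v"
      using eq
    proof eventually_elim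
      case (elim x)
      then show ?case using K(2) K(4)[of x] interior_subset[of Omega] by (cases "x \<in> K") auto
    qed
  qed
  also have "\<dots> = - (\<integral>x. G x * \<psi> x \<partial>lebesgue)" by (rule weak_derivative_integrals[OF w tU])
  also have "(\<integral>x. G x * \<psi> x \<partial>lebesgue) = (LINT x:interior Omega|lebesgue. G x * \<psi> x)"
    by (rule set_integral_supported[symmetric]) (use K in auto)
  finally show "(LINT x:interior Omega|lebesgue. f x * frechet_derivative \<psi> (at x) v)
    = - (LINT x:interior Omega|lebesgue. G x * \<psi> x)" .
qed

text \<open>The energy uses weak derivatives selected on the interior of \<open>Omega\<close>. By uniqueness they may be computed
from any function on the plane that agrees with \<open>f\<close> on \<open>Omega\<close>, in particular from the periodic
extension.\<close>

lemma wderiv_eq: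
  assumes "has_weak_derivative UNIV v F G" "v \<in> Basis"
    and "AE x in lebesgue. x \<in> Omega \<longrightarrow> f x = F x"
  shows "AE x in lebesgue. x \<in> Omega \<longrightarrow> wderiv v f x = G x"
proof -
  have w: "has_weak_derivative (interior Omega) v f G"
    by (rule has_weak_derivative_restrict[OF assms])
  then have "has_weak_derivative (interior Omega) v f (wderiv v f)"
    unfolding wderiv_def by (rule someI[of "has_weak_derivative (interior Omega) v f"])
  then show ?thesis using w by (rule weak_derivative_unique)
qed

section \<open>Classical derivatives are weak derivatives\<close>

lemma lborel_integral_translate:
  fixes f :: "'a::euclidean_space \<Rightarrow> real"
  assumes "f \<in> borel_measurable borel"
  shows "(LBINT x. f (w + x)) = (LBINT x. f x)"
    and "integrable lborel (\<lambda>x. f (w + x)) = integrable lborel f"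
proof -
  have m: "(+) w \<in> lborel \<rightarrow>\<^sub>M borel" by simp
  show "(LBINT x. f (w + x)) = (LBINT x. f x)"
    using integral_distr[OF m assms] by (simp add: lborel_distr_plus)
  show "integrable lborel (\<lambda>x. f (w + x)) = integrable lborel f"
    using integrable_distr_eq[OF m assms] by (simp add: lborel_distr_plus)
qed

lemma integrable_continuous_compact_support:
  fixes f :: "'a::euclidean_space \<Rightarrow> real"
  assumes "continuous_on UNIV f" "compact K" "\<And>x. x \<notin> K \<Longrightarrow> f x = 0"
  shows "integrable lborel f"
proof -
  have "integrable lborel (\<lambda>x. indicator K x *\<^sub>R f x)"
    by (rule borel_integrable_compact[OF assms(2)]) (use assms(1) continuous_on_subset in blast)
  moreover have "(\<lambda>x. indicator K x *\<^sub>R f x) = f"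
    using assms(3) by (force simp: indicator_def)
  ultimately show ?thesis by simp
qed

text \<open>The difference quotients of \<open>u\<close> in the direction \<open>v\<close> have integral zero by translation invariance, and
they converge boundedly with uniformly bounded support.\<close>

lemma integral_derivative_zero:
  fixes u :: "'a::euclidean_space \<Rightarrow> real"
  assumes u: "\<And>x. (u has_derivative u' x) (at x)" and c: "continuous_on UNIV (\<lambda>x. u' x v)"
    and K: "compact K" "\<And>x. x \<notin> K \<Longrightarrow> u x = 0" "\<And>x. x \<notin> K \<Longrightarrow> u' x v = 0"
  shows "(LBINT x. u' x v) = 0"
proof -
  have cu: "continuous_on UNIV u"
    using u has_derivative_continuous continuous_at_imp_continuous_on by blast
  have ui: "integrable lborel u" by (rule integrable_continuous_compact_support[OF cu K(1,2)])
  have um: "u \<in> borel_measurable borel" using cu by (rule borel_measurable_continuous_onI)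
  have "bounded ((\<lambda>x. u' x v) ` K)"
    by (intro compact_imp_bounded compact_continuous_image K(1) continuous_on_subset[OF c]) simp
  then obtain B where B: "\<And>x. x \<in> K \<Longrightarrow> \<bar>u' x v\<bar> \<le> B" unfolding bounded_iff by auto
  have B': "\<bar>u' x v\<bar> \<le> \<bar>B\<bar>" for x using B[of x] K(3)[of x] by (cases "x \<in> K") auto
  obtain R where R: "\<And>x. x \<in> K \<Longrightarrow> norm x \<le> R" using compact_imp_bounded[OF K(1)] unfolding bounded_iff by auto
  define t :: "nat \<Rightarrow> real" where "t n = inverse (real (Suc n))" for n
  have t: "0 < t n" "t n \<le> 1" for n by (auto simp: t_def inverse_eq_divide)
  have tl: "t \<longlonglongrightarrow> 0" unfolding t_def by (rule LIMSEQ_inverse_real_of_nat)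
  define D where "D n x = (u (t n *\<^sub>R v + x) - u x) / t n" for n x
  have line: "((\<lambda>s. u (s *\<^sub>R v + x)) has_real_derivative u' (s *\<^sub>R v + x) v) (at s)" for s x
  proof -
    have "((\<lambda>s. s *\<^sub>R v + x) has_derivative (\<lambda>s. s *\<^sub>R v)) (at s)"
      by (auto intro!: derivative_eq_intros)
    from has_derivative_compose[OF this u]
    have "((\<lambda>s. u (s *\<^sub>R v + x)) has_derivative (\<lambda>r. u' (s *\<^sub>R v + x) (r *\<^sub>R v))) (at s)" .
    moreover have "linear (u' (s *\<^sub>R v + x))" using u has_derivative_linear by blast
    ultimately show ?thesis
      by (simp add: has_field_derivative_def linear_scale mult.commute[of _ "u' _ v"])
  qed
  have bound: "\<bar>D n x\<bar> \<le> \<bar>B\<bar>" for n x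
  proof -
    obtain z where "u (t n *\<^sub>R v + x) - u (0 *\<^sub>R v + x) = (t n - 0) * u' (z *\<^sub>R v + x) v"
      using MVT2[OF t(1)[of n], of "\<lambda>s. u (s *\<^sub>R v + x)" "\<lambda>s. u' (s *\<^sub>R v + x) v"] line by blast
    then have "D n x = u' (z *\<^sub>R v + x) v" using t(1)[of n] by (simp add: D_def)
    then show ?thesis using B' by simp
  qed
  have supp: "D n x = 0" if "norm x > R + norm v" for n x
  proof -
    have "norm (t n *\<^sub>R v) \<le> norm v" using t[of n] by (simp add: mult_left_le_one_le)
    then have "norm (t n *\<^sub>R v + x) > R" using that norm_diff_ineq[of x "t n *\<^sub>R v"] by (simp add: add.commute)
    moreover have "norm x > R" using that norm_ge_zero[of v] by linarith
    ultimately have "t n *\<^sub>R v + x \<notin> K" "x \<notin> K" using R by (metis not_le)+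
    then show ?thesis using K(2) by (simp add: D_def)
  qed
  have "(\<lambda>n. \<integral>x. D n x \<partial>lborel) \<longlonglongrightarrow> (LBINT x. u' x v)"
  proof (rule integral_dominated_convergence[where w="\<lambda>x. indicator (cball 0 (R + norm v)) x * \<bar>B\<bar>"])
    show "(\<lambda>x. u' x v) \<in> borel_measurable lborel" using c by (simp add: borel_measurable_continuous_onI)
    show "D n \<in> borel_measurable lborel" for n unfolding D_def using um by measurable
    have "emeasure lborel (cball 0 (R + norm v) :: 'a set) < \<infinity>"
      by (rule emeasure_bounded_finite) simp
    then show "integrable lborel (\<lambda>x::'a. indicator (cball 0 (R + norm v)) x * \<bar>B\<bar>)"
      by (intro integrable_mult_left integrable_real_indicator) auto
    show "AE x in lborel. (\<lambda>n. D n x) \<longlonglongrightarrow> u' x v"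
    proof (rule AE_I2)
      fix x
      have "((\<lambda>s. (u (s *\<^sub>R v + x) - u x) / s) \<longlongrightarrow> u' x v) (at 0)"
        using line[of x 0] by (simp add: DERIV_def)
      moreover have "filterlim t (at 0) sequentially"
        using tl t(1) by (simp add: filterlim_at less_imp_neq[symmetric] eventuallyI)
      ultimately show "(\<lambda>n. D n x) \<longlonglongrightarrow> u' x v"
        unfolding D_def by (rule filterlim_compose)
    qed
    show "AE x in lborel. norm (D n x) \<le> indicator (cball 0 (R + norm v)) x * \<bar>B\<bar>" for n
    proof (rule AE_I2)
      fix x show "norm (D n x) \<le> indicator (cball 0 (R + norm v)) x * \<bar>B\<bar>"
        using bound[of n x] supp[of x n] by (cases "norm x \<le> R + norm v") auto
    qed
  qed
  moreover have "(LBINT x. D n x) = 0" for n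
  proof -
    have "(LBINT x. D n x) = ((LBINT x. u (t n *\<^sub>R v + x)) - (LBINT x. u x)) / t n"
      unfolding D_def using ui lborel_integral_translate(2)[OF um]
      by (simp add: Bochner_Integration.integral_diff)
    then show ?thesis by (simp add: lborel_integral_translate(1)[OF um])
  qed
  ultimately show ?thesis by (simp add: LIMSEQ_const_iff)
qed

lemma locally_integrable_continuous:
  assumes "continuous_on UNIV F" shows "locally_integrable_on F U"
  unfolding locally_integrable_on_def set_integrable_def
proof (intro allI impI)
  fix K :: "(real \<times> real) set" assume K: "compact K \<and> K \<subseteq> U"
  have i: "integrable lborel (\<lambda>x. indicator K x *\<^sub>R F x)"
    by (rule borel_integrable_compact) (use K assms continuous_on_subset in blast)+
  then show "integrable lebesgue (\<lambda>x. indicator K x *\<^sub>R F x)"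
    using integrable_completion[OF borel_measurable_integrable] i by (metis measurable_lborel1)
qed

text \<open>Integrate the derivative of the product of \<open>F\<close> with a test function.\<close>

lemma classical_weak_derivative:
  assumes F: "\<And>x. (F has_derivative F' x) (at x)" and c: "continuous_on UNIV (\<lambda>x. F' x v)"
    and v: "v \<in> Basis"
  shows "has_weak_derivative UNIV v F (\<lambda>x. F' x v)"
  unfolding has_weak_derivative_def
proof (intro conjI allI impI)
  have cF: "continuous_on UNIV F"
    using F has_derivative_continuous continuous_at_imp_continuous_on by blast
  show "locally_integrable_on F UNIV" "locally_integrable_on (\<lambda>x. F' x v) UNIV"
    using cF c by (auto intro: locally_integrable_continuous)
  fix \<psi> assume t: "test_function UNIV \<psi>"
  obtain K where K: "compact K" "K \<subseteq> UNIV" "\<And>x. x \<notin> K \<Longrightarrow> \<psi> x = 0"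
    "\<And>x v. x \<notin> K \<Longrightarrow> frechet_derivative \<psi> (at x) v = 0"
    "continuous_on UNIV \<psi>" "\<And>v. v \<in> Basis \<Longrightarrow> continuous_on UNIV (\<lambda>x. frechet_derivative \<psi> (at x) v)"
    "\<And>x. (\<psi> has_derivative frechet_derivative \<psi> (at x)) (at x)"
    by (rule test_functionE[OF t]) (rule that; simp)
  define d where "d x = frechet_derivative \<psi> (at x) v" for x
  have cd: "continuous_on UNIV d" unfolding d_def by (rule K(6)[OF v])
  have i1: "integrable lborel (\<lambda>x. F x * d x)"
    by (rule integrable_continuous_compact_support[OF _ K(1)])
      (auto intro!: continuous_on_mult cF cd, metis K(4) d_def)
  have i2: "integrable lborel (\<lambda>x. F' x v * \<psi> x)"
    by (rule integrable_continuous_compact_support[OF _ K(1)])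
      (auto intro!: continuous_on_mult c K(5), metis K(3))
  have "(LBINT x. (\<lambda>x h. F x * frechet_derivative \<psi> (at x) h + F' x h * \<psi> x) x v) = 0"
  proof (rule integral_derivative_zero[of "\<lambda>x. F x * \<psi> x"])
    show "((\<lambda>x. F x * \<psi> x) has_derivative (\<lambda>h. F x * frechet_derivative \<psi> (at x) h + F' x h * \<psi> x)) (at x)" for x
      by (rule has_derivative_mult[OF F K(7)])
    show "continuous_on UNIV (\<lambda>x. F x * frechet_derivative \<psi> (at x) v + F' x v * \<psi> x)"
      by (intro continuous_on_add continuous_on_mult cF c K(5) cd[unfolded d_def])
    show "compact K" by fact
    show "F x * \<psi> x = 0" "F x * frechet_derivative \<psi> (at x) v + F' x v * \<psi> x = 0" if "x \<notin> K" for x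
      using K(3,4)[OF that] by simp_all
  qed
  then have "(LBINT x. F x * d x) = - (LBINT x. F' x v * \<psi> x)"
    using i1 i2 by (simp add: d_def)
  moreover have "(\<integral>x. F x * d x \<partial>lebesgue) = (LBINT x. F x * d x)"
    "(\<integral>x. F' x v * \<psi> x \<partial>lebesgue) = (LBINT x. F' x v * \<psi> x)"
    using borel_measurable_integrable[OF i1] borel_measurable_integrable[OF i2]
    by (auto intro!: integral_completion)
  ultimately show "(LINT x:UNIV|lebesgue. F x * frechet_derivative \<psi> (at x) v) =
    - (LINT x:UNIV|lebesgue. F' x v * \<psi> x)"
    by (simp add: set_lebesgue_integral_def d_def)
qed

lemma has_weak_derivative_diff:
  assumes 1: "has_weak_derivative UNIV v F G" and 2: "has_weak_derivative UNIV v F' G'" and v: "v \<in> Basis"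
  shows "has_weak_derivative UNIV v (\<lambda>x. F x - F' x) (\<lambda>x. G x - G' x)"
proof -
  have li: "locally_integrable_on F UNIV" "locally_integrable_on F' UNIV"
     "locally_integrable_on G UNIV" "locally_integrable_on G' UNIV"
    using 1 2 by (auto simp: has_weak_derivative_def)
  have lid: "locally_integrable_on (\<lambda>x. f x - g x) UNIV"
    if "locally_integrable_on f UNIV" "locally_integrable_on g UNIV" for f g
    using that unfolding locally_integrable_on_def by (auto intro!: set_integral_diff)
  show ?thesis
    unfolding has_weak_derivative_def
  proof (intro conjI allI impI lid li)
    fix \<psi> assume t: "test_function UNIV \<psi>"
    obtain K where K: "compact K" "K \<subseteq> UNIV" "\<And>x. x \<notin> K \<Longrightarrow> \<psi> x = 0"
      "\<And>x v. x \<notin> K \<Longrightarrow> frechet_derivative \<psi> (at x) v = 0"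
      "continuous_on UNIV \<psi>" "\<And>v. v \<in> Basis \<Longrightarrow> continuous_on UNIV (\<lambda>x. frechet_derivative \<psi> (at x) v)"
      "\<And>x. (\<psi> has_derivative frechet_derivative \<psi> (at x)) (at x)"
      by (rule test_functionE[OF t]) (rule that; simp)
    note iF = test_function_integrable[OF li(1) K(1,2) K(4) K(6)[OF v]]
      test_function_integrable[OF li(2) K(1,2) K(4) K(6)[OF v]]
    note iG = test_function_integrable[OF li(3) K(1,2) K(3) K(5)]
      test_function_integrable[OF li(4) K(1,2) K(3) K(5)]
    show "(LINT x:UNIV|lebesgue. (F x - F' x) * frechet_derivative \<psi> (at x) v) =
      - (LINT x:UNIV|lebesgue. (G x - G' x) * \<psi> x)"
      using weak_derivative_integrals[OF 1 t] weak_derivative_integrals[OF 2 t] iF iG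
      by (simp add: set_lebesgue_integral_def left_diff_distrib)
  qed
qed

section \<open>Weak derivatives of periodic functions on lines\<close>

lemma lborel_Fubini:
  fixes f :: "real \<times> real \<Rightarrow> real"
  assumes "integrable lborel f"
  shows "integrable lborel (\<lambda>x. \<integral>y. f (x, y) \<partial>lborel)"
    and "(LBINT x. (LBINT y. f (x, y))) = (LBINT p. f p)"
    and "AE x in lborel. integrable lborel (\<lambda>y. f (x, y))"
proof -
  have f: "integrable (lborel \<Otimes>\<^sub>M lborel) f" using assms by (simp add: lborel_prod)
  show "integrable lborel (\<lambda>x. \<integral>y. f (x, y) \<partial>lborel)" by (rule lborel_pair.integrable_fst'[OF f])
  show "(LBINT x. (LBINT y. f (x, y))) = (LBINT p. f p)"
    using lborel_pair.integral_fst'[OF f] by (simp add: lborel_prod)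
  show "AE x in lborel. integrable lborel (\<lambda>y. f (x, y))" by (rule lborel_pair.AE_integrable_fst'[OF f])
qed

lemma integrable_tensor:
  assumes A: "integrable lborel A" and B: "integrable lborel B"
  shows "integrable lborel (tensor A B)"
proof -
  have [measurable]: "A \<in> borel_measurable borel" "B \<in> borel_measurable borel" using A B by auto
  have "integrable (lborel \<Otimes>\<^sub>M lborel) (\<lambda>p. A (fst p) * B (snd p))"
  proof (rule lborel_pair.Fubini_integrable)
    show "integrable lborel (\<lambda>x. \<integral>y. norm (A (fst (x, y)) * B (snd (x, y))) \<partial>lborel)"
      using A B by (simp add: abs_mult)
    show "AE x in lborel. integrable lborel (\<lambda>y. A (fst (x, y)) * B (snd (x, y)))"
      using B by simp
  qed measurable
  then show ?thesis by (simp add: lborel_prod tensor_def[abs_def])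
qed

text \<open>The function \<open>g\<close> is merely integrable, so that its indefinite integral need not be differentiable
everywhere; the formula is Fubini's theorem on the triangle \<open>s \<le> z\<close>.\<close>

lemma integration_by_parts_indefinite:
  fixes g u u' :: "real \<Rightarrow> real"
  assumes g: "integrable lborel (\<lambda>s. indicator {a..b} s * g s)"
    and u: "\<And>x. (u has_real_derivative u' x) (at x)" and cu': "continuous_on UNIV u'"
  shows "(LBINT z. indicator {a..b} z * (LBINT s. indicator {a..z} s * g s) * u' z) =
    (LBINT s. indicator {a..b} s * g s) * u b - (LBINT s. indicator {a..b} s * g s * u s)"
proof -
  define A where "A s = indicator {a..b} s * g s" for s :: real
  define B where "B z = indicator {a..b} z * u' z" for z :: real
  have A: "integrable lborel A" using g by (simp add: A_def[abs_def])
  have B: "integrable lborel B"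
    using borel_integrable_compact[OF compact_Icc continuous_on_subset[OF cu' subset_UNIV], of a b]
    by (simp add: B_def[abs_def])
  have [measurable]: "A \<in> borel_measurable borel" "B \<in> borel_measurable borel" using A B by auto
  define f where "f p = A (fst p) * B (snd p) * indicator {p. fst p \<le> snd p} p" for p :: "real \<times> real"
  have "integrable lborel (\<lambda>p. indicator {p :: real \<times> real. fst p \<le> snd p} p *\<^sub>R tensor A B p)"
  proof (rule integrable_mult_indicator[OF _ integrable_tensor[OF A B]])
    have "closed {p :: real \<times> real. fst p \<le> snd p}" by (intro closed_Collect_le continuous_intros)
    then show "{p :: real \<times> real. fst p \<le> snd p} \<in> sets lborel" by simp
  qed
  then have f: "integrable lborel f"
    unfolding f_def[abs_def] tensor_def by (simp add: mult.commute)
  then have f2: "integrable (lborel \<Otimes>\<^sub>M lborel) (\<lambda>(x, y). f (x, y))" by (simp add: lborel_prod)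
  have "(LBINT z. (LBINT s. f (s, z))) = (LBINT s. (LBINT z. f (s, z)))"
    by (rule lborel_pair.Fubini_integral[OF f2])
  moreover have "(LBINT s. f (s, z)) = indicator {a..b} z * (LBINT s. indicator {a..z} s * g s) * u' z" for z
  proof -
    have "(LBINT s. f (s, z)) = (LBINT s. B z * (indicator {a..z} s * g s))"
      by (rule Bochner_Integration.integral_cong) (auto simp: f_def A_def B_def indicator_def)
    then show ?thesis by (simp add: B_def)
  qed
  moreover have "(LBINT z. f (s, z)) = A s * (u b - u s)" for s
  proof (cases "s \<in> {a..b}")
    case True
    have "(LBINT z. f (s, z)) = (LBINT z. A s * (indicator {s..b} z *\<^sub>R u' z))"
      by (rule Bochner_Integration.integral_cong) (use True in \<open>auto simp: f_def B_def indicator_def\<close>)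
    also have "\<dots> = A s * (LBINT z. indicator {s..b} z *\<^sub>R u' z)" by (rule integral_mult_right_zero)
    also have "(LBINT z. indicator {s..b} z *\<^sub>R u' z) = u b - u s"
      by (rule integral_FTC_Icc)
        (use True u cu' in \<open>auto simp flip: has_real_derivative_iff_has_vector_derivative
          intro: has_field_derivative_at_within continuous_on_subset\<close>)
    finally show ?thesis .
  qed (simp add: f_def A_def)
  moreover have "(LBINT s. A s * (u b - u s)) = (LBINT s. A s) * u b - (LBINT s. A s * u s)"
  proof -
    have "integrable lborel (\<lambda>s. A s * (u b - u s))"
      using lborel_Fubini(1)[OF f] \<open>\<And>s. (LBINT z. f (s, z)) = A s * (u b - u s)\<close> by simp
    from Bochner_Integration.integrable_diff[OF integrable_mult_left[OF A, of "u b"] this]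
    have "integrable lborel (\<lambda>s. A s * u s)" by (simp add: algebra_simps)
    then show ?thesis using A by (simp add: right_diff_distrib)
  qed
  ultimately show ?thesis by (simp add: A_def)
qed

definition loc_int :: "(real \<times> real \<Rightarrow> real) \<Rightarrow> bool" where
  "loc_int F \<longleftrightarrow> F \<in> borel_measurable borel \<and>
     (\<forall>a b c d. integrable lborel (\<lambda>p. indicator ({a..b} \<times> {c..d}) p * F p))"

definition test1 :: "(real \<Rightarrow> real) \<Rightarrow> bool" where
  "test1 \<psi> \<longleftrightarrow> smooth \<psi> \<and> (\<exists>a b. \<forall>x. x \<notin> {a..b} \<longrightarrow> \<psi> x = 0)"

text \<open>Weak derivatives in the second coordinate direction, for Borel representatives and tested with products
only. The first direction is reduced to the second by exchanging the coordinates.\<close>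

definition z_weak :: "(real \<times> real \<Rightarrow> real) \<Rightarrow> (real \<times> real \<Rightarrow> real) \<Rightarrow> bool" where
  "z_weak F G \<longleftrightarrow> loc_int F \<and> loc_int G \<and>
     (\<forall>\<psi> \<eta> \<eta>'. test1 \<psi> \<longrightarrow> test1 \<eta> \<longrightarrow> (\<forall>x. (\<eta> has_real_derivative \<eta>' x) (at x)) \<longrightarrow>
       (LBINT p. F p * tensor \<psi> \<eta>' p) = - (LBINT p. G p * tensor \<psi> \<eta> p))"

text \<open>Periodicity in the second coordinate in the sense of distributions. In this form it passes from a function
to its weak derivatives without any choice of a representative.\<close>

definition z_per :: "real \<Rightarrow> (real \<times> real \<Rightarrow> real) \<Rightarrow> bool" where
  "z_per T F \<longleftrightarrow> (\<forall>\<psi> \<eta>. test1 \<psi> \<longrightarrow> test1 \<eta> \<longrightarrow>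
     (LBINT p. F p * tensor \<psi> (\<lambda>z. \<eta> z - \<eta> (z - T)) p) = 0)"

lemma z_weakD:
  assumes "z_weak F G" "test1 \<psi>" "test1 \<eta>" "\<And>x. (\<eta> has_real_derivative \<eta>' x) (at x)"
  shows "(LBINT p. F p * tensor \<psi> \<eta>' p) = - (LBINT p. G p * tensor \<psi> \<eta> p)"
  using assms unfolding z_weak_def by simp

lemma z_perD:
  assumes "z_per T F" "test1 \<psi>" "test1 \<eta>"
  shows "(LBINT p. F p * tensor \<psi> (\<lambda>z. \<eta> z - \<eta> (z - T)) p) = 0"
  using assms unfolding z_per_def by simp

lemma test1_shift_diff: assumes "test1 \<eta>" shows "test1 (\<lambda>z. \<eta> z - \<eta> (z - T))"
proof -
  obtain a b where ab: "\<And>x. x \<notin> {a..b} \<Longrightarrow> \<eta> x = 0" using assms by (auto simp: test1_def)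
  have s: "smooth \<eta>" using assms by (simp add: test1_def)
  have "smooth (\<lambda>z. \<eta> z - \<eta> (1 * z + (- T)))" by (intro smooth_diff smooth_affine s)
  moreover have "\<eta> x - \<eta> (x - T) = 0" if "x \<notin> {min a (a + T)..max b (b + T)}" for x
  proof -
    have "x \<notin> {a..b}" "x - T \<notin> {a..b}"
      using that by (auto simp: min_le_iff_disj le_max_iff_disj)
    then show ?thesis using ab by simp
  qed
  ultimately show ?thesis unfolding test1_def by auto
qed

lemma test1_deriv:
  assumes "test1 \<eta>" and d: "\<And>x. (\<eta> has_real_derivative \<eta>' x) (at x)" shows "test1 \<eta>'"
proof -
  obtain a b where ab: "\<And>x. x \<notin> {a..b} \<Longrightarrow> \<eta> x = 0" using assms by (auto simp: test1_def)
  have "smooth \<eta>'" using smooth_derivative[OF d] assms by (simp add: test1_def)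
  moreover have "\<eta>' x = 0" if "x \<notin> {a..b}" for x
    by (rule DERIV_locally_constant[OF d, of "- {a..b}"]) (use that ab in auto)
  ultimately show ?thesis unfolding test1_def by blast
qed

lemma has_derivative_shift_diff:
  assumes d: "\<And>x. (\<eta> has_real_derivative \<eta>' x) (at x)"
  shows "((\<lambda>z. \<eta> z - \<eta> (z - T)) has_real_derivative \<eta>' x - \<eta>' (x - T)) (at x)"
proof -
  have "((\<lambda>z. z - T) has_real_derivative 1) (at x)"
    using DERIV_diff[OF DERIV_ident DERIV_const, of T x] by simp
  from DERIV_chain2[OF d this] have "((\<lambda>z. \<eta> (z - T)) has_real_derivative \<eta>' (x - T)) (at x)" by simp
  with d show ?thesis by (rule DERIV_diff)
qed

lemma z_per_weak_derivative:
  assumes w: "z_weak F G" and p: "z_per T F" shows "z_per T G"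
  unfolding z_per_def
proof (intro allI impI)
  fix \<psi> \<eta> assume t: "test1 \<psi>" "test1 \<eta>"
  obtain \<eta>' where d: "\<And>x. (\<eta> has_real_derivative \<eta>' x) (at x)"
    using t(2) smooth_has_derivative[of \<eta>] unfolding test1_def by metis
  have "(LBINT p. F p * tensor \<psi> (\<lambda>z. \<eta>' z - \<eta>' (z - T)) p) =
     - (LBINT p. G p * tensor \<psi> (\<lambda>z. \<eta> z - \<eta> (z - T)) p)"
    by (rule z_weakD[OF w t(1) test1_shift_diff[OF t(2)] has_derivative_shift_diff[OF d]])
  moreover have "(LBINT p. F p * tensor \<psi> (\<lambda>z. \<eta>' z - \<eta>' (z - T)) p) = 0"
    by (rule z_perD[OF p t(1) test1_deriv[OF t(2) d]])
  ultimately show "(LBINT p. G p * tensor \<psi> (\<lambda>z. \<eta> z - \<eta> (z - T)) p) = 0" by simp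
qed

lemma borel_measurable_Pair_right:
  fixes G :: "real \<times> real \<Rightarrow> real"
  assumes "G \<in> borel_measurable borel" shows "(\<lambda>z. G (x, z)) \<in> borel_measurable borel"
proof -
  have "Pair x \<in> borel_measurable borel"
    by (intro borel_measurable_continuous_onI continuous_on_Pair continuous_on_const continuous_on_id)
  from measurable_compose[OF this assms] show ?thesis .
qed

lemma loc_int_bounded:
  assumes F: "loc_int F" and h: "h \<in> borel_measurable borel"
    and B: "\<And>p. \<bar>h p\<bar> \<le> B" and z: "\<And>p. p \<notin> {a..b} \<times> {c..d} \<Longrightarrow> h p = 0"
  shows "integrable lborel (\<lambda>p. F p * h p)"
proof -
  have "integrable lborel (\<lambda>p. indicator ({a..b} \<times> {c..d}) p * F p)"
    using F unfolding loc_int_def by blast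
  then have "integrable lborel (\<lambda>p. (indicator ({a..b} \<times> {c..d}) p * F p) * h p)"
    by (rule integrable_mult_bounded[OF _ _ B]) (use h in simp)
  moreover have "(\<lambda>p. (indicator ({a..b} \<times> {c..d}) p * F p) * h p) = (\<lambda>p. F p * h p)"
  proof
    fix p show "(indicator ({a..b} \<times> {c..d}) p * F p) * h p = F p * h p"
      using z[of p] by (cases "p \<in> {a..b} \<times> {c..d}") auto
  qed
  ultimately show ?thesis by simp
qed

text \<open>The difference \<open>E\<close> of a steep step and its translate by one period tends to the indicator of a period.
Its derivative is a difference of a test function and its translate, to which a periodic function is
blind; hence \<open>G\<close> integrates to zero against \<open>E\<close>, and in the limit over a period.\<close>

lemma z_mean_zero_strip:
  assumes w: "z_weak F G" and per: "z_per T F" and T: "T > 0"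
  shows "(LBINT x. G x * (indicator {p<..<q} (fst x) * indicator {a<..a + T} (snd x))) = 0"
proof -
  define S where "S n = step a (a + inverse (real (Suc n)))" for n
  have lt: "a < a + inverse (real (Suc n))" for n by simp
  define E where "E n z = S n z - S n (z - T)" for n z
  have one: "inverse (real (Suc n)) \<le> 1" for n by (simp add: inverse_eq_divide)
  have Esupp: "E n z = 0" if "z \<notin> {a..a + T + 1}" for n z
  proof (cases "z < a")
    case True
    then show ?thesis using T by (simp add: E_def S_def step_eq_0)
  next
    case False
    then have le: "a + inverse (real (Suc n)) \<le> z - T" using that T one[of n] by auto
    have "S n z = 1" unfolding S_def by (rule step_eq_1[OF lt]) (use le T in linarith)
    moreover have "S n (z - T) = 1" unfolding S_def by (rule step_eq_1[OF lt le])
    ultimately show ?thesis by (simp add: E_def)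
  qed
  have tE: "test1 (E n)" for n
  proof -
    have "smooth (\<lambda>z. S n z - S n (1 * z + (- T)))" unfolding S_def by (intro smooth_diff smooth_affine smooth_step)
    then show ?thesis unfolding test1_def using Esupp[of _ n] by (auto simp: E_def[abs_def])
  qed
  have Eb: "\<bar>E n z\<bar> \<le> 1" for n z
    using step_bounds unfolding E_def S_def by (smt (verit))
  have Elim: "(\<lambda>n. E n z) \<longlonglongrightarrow> indicator {a<..a + T} z" for z
  proof -
    have "(\<lambda>n. E n z) \<longlonglongrightarrow> indicator {a<..} z - indicator {a<..} (z - T)"
      unfolding E_def S_def by (intro tendsto_diff step_tendsto)
    moreover have "indicator {a<..} z - indicator {a<..} (z - T) = (indicator {a<..a + T} z :: real)"
      using T by (auto simp: indicator_def)
    ultimately show ?thesis by simp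
  qed
  have tX: "test1 (cutoff p q n)" for n
    unfolding test1_def using cutoff(1) cutoff(4) by (metis atLeastAtMost_iff greaterThanLessThan_iff less_imp_le)
  have zero: "(LBINT x. G x * tensor (cutoff p q n) (E n) x) = 0" for n
  proof -
    obtain e where e: "\<And>x. (S n has_real_derivative e x) (at x)" "smooth e"
      "\<And>x. x \<notin> {a..a + inverse (real (Suc n))} \<Longrightarrow> e x = 0"
      unfolding S_def using step_derivative[OF lt] by metis
    then have te: "test1 e" unfolding test1_def by blast
    have "(LBINT x. F x * tensor (cutoff p q n) (\<lambda>z. e z - e (z - T)) x) = - (LBINT x. G x * tensor (cutoff p q n) (E n) x)"
      by (rule z_weakD[OF w tX tE]) (use has_derivative_shift_diff[OF e(1), of T] in \<open>simp add: E_def[abs_def]\<close>)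
    moreover have "(LBINT x. F x * tensor (cutoff p q n) (\<lambda>z. e z - e (z - T)) x) = 0"
      by (rule z_perD[OF per tX te])
    ultimately show ?thesis by simp
  qed
  have lG: "loc_int G" using w by (simp add: z_weak_def)
  have [measurable]: "G \<in> borel_measurable borel" using lG by (simp add: loc_int_def)
  have [measurable]: "cutoff p q n \<in> borel_measurable borel" "E n \<in> borel_measurable borel" for n
    using cutoff(1) tE[of n] by (auto intro!: borel_measurable_continuous_onI smooth_continuous simp: test1_def)
  have "(\<lambda>n. \<integral>x. G x * tensor (cutoff p q n) (E n) x \<partial>lborel) \<longlonglongrightarrow>
     (LBINT x. G x * (indicator {p<..<q} (fst x) * indicator {a<..a + T} (snd x)))"
  proof (rule integral_dominated_convergence[where w="\<lambda>x. norm (indicator ({p..q} \<times> {a..a + T + 1}) x * G x)"])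
    show "integrable lborel (\<lambda>x. norm (indicator ({p..q} \<times> {a..a + T + 1}) x * G x))"
      using lG unfolding loc_int_def by (intro integrable_norm) blast
    show "AE x in lborel. (\<lambda>n. G x * tensor (cutoff p q n) (E n) x) \<longlonglongrightarrow>
        G x * (indicator {p<..<q} (fst x) * indicator {a<..a + T} (snd x))"
      unfolding tensor_def by (intro AE_I2 tendsto_mult tendsto_const cutoff(5) Elim)
    show "AE x in lborel. norm (G x * tensor (cutoff p q n) (E n) x) \<le> norm (indicator ({p..q} \<times> {a..a + T + 1}) x * G x)" for n
    proof (rule AE_I2)
      fix x
      show "norm (G x * tensor (cutoff p q n) (E n) x) \<le> norm (indicator ({p..q} \<times> {a..a + T + 1}) x * G x)"
      proof (cases "x \<in> {p..q} \<times> {a..a + T + 1}")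
        case True
        have "\<bar>tensor (cutoff p q n) (E n) x\<bar> \<le> 1"
          using cutoff(2,3) Eb unfolding tensor_def abs_mult by (intro mult_le_one) auto
        then show ?thesis using True mult_left_le[of "\<bar>tensor (cutoff p q n) (E n) x\<bar>" "\<bar>G x\<bar>"]
          by (simp add: abs_mult)
      next
        case False
        then have "cutoff p q n (fst x) = 0 \<or> E n (snd x) = 0"
          using cutoff(4)[of "fst x" p q n] Esupp[of "snd x" n] by (cases x) force
        then show ?thesis by (auto simp: tensor_def)
      qed
    qed
    show "(\<lambda>x. G x * tensor (cutoff p q n) (E n) x) \<in> borel_measurable lborel" for n
      unfolding tensor_def by measurable
  qed measurable
  then show ?thesis by (simp add: zero LIMSEQ_const_iff)
qed

text \<open>The integrals over all strips vanish, hence so does the integral over almost every line.\<close>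

lemma z_mean_zero_line:
  assumes w: "z_weak F G" and per: "z_per T F" and T: "T > 0"
  shows "AE x in lborel. x \<in> {\<alpha><..<\<beta>} \<longrightarrow> (LBINT z. indicator {a..a + T} z * G (x, z)) = 0"
proof -
  have lG: "loc_int G" using w by (simp add: z_weak_def)
  define D where "D x = (LBINT z. G (x, z) * (indicator {\<alpha><..<\<beta>} x * indicator {a<..a + T} z))" for x
  have i: "integrable lborel (\<lambda>x. G x * (indicator {p<..<q} (fst x) * indicator {a<..a + T} (snd x)))" for p q
    by (rule loc_int_bounded[OF lG, of _ 1 p q a "a + T"]) (auto simp: indicator_def)
  have Di: "integrable lborel D"
    using lborel_Fubini(1)[OF i[of \<alpha> \<beta>]] by (simp add: D_def[abs_def])
  have "(LBINT x. indicator (box p q) x * D x) = 0" for p q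
  proof -
    have "indicator (box p q) x * D x = (LBINT z. G (x, z) * (indicator {max p \<alpha><..<min q \<beta>} x * indicator {a<..a + T} z))" for x
      unfolding D_def by (cases "x \<in> {p<..<q}") (auto simp: indicator_def box_real intro!: Bochner_Integration.integral_cong)
    then show ?thesis
      using lborel_Fubini(2)[OF i[of "max p \<alpha>" "min q \<beta>"]] z_mean_zero_strip[OF assms] by simp
  qed
  from AE_zero_if_box_integrals_zero[OF Di this]
  show ?thesis
  proof eventually_elim
    case (elim x)
    show ?case
    proof
      assume x: "x \<in> {\<alpha><..<\<beta>}"
      have "G \<in> borel_measurable borel" using lG by (simp add: loc_int_def)
      note [measurable] = borel_measurable_Pair_right[OF this, of x]
      have "(LBINT z. indicator {a..a + T} z * G (x, z)) = (LBINT z. G (x, z) * (indicator {\<alpha><..<\<beta>} x * indicator {a<..a + T} z))"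
      proof (rule integral_cong_AE)
        have "AE z in lborel. z \<noteq> a" by (rule AE_lborel_singleton)
        then show "AE z in lborel. indicator {a..a + T} z * G (x, z) = G (x, z) * (indicator {\<alpha><..<\<beta>} x * indicator {a<..a + T} z)"
          by eventually_elim (use x in \<open>auto simp: indicator_def\<close>)
      qed measurable
      then show "(LBINT z. indicator {a..a + T} z * G (x, z)) = 0" using elim by (simp add: D_def)
    qed
  qed
qed

lemma AE_lborel_fst:
  assumes "AE x in (lborel :: real measure). Q x"
  shows "AE p in (lborel :: (real \<times> real) measure). Q (fst p)"
proof -
  obtain N where N: "{x. \<not> Q x} \<subseteq> N" "emeasure lborel N = 0" "N \<in> sets lborel"
    using assms by (auto elim!: AE_E)
  have "AE p in (lborel :: real measure) \<Otimes>\<^sub>M (lborel :: real measure). fst p \<notin> N"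
  proof (rule lborel_pair.AE_pair_measure)
    show "{p \<in> space ((lborel :: real measure) \<Otimes>\<^sub>M (lborel :: real measure)). fst p \<notin> N}
        \<in> sets ((lborel :: real measure) \<Otimes>\<^sub>M (lborel :: real measure))"
      using N(3) by measurable
    have "AE x in lborel. x \<notin> N" using N by (intro AE_not_in) auto
    then show "AE x in lborel. AE y in (lborel :: real measure). fst (x, y) \<notin> N"
      by eventually_elim simp
  qed
  then have "AE p in (lborel :: (real \<times> real) measure). fst p \<notin> N" unfolding lborel_prod .
  then show ?thesis by eventually_elim (use N(1) in auto)
qed

lemma borel_measurable_indefinite_integral:
  fixes G :: "real \<times> real \<Rightarrow> real"
  assumes G: "G \<in> borel_measurable borel"
  shows "(\<lambda>p. \<integral>s. indicator {a..snd p} s * G (fst p, s) \<partial>lborel) \<in> borel_measurable borel"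
proof (rule lborel.borel_measurable_lebesgue_integral)
  have c: "closed {q :: (real \<times> real) \<times> real. a \<le> snd q \<and> snd q \<le> snd (fst q)}"
    by (intro closed_Collect_conj closed_Collect_le continuous_intros)
  have 1: "(\<lambda>q :: (real \<times> real) \<times> real. indicator {q. a \<le> snd q \<and> snd q \<le> snd (fst q)} q :: real) \<in> borel_measurable borel"
    using c by (intro borel_measurable_indicator) simp
  have "(\<lambda>q :: (real \<times> real) \<times> real. (fst (fst q), snd q)) \<in> borel_measurable borel"
    by (intro borel_measurable_continuous_onI continuous_intros)
  from measurable_compose[OF this G] have 2: "(\<lambda>q :: (real \<times> real) \<times> real. G (fst (fst q), snd q)) \<in> borel_measurable borel" .
  have "(\<lambda>q :: (real \<times> real) \<times> real. indicator {a..snd (fst q)} (snd q) * G (fst (fst q), snd q)) =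
     (\<lambda>q. indicator {q. a \<le> snd q \<and> snd q \<le> snd (fst q)} q * G (fst (fst q), snd q))"
    by (auto simp: indicator_def)
  with borel_measurable_times[OF 1 2]
  have 3: "(\<lambda>q :: (real \<times> real) \<times> real. indicator {a..snd (fst q)} (snd q) * G (fst (fst q), snd q)) \<in> borel_measurable borel"
    by simp
  have "sets (borel \<Otimes>\<^sub>M lborel) = sets (borel :: ((real \<times> real) \<times> real) measure)"
    using sets_pair_measure_cong[OF refl sets_lborel] borel_prod by metis
  from 3 have "(\<lambda>q :: (real \<times> real) \<times> real. indicator {a..snd (fst q)} (snd q) * G (fst (fst q), snd q)) \<in>
      borel_measurable ((borel :: (real \<times> real) measure) \<Otimes>\<^sub>M (lborel :: real measure))"
    unfolding measurable_cong_sets[OF \<open>sets (borel \<Otimes>\<^sub>M lborel) = sets borel\<close> refl] .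
  then show "(\<lambda>(p, s). indicator {a..snd p} s * G (fst p, s)) \<in> borel_measurable ((borel :: (real \<times> real) measure) \<Otimes>\<^sub>M lborel)"
    by (simp add: case_prod_beta')
qed

lemma continuous_antiderivative:
  fixes f :: "real \<Rightarrow> real" assumes "continuous_on UNIV f"
  obtains F where "\<And>x. (F has_real_derivative f x) (at x)"
proof -
  have "\<exists>F. \<forall>x. -\<infinity> < ereal x \<longrightarrow> ereal x < \<infinity> \<longrightarrow> (F has_vector_derivative f x) (at x)"
    by (intro einterval_antiderivative) (use assms in \<open>auto simp: continuous_on_eq_continuous_at\<close>)
  then show ?thesis using that by (auto simp: has_real_derivative_iff_has_vector_derivative)
qed

lemma integral_FTC_real:
  fixes F f :: "real \<Rightarrow> real"
  assumes "a \<le> b" "\<And>x. (F has_real_derivative f x) (at x)" "continuous_on UNIV f"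
  shows "(LBINT x. indicator {a..b} x * f x) = F b - F a"
  using integral_FTC_Icc[OF assms(1), of F f] assms(2,3)
  by (simp add: continuous_on_subset has_field_derivative_at_within flip: has_real_derivative_iff_has_vector_derivative)

lemma tensor_diff_right: "tensor \<psi> (\<lambda>z. \<eta> z - \<zeta> z) p = tensor \<psi> \<eta> p - tensor \<psi> \<zeta> p"
  and tensor_cmult_right: "tensor \<psi> (\<lambda>z. c * \<eta> z) p = c * tensor \<psi> \<eta> p"
  by (simp_all add: tensor_def algebra_simps)

lemma const_if_derivative_zero:
  fixes f :: "real \<Rightarrow> real"
  assumes d: "\<And>x. (f has_real_derivative f' x) (at x)" and z: "\<And>t. x \<le> t \<Longrightarrow> t \<le> y \<Longrightarrow> f' t = 0" and xy: "x \<le> y"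
  shows "f x = f y"
proof (rule antisym)
  show "f x \<le> f y"
    by (rule DERIV_nonneg_imp_nondecreasing[OF xy]) (metis d z order_refl)
  show "f y \<le> f x"
    by (rule DERIV_nonpos_imp_nonincreasing[OF xy]) (metis d z order_refl)
qed

lemma test1_bounded: assumes "test1 \<psi>" obtains B where "\<And>x. \<bar>\<psi> x\<bar> \<le> B"
proof -
  obtain a b where ab: "\<And>x. x \<notin> {a..b} \<Longrightarrow> \<psi> x = 0" and s: "smooth \<psi>" using assms by (auto simp: test1_def)
  have "bounded (\<psi> ` {a..b})"
    by (intro compact_imp_bounded compact_continuous_image smooth_continuous s compact_Icc)
  then obtain B where "\<forall>y\<in>\<psi> ` {a..b}. norm y \<le> B" using bounded_iff by blast
  then have B: "\<bar>\<psi> x\<bar> \<le> B" if "x \<in> {a..b}" for x using that by simp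
  have "\<bar>\<psi> x\<bar> \<le> \<bar>B\<bar>" for x using B[of x] ab[of x] by (cases "x \<in> {a..b}") auto
  then show ?thesis by (rule that)
qed

lemma test1_measurable: "test1 \<psi> \<Longrightarrow> \<psi> \<in> borel_measurable borel"
  unfolding test1_def using smooth_continuous borel_measurable_continuous_onI by blast

lemma integrable_times_tensor:
  assumes R: "integrable lborel R" and t: "test1 \<psi>" "test1 \<eta>"
  shows "integrable lborel (\<lambda>p. R p * tensor \<psi> \<eta> p)"
proof -
  obtain B where B: "\<And>x. \<bar>\<psi> x\<bar> \<le> B" using test1_bounded[OF t(1)] by blast
  obtain C where C: "\<And>x. \<bar>\<eta> x\<bar> \<le> C" using test1_bounded[OF t(2)] by blast
  have "tensor \<psi> \<eta> \<in> borel_measurable lborel"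
    unfolding tensor_def[abs_def] using t[THEN test1_measurable, measurable] by measurable
  then show ?thesis
  proof (rule integrable_mult_bounded[OF R])
    show "\<bar>tensor \<psi> \<eta> p\<bar> \<le> B * C" for p
      unfolding tensor_def abs_mult using B[of "fst p"] C[of "snd p"] by (intro mult_mono) auto
  qed
qed

text \<open>Let \<open>P\<close> be the indefinite integral of \<open>G\<close> along lines. By integration by parts \<open>F - P\<close> vanishes against
\<open>\<psi> \<otimes> e'\<close> for every test function \<open>e\<close> with support in the interval. An arbitrary test function \<open>\<eta>\<close> differs
from such a derivative only by a multiple of one fixed bump \<open>\<eta>0\<close> of integral one. Therefore \<open>F - P\<close> is
weakly equal to the function \<open>c\<close> of \<open>x\<close> alone that is obtained by integrating it against \<open>\<eta>0\<close>, and the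
fundamental lemma applies.\<close>

lemma line_representation:
  assumes w: "z_weak F G" and ab: "a < b"
  shows "AE x in lborel. x \<in> {\<alpha><..<\<beta>} \<longrightarrow> integrable lborel (\<lambda>s. indicator {a..b} s * G (x, s)) \<and>
    (\<exists>c. AE z in lborel. z \<in> {a<..<b} \<longrightarrow> F (x, z) = c + (LBINT s. indicator {a..z} s * G (x, s)))"
proof -
  have lF: "loc_int F" and lG: "loc_int G" using w by (auto simp: z_weak_def)
  have Fm [measurable]: "F \<in> borel_measurable borel" and Gm [measurable]: "G \<in> borel_measurable borel"
    using lF lG by (auto simp: loc_int_def)
  define Q where "Q = {\<alpha>..\<beta>} \<times> {a..b}"
  have Qm [measurable]: "Q \<in> sets borel" unfolding Q_def by (intro borel_closed closed_Times) auto
  have QF: "integrable lborel (\<lambda>p. indicator Q p * F p)" and QG: "integrable lborel (\<lambda>p. indicator Q p * G p)"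
    using lF lG unfolding loc_int_def Q_def by blast+
  define P where "P p = (LBINT s. indicator {a..snd p} s * G (fst p, s))" for p
  have Pm [measurable]: "P \<in> borel_measurable borel"
    unfolding P_def[abs_def] by (rule borel_measurable_indefinite_integral[OF Gm])
  have Gline: "AE x in lborel. x \<in> {\<alpha>..\<beta>} \<longrightarrow> integrable lborel (\<lambda>s. indicator {a..b} s * G (x, s))"
    using lborel_Fubini(3)[OF QG]
  proof eventually_elim
    case (elim x)
    show ?case
    proof
      assume "x \<in> {\<alpha>..\<beta>}"
      then have "(\<lambda>s. indicator Q (x, s) * G (x, s)) = (\<lambda>s. indicator {a..b} s * G (x, s))"
        by (auto simp: Q_def indicator_def)
      then show "integrable lborel (\<lambda>s. indicator {a..b} s * G (x, s))" using elim by simp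
    qed
  qed
  \<comment> \<open>On almost every line \<open>P\<close> is bounded by the integral of \<open>\<bar>G\<bar>\<close>; on the exceptional lines the
    integral that defines \<open>P\<close> may take its default value.\<close>
  define g1 where "g1 x = (LBINT s. \<bar>indicator Q (x, s) * G (x, s)\<bar>)" for x
  have g1: "integrable lborel g1"
    unfolding g1_def[abs_def] by (rule lborel_Fubini(1)[OF integrable_abs[OF QG]])
  have QP: "integrable lborel (\<lambda>p. indicator Q p * P p)"
  proof (rule Bochner_Integration.integrable_bound)
    show "integrable lborel (tensor g1 (indicator {a..b}))"
      by (intro integrable_tensor g1 integrable_real_indicator) (auto simp: emeasure_lborel_Icc_eq)
    show "(\<lambda>p. indicator Q p * P p) \<in> borel_measurable lborel" by measurable
    show "AE p in lborel. norm (indicator Q p * P p) \<le> norm (tensor g1 (indicator {a..b}) p)"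
      using AE_lborel_fst[OF Gline]
    proof eventually_elim
      case (elim p)
      show ?case
      proof (cases "p \<in> Q")
        case True
        then have p: "fst p \<in> {\<alpha>..\<beta>}" "snd p \<in> {a..b}" unfolding Q_def by (auto simp: mem_Times_iff)
        have i: "integrable lborel (\<lambda>s. indicator {a..b} s * G (fst p, s))" using elim p by blast
        have eq: "indicator Q (fst p, s) * G (fst p, s) = indicator {a..b} s * G (fst p, s)" for s
          using p by (auto simp: Q_def indicator_def)
        have "integrable lborel (\<lambda>s. indicator {a..snd p} s *\<^sub>R (indicator {a..b} s * G (fst p, s)))"
          by (rule integrable_mult_indicator[OF _ i]) simp
        moreover have "(\<lambda>s. indicator {a..snd p} s *\<^sub>R (indicator {a..b} s * G (fst p, s))) = (\<lambda>s. indicator {a..snd p} s * G (fst p, s))"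
          using p by (auto simp: indicator_def)
        ultimately have i2: "integrable lborel (\<lambda>s. indicator {a..snd p} s * G (fst p, s))" by simp
        have "\<bar>P p\<bar> \<le> (LBINT s. \<bar>indicator {a..snd p} s * G (fst p, s)\<bar>)"
          unfolding P_def by (rule integral_abs_bound)
        also have "\<dots> \<le> g1 (fst p)"
          unfolding g1_def eq
          by (rule integral_mono[OF integrable_abs[OF i2] integrable_abs[OF i]]) (use p in \<open>auto simp: indicator_def\<close>)
        finally show ?thesis using True p by (simp add: tensor_def)
      qed simp
    qed
  qed
  define R where "R p = indicator Q p * F p - indicator Q p * P p" for p
  have R: "integrable lborel R" unfolding R_def[abs_def] using QF QP by simp
  define J where "J = step a b"
  have J0: "J x = 0" if "x \<le> a" for x unfolding J_def by (rule step_eq_0[OF ab that])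
  have J1: "J x = 1" if "x \<ge> b" for x unfolding J_def by (rule step_eq_1[OF ab that])
  have sJ: "smooth J" unfolding J_def by (rule smooth_step)
  obtain \<eta>0 where \<eta>0: "\<And>x. (J has_real_derivative \<eta>0 x) (at x)" "smooth \<eta>0"
    and \<eta>0z: "\<And>x. x \<notin> {a..b} \<Longrightarrow> \<eta>0 x = 0"
    unfolding J_def using step_derivative[OF ab] by metis
  have t\<eta>0: "test1 \<eta>0" unfolding test1_def using \<eta>0(2) \<eta>0z by blast
  define c where "c x = (LBINT z. R (x, z) * \<eta>0 z)" for x
  obtain B where B: "\<And>x. \<bar>\<eta>0 x\<bar> \<le> B" using test1_bounded[OF t\<eta>0] by blast
  have R\<eta>0: "integrable lborel (\<lambda>p. R p * \<eta>0 (snd p))"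
    by (rule integrable_mult_bounded[OF R _ B]) (use test1_measurable[OF t\<eta>0, measurable] in measurable)
  have ci: "integrable lborel c" using lborel_Fubini(1)[OF R\<eta>0] by (simp add: c_def[abs_def])
  define D where "D p = R p - tensor c (indicator {a..b}) p" for p
  have ti: "integrable lborel (tensor c (indicator {a..b}))"
    by (intro integrable_tensor ci integrable_real_indicator) (auto simp: emeasure_lborel_Icc_eq)
  have Di: "integrable lborel D" unfolding D_def[abs_def] using R ti by simp
  have "AE p in lborel. p \<in> {\<alpha><..<\<beta>} \<times> {a<..<b} \<longrightarrow> D p = 0"
  proof (rule tensor_fundamental_lemma[OF Di])
    fix \<psi> \<eta> assume t: "smooth \<psi>" "smooth \<eta>" "\<And>x. x \<notin> {\<alpha><..<\<beta>} \<Longrightarrow> \<psi> x = 0" "\<And>x. x \<notin> {a<..<b} \<Longrightarrow> \<eta> x = 0"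
    have t\<psi>: "test1 \<psi>" unfolding test1_def using t(1) t(3)
      by (metis atLeastAtMost_iff greaterThanLessThan_iff less_imp_le)
    have t\<eta>: "test1 \<eta>" unfolding test1_def using t(2) t(4)
      by (metis atLeastAtMost_iff greaterThanLessThan_iff less_imp_le)
    obtain E where E: "\<And>x. (E has_real_derivative \<eta> x) (at x)"
      using continuous_antiderivative[OF smooth_continuous[OF t(2)]] by blast
    define I where "I = E b - E a"
    define e where "e z = E z - E a - I * J z" for z
    define e' where "e' z = \<eta> z - I * \<eta>0 z" for z
    have e: "(e has_real_derivative e' z) (at z)" for z
      using DERIV_diff[OF DERIV_diff[OF E DERIV_const[of "E a"]] DERIV_cmult[OF \<eta>0(1), of I], of z]
      by (simp add: e_def[abs_def] e'_def)
    have ez: "e z = 0" if "z \<le> a \<or> b \<le> z" for z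
      using that
    proof
      assume z: "z \<le> a"
      have "E z = E a" by (rule const_if_derivative_zero[OF E _ z]) (use t(4) in auto)
      then show ?thesis using J0[OF z] by (simp add: e_def)
    next
      assume z: "b \<le> z"
      have "E b = E z" by (rule const_if_derivative_zero[OF E _ z]) (use t(4) in auto)
      then show ?thesis using J1[OF z] by (simp add: e_def I_def)
    qed
    have se: "smooth e" unfolding e_def
      by (intro smooth_diff smooth_cmult smooth_const sJ smooth_antiderivative[OF E t(2)])
    have te: "test1 e" unfolding test1_def using se ez by (metis atLeastAtMost_iff linear)
    have te': "test1 e'" by (rule test1_deriv[OF te e])
    have e'z: "e' z = 0" if "z \<notin> {a..b}" for z
      using that t(4)[of z] \<eta>0z[of z] by (auto simp: e'_def)
    have \<eta>I: "(LBINT z. indicator {a..b} z * \<eta> z) = I"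
      unfolding I_def by (rule integral_FTC_real[OF _ E smooth_continuous[OF t(2)]]) (use ab in simp)
    note iR = integrable_times_tensor[OF R t\<psi> t\<eta>] integrable_times_tensor[OF R t\<psi> t\<eta>0]
    have ic: "integrable lborel (\<lambda>p. tensor c (indicator {a..b}) p * tensor \<psi> \<eta> p)"
      by (rule integrable_times_tensor[OF ti t\<psi> t\<eta>])
    have 1: "(LBINT p. tensor c (indicator {a..b}) p * tensor \<psi> \<eta> p) = I * (LBINT p. R p * tensor \<psi> \<eta>0 p)"
    proof -
      have "(LBINT p. tensor c (indicator {a..b}) p * tensor \<psi> \<eta> p) =
        (LBINT x. (LBINT z. tensor c (indicator {a..b}) (x, z) * tensor \<psi> \<eta> (x, z)))"
        by (rule lborel_Fubini(2)[OF ic, symmetric])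
      also have "\<dots> = (LBINT x. I * (c x * \<psi> x))"
      proof (rule Bochner_Integration.integral_cong[OF refl])
        fix x
        have "(LBINT z. tensor c (indicator {a..b}) (x, z) * tensor \<psi> \<eta> (x, z)) =
          (LBINT z. (c x * \<psi> x) * (indicator {a..b} z * \<eta> z))"
          by (simp add: tensor_def algebra_simps)
        then show "(LBINT z. tensor c (indicator {a..b}) (x, z) * tensor \<psi> \<eta> (x, z)) = I * (c x * \<psi> x)"
          using \<eta>I by simp
      qed
      also have "\<dots> = I * (LBINT x. c x * \<psi> x)" by simp
      also have "(LBINT x. c x * \<psi> x) = (LBINT x. (LBINT z. R (x, z) * tensor \<psi> \<eta>0 (x, z)))"
      proof (rule Bochner_Integration.integral_cong[OF refl])
        fix x
        have "(LBINT z. R (x, z) * tensor \<psi> \<eta>0 (x, z)) = (LBINT z. \<psi> x * (R (x, z) * \<eta>0 z))"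
          by (simp add: tensor_def algebra_simps)
        then show "c x * \<psi> x = (LBINT z. R (x, z) * tensor \<psi> \<eta>0 (x, z))" by (simp add: c_def)
      qed
      also have "\<dots> = (LBINT p. R p * tensor \<psi> \<eta>0 p)" by (rule lborel_Fubini(2)[OF iR(2)])
      finally show ?thesis .
    qed
    have iQF: "integrable lborel (\<lambda>p. indicator Q p * F p * tensor \<psi> e' p)"
      and iQP: "integrable lborel (\<lambda>p. indicator Q p * P p * tensor \<psi> e' p)"
      and iQG: "integrable lborel (\<lambda>p. indicator Q p * G p * tensor \<psi> e p)"
      using integrable_times_tensor[OF QF t\<psi> te'] integrable_times_tensor[OF QP t\<psi> te']
        integrable_times_tensor[OF QG t\<psi> te] by auto
    have Qz: "tensor \<psi> \<zeta> p = indicator Q p * tensor \<psi> \<zeta> p" if "\<And>z. z \<notin> {a..b} \<Longrightarrow> \<zeta> z = 0" for \<zeta> p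
    proof (cases "p \<in> Q")
      case False
      then have "\<psi> (fst p) = 0 \<or> \<zeta> (snd p) = 0"
        using t(3)[of "fst p"] that[of "snd p"] unfolding Q_def mem_Times_iff by force
      then show ?thesis by (auto simp: tensor_def)
    qed simp
    have ez': "e z = 0" if "z \<notin> {a..b}" for z using that by (intro ez) auto
    have 2: "(LBINT p. indicator Q p * F p * tensor \<psi> e' p) = - (LBINT p. indicator Q p * G p * tensor \<psi> e p)"
    proof -
      have "(LBINT p. F p * tensor \<psi> e' p) = - (LBINT p. G p * tensor \<psi> e p)"
        by (rule z_weakD[OF w t\<psi> te e])
      moreover have "(\<lambda>p. F p * tensor \<psi> e' p) = (\<lambda>p. indicator Q p * F p * tensor \<psi> e' p)"
        "(\<lambda>p. G p * tensor \<psi> e p) = (\<lambda>p. indicator Q p * G p * tensor \<psi> e p)"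
        using Qz[OF e'z] Qz[OF ez'] by (auto simp: fun_eq_iff mult_ac)
      ultimately show ?thesis by simp
    qed
    have 3: "(LBINT p. indicator Q p * P p * tensor \<psi> e' p) = - (LBINT p. indicator Q p * G p * tensor \<psi> e p)"
    proof -
      have "(LBINT p. indicator Q p * P p * tensor \<psi> e' p) =
         (LBINT x. (LBINT z. indicator Q (x, z) * P (x, z) * tensor \<psi> e' (x, z)))"
        by (rule lborel_Fubini(2)[OF iQP, symmetric])
      also have "\<dots> = (LBINT x. - (LBINT z. indicator Q (x, z) * G (x, z) * tensor \<psi> e (x, z)))"
      proof (rule integral_cong_AE)
        show "(\<lambda>x. \<integral>z. indicator Q (x, z) * P (x, z) * tensor \<psi> e' (x, z) \<partial>lborel) \<in> borel_measurable lborel"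
          using lborel_Fubini(1)[OF iQP] by (rule borel_measurable_integrable)
        show "(\<lambda>x. - (LBINT z. indicator Q (x, z) * G (x, z) * tensor \<psi> e (x, z))) \<in> borel_measurable lborel"
          using borel_measurable_integrable[OF lborel_Fubini(1)[OF iQG]] by (rule borel_measurable_uminus)
        show "AE x in lborel. (LBINT z. indicator Q (x, z) * P (x, z) * tensor \<psi> e' (x, z)) =
           - (LBINT z. indicator Q (x, z) * G (x, z) * tensor \<psi> e (x, z))"
          using Gline
        proof eventually_elim
          case (elim x)
          show ?case
          proof (cases "x \<in> {\<alpha>..\<beta>}")
            case True
            have "(LBINT z. indicator {a..b} z * (LBINT s. indicator {a..z} s * G (x, s)) * e' z) =
              (LBINT s. indicator {a..b} s * G (x, s)) * e b - (LBINT s. indicator {a..b} s * G (x, s) * e s)"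
              by (rule integration_by_parts_indefinite[OF _ e smooth_continuous])
                (use elim True te' in \<open>auto simp: test1_def\<close>)
            then have ibp: "(LBINT z. indicator {a..b} z * P (x, z) * e' z) = - (LBINT s. indicator {a..b} s * G (x, s) * e s)"
              by (simp add: P_def ez)
            have "(LBINT z. indicator Q (x, z) * P (x, z) * tensor \<psi> e' (x, z)) =
              (LBINT z. \<psi> x * (indicator {a..b} z * P (x, z) * e' z))"
              by (rule Bochner_Integration.integral_cong) (use True in \<open>auto simp: Q_def tensor_def indicator_def\<close>)
            moreover have "(LBINT z. indicator Q (x, z) * G (x, z) * tensor \<psi> e (x, z)) =
              (LBINT z. \<psi> x * (indicator {a..b} z * G (x, z) * e z))"
              by (rule Bochner_Integration.integral_cong) (use True in \<open>auto simp: Q_def tensor_def indicator_def\<close>)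
            ultimately show ?thesis using ibp by simp
          next
            case False
            then have "indicator Q (x, z) = (0::real)" for z by (auto simp: Q_def)
            then show ?thesis by simp
          qed
        qed
      qed
      also have "\<dots> = - (LBINT p. indicator Q p * G p * tensor \<psi> e p)"
        using lborel_Fubini(2)[OF iQG] by simp
      finally show ?thesis .
    qed
    have "(LBINT p. D p * (\<psi> (fst p) * \<eta> (snd p))) = (LBINT p. R p * tensor \<psi> \<eta> p - tensor c (indicator {a..b}) p * tensor \<psi> \<eta> p)"
      by (simp add: D_def tensor_def left_diff_distrib)
    also have "\<dots> = (LBINT p. R p * tensor \<psi> \<eta> p) - I * (LBINT p. R p * tensor \<psi> \<eta>0 p)"
      using iR ic 1 by simp
    also have "\<dots> = (LBINT p. R p * tensor \<psi> \<eta> p - I * (R p * tensor \<psi> \<eta>0 p))"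
      using iR by simp
    also have "\<dots> = (LBINT p. indicator Q p * F p * tensor \<psi> e' p - indicator Q p * P p * tensor \<psi> e' p)"
      by (simp add: R_def e'_def[abs_def] tensor_diff_right tensor_cmult_right algebra_simps)
    also have "\<dots> = 0" using iQF iQP 2 3 by simp
    finally show "(LBINT p. D p * (\<psi> (fst p) * \<eta> (snd p))) = 0" .
  qed
  then have "AE p in lborel \<Otimes>\<^sub>M lborel. p \<in> {\<alpha><..<\<beta>} \<times> {a<..<b} \<longrightarrow> D p = 0" unfolding lborel_prod .
  then have "AE x in lborel. AE z in lborel. (x, z) \<in> {\<alpha><..<\<beta>} \<times> {a<..<b} \<longrightarrow> D (x, z) = 0"
    by (rule lborel_pair.AE_pair)
  with Gline show ?thesis
  proof eventually_elim
    case (elim x)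
    show ?case
    proof (intro impI conjI exI)
      assume x: "x \<in> {\<alpha><..<\<beta>}"
      show "integrable lborel (\<lambda>s. indicator {a..b} s * G (x, s))" using elim(1) x by auto
      show "AE z in lborel. z \<in> {a<..<b} \<longrightarrow> F (x, z) = c x + (LBINT s. indicator {a..z} s * G (x, s))"
        using elim(2)
      proof eventually_elim
        case (elim z)
        show ?case
        proof
          assume z: "z \<in> {a<..<b}"
          then have "D (x, z) = 0" using elim x by auto
          moreover have "(x, z) \<in> Q" using x z by (auto simp: Q_def)
          ultimately show "F (x, z) = c x + (LBINT s. indicator {a..z} s * G (x, s))"
            using z by (simp add: D_def R_def P_def tensor_def)
        qed
      qed
    qed
  qed
qed

section \<open>An interpolation inequality on a line\<close>

lemma Cauchy_Schwarz_integral: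
  fixes f g :: "'a \<Rightarrow> real"
  assumes m: "f \<in> borel_measurable M" "g \<in> borel_measurable M"
    and f: "integrable M (\<lambda>x. (f x)\<^sup>2)" and g: "integrable M (\<lambda>x. (g x)\<^sup>2)"
  shows "integrable M (\<lambda>x. f x * g x)"
    and "(\<integral>x. f x * g x \<partial>M)\<^sup>2 \<le> (\<integral>x. (f x)\<^sup>2 \<partial>M) * (\<integral>x. (g x)\<^sup>2 \<partial>M)"
proof -
  show fg: "integrable M (\<lambda>x. f x * g x)"
  proof (rule Bochner_Integration.integrable_bound)
    show "integrable M (\<lambda>x. (f x)\<^sup>2 + (g x)\<^sup>2)" using f g by simp
    show "(\<lambda>x. f x * g x) \<in> borel_measurable M" using m by (rule borel_measurable_times)
    show "AE x in M. norm (f x * g x) \<le> norm ((f x)\<^sup>2 + (g x)\<^sup>2)"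
    proof (rule AE_I2)
      fix x
      have "0 \<le> (\<bar>f x\<bar> - \<bar>g x\<bar>)\<^sup>2" by simp
      then have "2 * (\<bar>f x\<bar> * \<bar>g x\<bar>) \<le> (f x)\<^sup>2 + (g x)\<^sup>2" by (simp add: power2_diff)
      moreover have "0 \<le> \<bar>f x\<bar> * \<bar>g x\<bar>" by simp
      ultimately have "\<bar>f x\<bar> * \<bar>g x\<bar> \<le> (f x)\<^sup>2 + (g x)\<^sup>2" by linarith
      then show "norm (f x * g x) \<le> norm ((f x)\<^sup>2 + (g x)\<^sup>2)" by (simp add: abs_mult)
    qed
  qed
  define A where "A = (\<integral>x. (f x)\<^sup>2 \<partial>M)" define B where "B = (\<integral>x. f x * g x \<partial>M)"
  define C where "C = (\<integral>x. (g x)\<^sup>2 \<partial>M)"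
  have q: "0 \<le> t\<^sup>2 * A + 2 * t * B + C" for t
  proof -
    have "0 \<le> (\<integral>x. (t * f x + g x)\<^sup>2 \<partial>M)" by simp
    also have "\<dots> = (\<integral>x. t\<^sup>2 * (f x)\<^sup>2 + (2 * t) * (f x * g x) + (g x)\<^sup>2 \<partial>M)"
      by (simp add: power2_sum power_mult_distrib algebra_simps)
    also have "\<dots> = t\<^sup>2 * A + 2 * t * B + C"
      using f g fg by (simp add: A_def B_def C_def)
    finally show ?thesis .
  qed
  have A0: "A \<ge> 0" by (simp add: A_def)
  have "B\<^sup>2 \<le> A * C"
  proof (cases "A = 0")
    case True
    have "B = 0"
    proof (rule ccontr)
      assume "B \<noteq> 0"
      then have "2 * (- (C + 1) / (2 * B)) * B = - (C + 1)" by simp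
      then show False using q[of "- (C + 1) / (2 * B)"] True by simp
    qed
    then show ?thesis using True by simp
  next
    case False
    then have "(- B / A)\<^sup>2 * A + 2 * (- B / A) * B + C = C - B\<^sup>2 / A"
      by (simp add: field_simps power2_eq_square)
    then have "B\<^sup>2 / A \<le> C" using q[of "- B / A"] by simp
    then show ?thesis using False A0 by (simp add: divide_le_eq mult.commute)
  qed
  then show "(\<integral>x. f x * g x \<partial>M)\<^sup>2 \<le> (\<integral>x. (f x)\<^sup>2 \<partial>M) * (\<integral>x. (g x)\<^sup>2 \<partial>M)"
    by (simp add: A_def B_def C_def)
qed

lemma integrable_Icc_continuous:
  fixes f :: "real \<Rightarrow> real"
  assumes "continuous_on UNIV f" shows "integrable lborel (\<lambda>x. indicator {a..b} x * f x)"
  using borel_integrable_compact[OF compact_Icc continuous_on_subset[OF assms subset_UNIV], of a b] by simp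

text \<open>Let \<open>w = u - min u\<close>. Since \<open>K\<close> is the derivative of \<open>g = u'\<close>, periodicity and integration by parts give
\<open>\<integral> g\<^sup>2 = - \<integral> K w\<close>. Starting at a minimum point, \<open>w\<^sup>2\<close> grows at the rate \<open>2 w g\<close>, so \<open>w\<^sup>2\<close> is at most
\<open>2 L \<integral> w\<close>, which bounds \<open>\<integral> w\<^sup>2\<close> by a power of \<open>\<integral> w \<le> \<integral> u\<close>. The Cauchy-Schwarz inequality combines
the two.\<close>

lemma interpolation_1d:
  fixes u g K :: "real \<Rightarrow> real"
  assumes ab: "a < b" and u: "\<And>x. (u has_real_derivative g x) (at x)" and cg: "continuous_on UNIV g"
    and gK: "\<And>z. z \<in> {a..b} \<Longrightarrow> g z = d + (LBINT s. indicator {a..z} s * K s)"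
    and per: "g b = g a" "u b = u a"
    and pos: "\<And>z. z \<in> {a..b} \<Longrightarrow> 0 \<le> u z" and L: "\<And>z. z \<in> {a..b} \<Longrightarrow> \<bar>g z\<bar> \<le> L"
    and K: "integrable lborel (\<lambda>s. indicator {a..b} s * K s)"
    and K2: "integrable lborel (\<lambda>s. indicator {a..b} s * (K s)\<^sup>2)"
  shows "(LBINT s. indicator {a..b} s * (g s)\<^sup>2) ^ 4 \<le>
    2 * L * (LBINT s. indicator {a..b} s * u s) ^ 3 * (LBINT s. indicator {a..b} s * (K s)\<^sup>2) ^ 2"
proof -
  have cu: "continuous_on UNIV u" using u DERIV_isCont continuous_at_imp_continuous_on by blast
  note int = integrable_Icc_continuous
  obtain y0 where y0: "y0 \<in> {a..b}" "\<And>y. y \<in> {a..b} \<Longrightarrow> u y0 \<le> u y"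
    using continuous_attains_inf[OF compact_Icc _ continuous_on_subset[OF cu subset_UNIV], of a b] ab by auto
  define w where "w x = u x - u y0" for x
  have w0: "0 \<le> w z" if "z \<in> {a..b}" for z using y0(2)[OF that] by (simp add: w_def)
  have wd: "(w has_real_derivative g x) (at x)" for x
    unfolding w_def using DERIV_diff[OF u DERIV_const] by simp
  have cw: "continuous_on UNIV w" unfolding w_def by (intro continuous_on_diff cu continuous_on_const)
  have L0: "0 \<le> L" using L[of a] ab by (simp add: order_trans[OF abs_ge_zero])
  define P where "P = (LBINT s. indicator {a..b} s * (g s)\<^sup>2)"
  define S where "S = (LBINT s. indicator {a..b} s * w s)"
  define k where "k = (LBINT s. indicator {a..b} s * (K s)\<^sup>2)"
  define U where "U = (LBINT s. indicator {a..b} s * u s)"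
  have S0: "0 \<le> S" unfolding S_def by (rule integral_nonneg_AE) (auto simp: w0 indicator_def)
  have SU: "S \<le> U" unfolding S_def U_def
    by (rule integral_mono[OF int[OF cw] int[OF cu]]) (use pos[OF y0(1)] in \<open>auto simp: w_def indicator_def\<close>)
  have K0: "(LBINT s. indicator {a..b} s * K s) = 0"
    using gK[of a] gK[of b] per(1) ab integral_indicator_singleton[of a K] by simp
  have "(LBINT z. indicator {a..b} z * (LBINT s. indicator {a..z} s * K s) * g z) =
    (LBINT s. indicator {a..b} s * K s) * w b - (LBINT s. indicator {a..b} s * K s * w s)"
    by (rule integration_by_parts_indefinite[OF K wd cg])
  moreover have "(LBINT z. indicator {a..b} z * (LBINT s. indicator {a..z} s * K s) * g z) =
     (LBINT z. indicator {a..b} z * (g z)\<^sup>2 - d * (indicator {a..b} z * g z))"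
    by (rule Bochner_Integration.integral_cong)
      (auto simp: indicator_def gK power2_eq_square algebra_simps)
  moreover have "\<dots> = P - d * (u b - u a)"
    using int[OF cg] int[OF continuous_on_power[OF cg, of 2]] integral_FTC_real[OF less_imp_le[OF ab] u cg]
    by (simp add: P_def)
  ultimately have P: "P = - (LBINT s. (indicator {a..b} s * K s) * (indicator {a..b} s * w s))"
    using K0 per(2) by (simp add: indicator_inter_arith[symmetric] mult_ac)
  have osc: "(w y)\<^sup>2 \<le> 2 * L * S" if y: "y \<in> {a..b}" for y
  proof -
    have F: "((\<lambda>x. (w x)\<^sup>2) has_real_derivative 2 * w x * g x) (at x)" for x
      using DERIV_power[OF wd[of x], of 2] by (simp add: mult_ac)
    have cF: "continuous_on UNIV (\<lambda>x. 2 * w x * g x)"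
      by (intro continuous_on_mult cw cg continuous_on_const)
    have LS: "2 * L * S = (LBINT s. indicator {a..b} s * (2 * L * w s))"
      unfolding S_def by (simp add: mult_ac flip: integral_mult_right_zero)
    have iL: "integrable lborel (\<lambda>s. indicator {a..b} s * (2 * L * w s))"
      by (rule int) (intro continuous_on_mult cw continuous_on_const)
    have gw: "\<bar>2 * w s * g s\<bar> \<le> 2 * L * w s" if "s \<in> {a..b}" for s
      using mult_left_mono[OF L[OF that] w0[OF that]] w0[OF that] by (simp add: abs_mult mult_ac)
    have z: "w y0 = 0" by (simp add: w_def)
    show ?thesis
    proof (cases "y0 \<le> y")
      case True
      have "(w y)\<^sup>2 = (LBINT s. indicator {y0..y} s * (2 * w s * g s))"
        using integral_FTC_real[OF True F cF] z by simp
      also have "\<dots> \<le> (LBINT s. indicator {a..b} s * (2 * L * w s))"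
      proof (rule integral_mono[OF int[OF cF] iL])
        fix s show "indicator {y0..y} s * (2 * w s * g s) \<le> indicator {a..b} s * (2 * L * w s)"
        proof (cases "s \<in> {a..b}")
          case True
          have "2 * w s * g s \<le> 2 * L * w s" "0 \<le> 2 * L * w s" using gw[OF True] by linarith+
          then show ?thesis using True by (cases "s \<in> {y0..y}") simp_all
        next
          case False
          then have "s \<notin> {y0..y}" using y y0(1) by auto
          then show ?thesis using False by simp
        qed
      qed
      finally show ?thesis using LS by simp
    next
      case False
      then have "y \<le> y0" by simp
      have "(w y)\<^sup>2 = (LBINT s. indicator {y..y0} s * (- (2 * w s * g s)))"
        using integral_FTC_real[OF \<open>y \<le> y0\<close> F cF] z by simp
      also have "\<dots> \<le> (LBINT s. indicator {a..b} s * (2 * L * w s))"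
      proof (rule integral_mono[OF int[OF continuous_on_minus[OF cF]] iL])
        fix s show "indicator {y..y0} s * (- (2 * w s * g s)) \<le> indicator {a..b} s * (2 * L * w s)"
        proof (cases "s \<in> {a..b}")
          case True
          have "- (2 * w s * g s) \<le> 2 * L * w s" "0 \<le> 2 * L * w s" using gw[OF True] by linarith+
          then show ?thesis using True by (cases "s \<in> {y..y0}") simp_all
        next
          case False
          then have "s \<notin> {y..y0}" using y y0(1) by auto
          then show ?thesis using False by simp
        qed
      qed
      finally show ?thesis using LS by simp
    qed
  qed
  have ind2: "(indicator {a..b} s * x)\<^sup>2 = indicator {a..b} s * x\<^sup>2" for s x :: real
    by (simp add: indicator_def)
  define M where "M = sqrt (2 * L * S)"
  have M2: "M\<^sup>2 = 2 * L * S" using L0 S0 by (simp add: M_def)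
  have wM: "w y \<le> M" if "y \<in> {a..b}" for y
    unfolding M_def by (rule real_le_rsqrt[OF osc[OF that]])
  define q where "q = (LBINT s. (indicator {a..b} s * w s)\<^sup>2)"
  have iw2: "integrable lborel (\<lambda>s. (indicator {a..b} s * w s)\<^sup>2)"
    using int[OF continuous_on_power[OF cw, of 2], of a b] by (simp add: ind2)
  have qM: "q \<le> M * S"
  proof -
    have "q \<le> (LBINT s. M * (indicator {a..b} s * w s))"
      unfolding q_def
    proof (rule integral_mono[OF iw2])
      show "integrable lborel (\<lambda>s. M * (indicator {a..b} s * w s))" using int[OF cw] by simp
      fix s show "(indicator {a..b} s * w s)\<^sup>2 \<le> M * (indicator {a..b} s * w s)"
        using wM[of s] w0[of s] by (cases "s \<in> {a..b}") (auto simp: power2_eq_square mult_right_mono)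
    qed
    then show ?thesis by (simp add: S_def)
  qed
  have q0: "0 \<le> q" by (simp add: q_def)
  have k0: "0 \<le> k" unfolding k_def by (rule integral_nonneg_AE) simp
  have iK2: "integrable lborel (\<lambda>s. (indicator {a..b} s * K s)\<^sup>2)"
    and kk: "(LBINT s. (indicator {a..b} s * K s)\<^sup>2) = k"
    using K2 by (simp_all add: k_def ind2)
  have "P\<^sup>2 \<le> k * q"
    using Cauchy_Schwarz_integral(2)[OF borel_measurable_integrable[OF K] borel_measurable_integrable[OF int[OF cw]] iK2 iw2]
    unfolding P kk q_def by simp
  then have "(P\<^sup>2)\<^sup>2 \<le> (k * q)\<^sup>2" by (rule power_mono) simp
  also have "\<dots> \<le> (k * (M * S))\<^sup>2"
    using qM q0 k0 by (intro power_mono mult_left_mono) auto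
  also have "\<dots> = M\<^sup>2 * S\<^sup>2 * k\<^sup>2" by (simp add: power_mult_distrib)
  also have "\<dots> = 2 * L * S ^ 3 * k\<^sup>2"
    unfolding M2 by (simp add: power2_eq_square power3_eq_cube)
  also have "\<dots> \<le> 2 * L * U ^ 3 * k\<^sup>2"
    using SU S0 L0 by (intro mult_right_mono mult_left_mono power_mono) auto
  finally show ?thesis by (simp add: P_def U_def k_def flip: power_mult)
qed

section \<open>The single-fold competitor\<close>

lemma positive_part_power_derivative:
  "((\<lambda>x. (max 0 x) ^ (n + 2)) has_real_derivative real (n + 2) * (max 0 x) ^ (n + 1)) (at (x::real))"
proof -
  consider "x > 0" | "x < 0" | "x = 0" by linarith
  then show ?thesis
  proof cases
    case 1
    have "((\<lambda>x. x ^ (n + 2)) has_real_derivative real (n + 2) * (max 0 x) ^ (n + 1)) (at x)"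
      using DERIV_pow[of "n + 2" x UNIV] 1 by simp
    then show ?thesis
      by (rule has_field_derivative_transform_within_open[of _ _ _ "{0<..}"]) (use 1 in auto)
  next
    case 2
    have "((\<lambda>x. 0) has_real_derivative real (n + 2) * (max 0 x) ^ (n + 1)) (at x)"
      using 2 by simp
    then show ?thesis
      by (rule has_field_derivative_transform_within_open[of _ _ _ "{..<0}"]) (use 2 in auto)
  next
    case 3
    have "((\<lambda>h::real. (max 0 h) ^ (n + 1)) \<longlongrightarrow> (max 0 0) ^ (n + 1)) (at 0)"
      by (intro tendsto_power tendsto_max tendsto_const tendsto_ident_at)
    moreover have "\<forall>\<^sub>F h::real in at 0. (max 0 h) ^ (n + 1) = (max 0 h) ^ (n + 2) / h"
      unfolding eventually_at_filter by (auto simp: max_def)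
    ultimately have "((\<lambda>h::real. (max 0 h) ^ (n + 2) / h) \<longlongrightarrow> (max 0 0) ^ (n + 1)) (at 0)"
      by (rule Lim_transform_eventually)
    then show ?thesis unfolding 3 by (simp add: DERIV_def)
  qed
qed

text \<open>Below \<open>pi / 3\<close> the derivative of the sine is at least \<open>1 / 2\<close>; beyond, the sine is at least its value at
\<open>pi / 3\<close>, which exceeds \<open>pi / 4\<close>.\<close>

lemma sin_ge_half:
  assumes "0 \<le> x" "x \<le> pi / 2" shows "x / 2 \<le> sin x"
proof (cases "x \<le> pi / 3")
  case True
  have "sin 0 - 0 / 2 \<le> sin x - x / 2"
  proof (rule DERIV_nonneg_imp_nondecreasing[OF assms(1)])
    fix t assume t: "0 \<le> t" "t \<le> x"
    have "cos (pi / 3) \<le> cos t" by (rule cos_monotone_0_pi_le) (use t True in auto)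
    then have "0 \<le> cos t - 1 / 2" by (simp add: cos_60)
    moreover have "((\<lambda>x. sin x - x / 2) has_real_derivative cos t - 1 / 2) (at t)"
      by (intro DERIV_diff DERIV_sin) (use DERIV_cdivide[OF DERIV_ident[of "at t"], of 2] in simp)
    ultimately show "\<exists>y. ((\<lambda>x. sin x - x / 2) has_real_derivative y) (at t) \<and> 0 \<le> y" by blast
  qed
  then show ?thesis by simp
next
  case False
  have "sin (pi / 3) \<le> sin x"
    by (rule sin_monotone_2pi_le) (use False assms pi_gt_zero in auto)
  moreover have "(1.7 / 2 :: real) \<le> sqrt 3 / 2"
    by (intro divide_right_mono real_le_rsqrt) (auto simp: power2_eq_square)
  moreover have "x / 2 \<le> 1.7 / 2"
  proof -
    have "pi \<le> 3.2" by (rule order_trans[OF pi_approx(2)]) simp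
    then show ?thesis using assms(2) by simp
  qed
  ultimately show ?thesis by (simp add: sin_60)
qed

lemma abs_sin_pi_ge:
  assumes "\<bar>z\<bar> \<le> 1 / 2" shows "\<bar>z\<bar> \<le> \<bar>sin (pi * z)\<bar>"
proof -
  have "pi * \<bar>z\<bar> / 2 \<le> sin (pi * \<bar>z\<bar>)"
    using assms by (intro sin_ge_half) auto
  moreover have "\<bar>z\<bar> * 2 \<le> \<bar>z\<bar> * pi" using pi_ge_two by (intro mult_left_mono) auto
  moreover have "sin (pi * \<bar>z\<bar>) \<le> \<bar>sin (pi * z)\<bar>"
    by (cases "z \<ge> 0") auto
  ultimately show ?thesis by (simp add: mult.commute)
qed

text \<open>A periodic outward fold \<open>W\<close> of unit height and width \<open>s\<close>, with the first two derivatives. The function \<open>V\<close>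
is a primitive of the squared slope, and \<open>N\<close>, the integral of the squared slope over a period, measures how
much length one fold stores.\<close>

definition fold_profile ::
    "real \<Rightarrow> (real \<Rightarrow> real) \<Rightarrow> (real \<Rightarrow> real) \<Rightarrow> (real \<Rightarrow> real) \<Rightarrow> (real \<Rightarrow> real) \<Rightarrow> real \<Rightarrow> bool" where
  "fold_profile s W W' W'' V N \<longleftrightarrow>
     (\<forall>z. (W has_real_derivative W' z) (at z)) \<and> (\<forall>z. (W' has_real_derivative W'' z) (at z)) \<and>
     continuous_on UNIV W'' \<and> (\<forall>z. (V has_real_derivative (W' z)\<^sup>2) (at z)) \<and>
     (\<forall>z. W (z + 1) = W z) \<and> (\<forall>z. V (z + 1) = V z + N) \<and>
     (\<forall>z. 0 \<le> W z \<and> W z \<le> 1) \<and> (\<forall>z. \<bar>W'' z\<bar> \<le> 480 / s\<^sup>2) \<and>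
     (\<forall>z. \<bar>z\<bar> \<le> 1/2 \<longrightarrow> s < \<bar>z\<bar> \<longrightarrow> W z = 0 \<and> W'' z = 0) \<and> 1 \<le> N * s"

text \<open>Take the cube of the positive part of \<open>1 - (sin (pi z) / s)\<^sup>2\<close>: it is periodic by construction and the cube
makes it twice continuously differentiable. The bound on \<open>N\<close> holds because \<open>W\<close> descends from 1 to 0 on an
interval of length at most \<open>s\<close>; it is the Cauchy-Schwarz inequality for the slope.\<close>

lemma fold_profile_exists:
  fixes s :: real
  assumes s: "0 < s" "s \<le> 1"
  obtains W W' W'' V N where "fold_profile s W W' W'' V N"
proof -
  define q where "q z = 1 - (sin (pi * z))\<^sup>2 / s\<^sup>2" for z
  define q' where "q' z = - (2 * pi / s\<^sup>2) * (sin (pi * z) * cos (pi * z))" for z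
  define q'' where "q'' z = - (2 * pi / s\<^sup>2) * (pi * ((cos (pi * z))\<^sup>2 - (sin (pi * z))\<^sup>2))" for z
  define W where "W z = (max 0 (q z)) ^ 3" for z
  define W' where "W' z = 3 * (max 0 (q z))\<^sup>2 * q' z" for z
  define W'' where "W'' z = 3 * (max 0 (q z))\<^sup>2 * q'' z + 6 * max 0 (q z) * (q' z)\<^sup>2" for z
  have lin: "((\<lambda>z. pi * z) has_real_derivative pi) (at z)" for z
    using DERIV_cmult[OF DERIV_ident, of pi z UNIV] by simp
  have ds: "((\<lambda>z. sin (pi * z)) has_real_derivative pi * cos (pi * z)) (at z)" for z
    using DERIV_chain2[OF DERIV_sin lin, of z] by (simp add: mult.commute)
  have dc: "((\<lambda>z. cos (pi * z)) has_real_derivative - (pi * sin (pi * z))) (at z)" for z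
    using DERIV_chain2[OF DERIV_cos lin, of z] by (simp add: mult.commute)
  have dq: "(q has_real_derivative q' z) (at z)" for z
  proof -
    have "((\<lambda>z. (sin (pi * z))\<^sup>2 / s\<^sup>2) has_real_derivative (2 * (pi * cos (pi * z)) * sin (pi * z)) / s\<^sup>2) (at z)"
      using DERIV_cdivide[OF DERIV_power[OF ds[of z], of 2], of "s\<^sup>2"] by (simp add: mult_ac)
    from DERIV_diff[OF DERIV_const[of 1] this] show ?thesis
      by (simp add: q_def[abs_def] q'_def mult_ac)
  qed
  have dq': "(q' has_real_derivative q'' z) (at z)" for z
  proof -
    have "((\<lambda>z. sin (pi * z) * cos (pi * z)) has_real_derivative pi * ((cos (pi * z))\<^sup>2 - (sin (pi * z))\<^sup>2)) (at z)"
      using DERIV_mult'[OF ds[of z] dc[of z]] by (simp add: power2_eq_square algebra_simps)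
    from DERIV_cmult[OF this, of "- (2 * pi / s\<^sup>2)"] show ?thesis by (simp add: q'_def[abs_def] q''_def)
  qed
  have p3: "((\<lambda>x. (max 0 x) ^ 3) has_real_derivative 3 * (max 0 x)\<^sup>2) (at x)" for x :: real
    using positive_part_power_derivative[of 1 x] by (simp add: numeral_3_eq_3 numeral_2_eq_2)
  have p2: "((\<lambda>x. (max 0 x)\<^sup>2) has_real_derivative 2 * max 0 x) (at x)" for x :: real
    using positive_part_power_derivative[of 0 x] by (simp add: numeral_2_eq_2)
  have dW: "(W has_real_derivative W' z) (at z)" for z
    using DERIV_chain2[OF p3 dq, of z] by (simp add: W_def[abs_def] W'_def)
  have dW': "(W' has_real_derivative W'' z) (at z)" for z
  proof -
    have "((\<lambda>z. 3 * (max 0 (q z))\<^sup>2) has_real_derivative 3 * (2 * max 0 (q z) * q' z)) (at z)"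
      by (rule DERIV_cmult[OF DERIV_chain2[OF p2 dq]])
    from DERIV_mult'[OF this dq'] show ?thesis
      by (simp add: W'_def[abs_def] W''_def power2_eq_square mult_ac)
  qed
  have cq: "continuous_on UNIV q" unfolding q_def by (intro continuous_intros) (use s in auto)
  have cq': "continuous_on UNIV q'" unfolding q'_def by (intro continuous_intros) (use s in auto)
  have cq'': "continuous_on UNIV q''" unfolding q''_def by (intro continuous_intros) (use s in auto)
  have cW'': "continuous_on UNIV W''" unfolding W''_def
    by (intro continuous_on_add continuous_on_mult continuous_on_power continuous_on_max
      continuous_on_const cq cq' cq'')
  have cW': "continuous_on UNIV W'" using dW' DERIV_isCont continuous_at_imp_continuous_on by blast
  obtain V where V: "\<And>z. (V has_real_derivative (W' z)\<^sup>2) (at z)"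
    using continuous_antiderivative[OF continuous_on_power[OF cW', of 2]] by blast
  have s1: "sin (pi * (z + 1)) = - sin (pi * z)" and c1: "cos (pi * (z + 1)) = - cos (pi * z)" for z
    by (simp_all add: distrib_left)
  have q1: "q (z + 1) = q z" "q' (z + 1) = q' z" for z by (simp_all only: q_def q'_def s1 c1) simp_all
  have W1: "W (z + 1) = W z" "W' (z + 1) = W' z" for z by (simp_all add: W_def W'_def q1)
  define N where "N = V (1/2) - V (- 1/2)"
  have V1: "V (z + 1) = V z + N" for z
  proof -
    have d: "((\<lambda>z. V (z + 1) - V z) has_real_derivative 0) (at z)" for z
    proof -
      have "((\<lambda>z. z + 1) has_real_derivative 1) (at z)"
        using DERIV_add[OF DERIV_ident DERIV_const, of 1 z] by simp
      from DERIV_chain2[OF V this] have "((\<lambda>z. V (z + 1)) has_real_derivative (W' z)\<^sup>2) (at z)"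
        by (simp add: W1)
      from DERIV_diff[OF this V[of z]] show ?thesis by simp
    qed
    have "V (z + 1) - V z = V (- 1/2 + 1) - V (- 1/2)"
      by (rule DERIV_isconst_all) (use d in blast)
    then show ?thesis by (simp add: N_def)
  qed
  have qle: "q z \<le> 1" for z by (simp add: q_def)
  have W01: "0 \<le> W z" "W z \<le> 1" for z
    using qle[of z] by (auto simp: W_def intro!: power_le_one)
  have bound: "\<bar>W'' z\<bar> \<le> 480 / s\<^sup>2" for z
  proof (cases "q z \<le> 0")
    case True
    then show ?thesis by (simp add: W''_def max_def)
  next
    case False
    then have "(sin (pi * z))\<^sup>2 / s\<^sup>2 < 1" by (simp add: q_def)
    then have sn: "(sin (pi * z))\<^sup>2 \<le> s\<^sup>2" using s by (simp add: divide_less_eq)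
    have cn: "(cos (pi * z))\<^sup>2 \<le> 1" 
      using sin_cos_squared_add[of "pi * z"] zero_le_power2[of "sin (pi * z)"] by linarith
    have "(pi::real) \<le> 4" using pi_less_4 by simp
    then have pi2: "pi\<^sup>2 \<le> 16" using power_mono[of pi 4 2] by simp
    have "(q' z)\<^sup>2 = 4 * pi\<^sup>2 / (s\<^sup>2)\<^sup>2 * ((sin (pi * z))\<^sup>2 * (cos (pi * z))\<^sup>2)"
      by (simp add: q'_def power_mult_distrib power_divide)
    also have "\<dots> \<le> 4 * pi\<^sup>2 / (s\<^sup>2)\<^sup>2 * (s\<^sup>2 * 1)"
      using sn cn by (intro mult_left_mono mult_mono) auto
    also have "\<dots> = 4 * pi\<^sup>2 / s\<^sup>2" using s by (simp add: power2_eq_square)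
    also have "\<dots> \<le> 64 / s\<^sup>2" using pi2 by (intro divide_right_mono) auto
    finally have q'b: "(q' z)\<^sup>2 \<le> 64 / s\<^sup>2" .
    have "\<bar>(cos (pi * z))\<^sup>2 - (sin (pi * z))\<^sup>2\<bar> \<le> 1"
      using cn zero_le_power2[of "sin (pi * z)"] zero_le_power2[of "cos (pi * z)"] sin_cos_squared_add[of "pi * z"] by linarith
    then have "\<bar>q'' z\<bar> \<le> 2 * pi / s\<^sup>2 * (pi * 1)"
      unfolding q''_def abs_mult by (intro mult_mono) auto
    also have "\<dots> = 2 * pi\<^sup>2 / s\<^sup>2" by (simp add: power2_eq_square)
    also have "\<dots> \<le> 32 / s\<^sup>2" using pi2 by (intro divide_right_mono) auto
    finally have q''b: "\<bar>q'' z\<bar> \<le> 32 / s\<^sup>2" .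
    have m: "0 \<le> max 0 (q z)" "max 0 (q z) \<le> 1" "(max 0 (q z))\<^sup>2 \<le> 1"
      using qle[of z] by (auto intro!: power_le_one)
    have "\<bar>W'' z\<bar> \<le> 3 * ((max 0 (q z))\<^sup>2 * \<bar>q'' z\<bar>) + 6 * (max 0 (q z) * (q' z)\<^sup>2)"
      unfolding W''_def by (rule order_trans[OF abs_triangle_ineq]) (use m in \<open>simp add: abs_mult\<close>)
    also have "\<dots> \<le> 3 * (1 * (32 / s\<^sup>2)) + 6 * (1 * (64 / s\<^sup>2))"
      using m q'b q''b by (intro add_mono mult_left_mono mult_mono) auto
    also have "\<dots> = 480 / s\<^sup>2" by simp
    finally show ?thesis .
  qed
  have supp: "q z \<le> 0" if "\<bar>z\<bar> \<le> 1/2" "s \<le> \<bar>z\<bar> \<or> \<bar>z\<bar> = 1/2" for z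
  proof -
    have "s \<le> \<bar>sin (pi * z)\<bar>"
    proof (cases "\<bar>z\<bar> = 1/2")
      case True
      then have "z = 1/2 \<or> z = - (1/2)" by linarith
      then have "pi * z = pi / 2 \<or> pi * z = - (pi / 2)" by auto
      then have "\<bar>sin (pi * z)\<bar> = 1"
      proof
        assume "pi * z = - (pi / 2)"
        then show ?thesis by (simp only: sin_minus sin_pi_half)
      qed (simp only: sin_pi_half abs_one)
      then show ?thesis using s by simp
    next
      case False
      then show ?thesis using abs_sin_pi_ge[OF that(1)] that(2) by linarith
    qed
    then have "s\<^sup>2 \<le> (sin (pi * z))\<^sup>2" using power_mono[of s "\<bar>sin (pi * z)\<bar>" 2] s by simp
    then show ?thesis using s by (simp add: q_def le_divide_eq)
  qed
  have N: "1 \<le> N * s"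
  proof -
    define r where "r = min s (1/2)"
    have r: "0 < r" "r \<le> s" "r \<le> 1/2" using s by (auto simp: r_def)
    have "q r \<le> 0" by (rule supp) (use r in \<open>auto simp: r_def min_def\<close>)
    then have Wr: "W r = 0" by (simp add: W_def max_def)
    have W0: "W 0 = 1" by (simp add: W_def q_def)
    have mono: "V x \<le> V y" if "x \<le> y" for x y
      by (rule DERIV_nonneg_imp_nondecreasing[OF that]) (metis V zero_le_power2)
    \<comment> \<open>The slope \<open>- c\<close> is the average slope on \<open>{0..r}\<close>: expanding \<open>(W' + c)\<^sup>2 \<ge> 0\<close> is the
      Cauchy-Schwarz inequality.\<close>
    define c where "c = 1 / r"
    have "V 0 + 2 * c * W 0 + c\<^sup>2 * 0 \<le> V r + 2 * c * W r + c\<^sup>2 * r"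
    proof (rule DERIV_nonneg_imp_nondecreasing[of 0 r "\<lambda>z. V z + 2 * c * W z + c\<^sup>2 * z"])
      fix x
      have "((\<lambda>z. V z + 2 * c * W z + c\<^sup>2 * z) has_real_derivative (W' x)\<^sup>2 + 2 * c * W' x + c\<^sup>2 * 1) (at x)"
        by (intro DERIV_add V DERIV_cmult dW DERIV_ident)
      moreover have "(W' x)\<^sup>2 + 2 * c * W' x + c\<^sup>2 * 1 = (W' x + c)\<^sup>2" by (simp add: power2_sum mult_ac)
      ultimately show "\<exists>y. ((\<lambda>z. V z + 2 * c * W z + c\<^sup>2 * z) has_real_derivative y) (at x) \<and> 0 \<le> y"
        by (metis zero_le_power2)
    qed (use r in simp)
    then have "2 * c - c\<^sup>2 * r \<le> V r - V 0" using Wr W0 by simp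
    moreover have "c\<^sup>2 * r = c" using r by (simp add: c_def power2_eq_square)
    moreover have "V r \<le> V (1/2)" "V (- 1/2) \<le> V 0" using r by (auto intro!: mono)
    ultimately have "c \<le> N" by (simp add: N_def)
    moreover have "0 \<le> c" using r by (simp add: c_def)
    ultimately have "c * r \<le> N * s" using r by (intro mult_mono) linarith+
    then show ?thesis using r by (simp add: c_def)
  qed
  have supp': "W z = 0 \<and> W'' z = 0" if "\<bar>z\<bar> \<le> 1/2" "s < \<bar>z\<bar>" for z
    using supp[of z] that by (simp add: W_def W''_def max_def)
  have "fold_profile s W W' W'' V N"
    unfolding fold_profile_def using dW dW' cW'' V W1(1) V1 W01 bound supp' N by simp
  then show ?thesis by (rule that)
qed

lemma L2_loc_continuous: assumes "continuous_on UNIV F" shows "L2_loc F"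
proof -
  have "locally_integrable_on (\<lambda>x. (F x)\<^sup>2) UNIV"
    using assms by (intro locally_integrable_continuous continuous_on_power)
  moreover have "F \<in> borel_measurable lebesgue"
    using borel_measurable_continuous_onI[OF assms] by (intro measurable_completion) simp
  ultimately show ?thesis unfolding L2_loc_def locally_integrable_on_def by simp
qed

lemma weak_derivative_snd:
  assumes f: "\<And>x. (f has_real_derivative f' x) (at x)" and c: "continuous_on UNIV f'"
  shows "has_weak_derivative UNIV (1, 0) (\<lambda>p. f (snd p)) (\<lambda>p. 0)"
    and "has_weak_derivative UNIV (0, 1) (\<lambda>p. f (snd p)) (\<lambda>p. f' (snd p))"
proof -
  have d: "((\<lambda>p. f (snd p)) has_derivative (\<lambda>v. f' (snd p) * snd v)) (at p)" for p :: "real \<times> real"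
    using has_derivative_compose[OF has_derivative_snd[OF has_derivative_ident]
      f[unfolded has_field_derivative_def], of p UNIV] by simp
  have c': "continuous_on UNIV (\<lambda>p :: real \<times> real. f' (snd p) * snd v)" for v :: "real \<times> real"
    by (intro continuous_on_mult continuous_on_const continuous_on_compose2[OF c]
      continuous_on_snd continuous_on_id) auto
  show "has_weak_derivative UNIV (1, 0) (\<lambda>p. f (snd p)) (\<lambda>p. 0)"
    using classical_weak_derivative[of "\<lambda>p. f (snd p)" "\<lambda>p v. f' (snd p) * snd v" "(1, 0)", OF d c']
    by (simp add: Basis_real2)
  show "has_weak_derivative UNIV (0, 1) (\<lambda>p. f (snd p)) (\<lambda>p. f' (snd p))"
    using classical_weak_derivative[of "\<lambda>p. f (snd p)" "\<lambda>p v. f' (snd p) * snd v" "(0, 1)", OF d c']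
    by (simp add: Basis_real2)
qed

lemma L2_loc_snd:
  assumes "continuous_on UNIV f" shows "L2_loc (\<lambda>p. f (snd p))"
proof -
  have "continuous_on UNIV (\<lambda>p :: real \<times> real. f (snd p))"
    by (rule continuous_on_compose2[OF assms continuous_on_snd[OF continuous_on_id]]) simp
  then show ?thesis by (rule L2_loc_continuous)
qed

lemma DERIV_continuous_UNIV:
  fixes f :: "real \<Rightarrow> real"
  assumes "\<And>x. (f has_real_derivative f' x) (at x)" shows "continuous_on UNIV f"
  by (rule DERIV_continuous_on[OF has_field_derivative_at_within[OF assms]])

lemma H_loc_SucI:
  assumes "L2_loc F" "has_weak_derivative UNIV (1, 0) F G" "H_loc k G"
    "has_weak_derivative UNIV (0, 1) F G'" "H_loc k G'"
  shows "H_loc (Suc k) F"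
  unfolding H_loc.simps(2) Basis_real2
proof (intro conjI ballI assms(1))
  fix v :: "real \<times> real" assume "v \<in> {(1, 0), (0, 1)}"
  then have "v = (1, 0) \<or> v = (0, 1)" by simp
  then show "\<exists>G. has_weak_derivative UNIV v F G \<and> H_loc k G"
  proof
    assume v: "v = (1, 0)" show ?thesis unfolding v by (rule exI[of _ G]) (intro conjI assms)
  next
    assume v: "v = (0, 1)" show ?thesis unfolding v by (rule exI[of _ G']) (intro conjI assms)
  qed
qed

lemma H_loc_snd_1:
  assumes f: "\<And>x. (f has_real_derivative f' x) (at x)" and c: "continuous_on UNIV f'"
  shows "H_loc (Suc 0) (\<lambda>p. f (snd p))"
proof -
  have cf: "continuous_on UNIV f" by (rule DERIV_continuous_UNIV) (rule f)
  have 1: "L2_loc (\<lambda>p. f (snd p))" "L2_loc (\<lambda>p. f' (snd p))" "L2_loc (\<lambda>p. 0)"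
    by (rule L2_loc_snd[OF cf], rule L2_loc_snd[OF c], rule L2_loc_continuous, rule continuous_on_const)
  have 2: "has_weak_derivative UNIV (1, 0) (\<lambda>p. f (snd p)) (\<lambda>p. 0)"
    "has_weak_derivative UNIV (0, 1) (\<lambda>p. f (snd p)) (\<lambda>p. f' (snd p))"
    by (rule weak_derivative_snd(1)[of f f'], rule f, rule c,
      rule weak_derivative_snd(2)[of f f'], rule f, rule c)
  show ?thesis
    by (rule H_loc_SucI[of "\<lambda>p. f (snd p)" "\<lambda>p. 0" 0 "\<lambda>p. f' (snd p)"])
      (rule 1(1), rule 2(1), rule 1(3)[folded H_loc.simps(1)], rule 2(2), rule 1(2)[folded H_loc.simps(1)])
qed

lemma H_loc_snd_2:
  assumes f: "\<And>x. (f has_real_derivative f' x) (at x)" "\<And>x. (f' has_real_derivative f'' x) (at x)"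
    and c: "continuous_on UNIV f''"
  shows "H_loc (Suc (Suc 0)) (\<lambda>p. f (snd p))"
proof -
  have cf: "continuous_on UNIV f" "continuous_on UNIV f'"
    by (rule DERIV_continuous_UNIV, rule f(1), rule DERIV_continuous_UNIV, rule f(2))
  have z: "H_loc (Suc 0) (\<lambda>p. 0)"
    by (rule H_loc_snd_1[of "\<lambda>_. 0" "\<lambda>_. 0"]) (rule DERIV_const, rule continuous_on_const)
  have z': "H_loc (Suc 0) (\<lambda>p. f' (snd p))"
    by (rule H_loc_snd_1[of f' f'']) (rule f(2), rule c)
  have 2: "has_weak_derivative UNIV (1, 0) (\<lambda>p. f (snd p)) (\<lambda>p. 0)"
    "has_weak_derivative UNIV (0, 1) (\<lambda>p. f (snd p)) (\<lambda>p. f' (snd p))"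
    by (rule weak_derivative_snd(1)[of f f'], rule f(1), rule cf(2),
      rule weak_derivative_snd(2)[of f f'], rule f(1), rule cf(2))
  show ?thesis
    by (rule H_loc_SucI[of "\<lambda>p. f (snd p)" "\<lambda>p. 0" _ "\<lambda>p. f' (snd p)"])
      (rule L2_loc_snd[OF cf(1)], rule 2(1), rule z, rule 2(2), rule z')
qed

lemma H_per_self: "Omega_periodic f \<Longrightarrow> H_loc k f \<Longrightarrow> H_per k f"
  unfolding H_per_def by (intro exI[of _ f]) auto

lemma norm_matrix_2: "(norm (vector [vector [a, b], vector [c, d]] :: real^2^2))\<^sup>2 = a\<^sup>2 + b\<^sup>2 + c\<^sup>2 + d\<^sup>2"
  unfolding power2_norm_eq_inner by (simp add: inner_vec_def sum_2 power2_eq_square)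

lemma emeasure_strip:
  assumes "0 \<le> t"
  shows "emeasure lborel ({0..2 * pi} \<times> {- t..t}) = ennreal (4 * pi * t)"
proof -
  have "{0..2 * pi} \<times> {- t..t} = cbox (0, - t) (2 * pi, t)"
    by (auto simp: cbox_def Basis_real2)
  then show ?thesis using assms
    by (simp add: emeasure_lborel_cbox_eq Basis_real2 ennreal_mult[symmetric])
qed

lemma Omega_strip: "Omega = {0..2 * pi} \<times> {- (1/2)..1/2}"
  by (simp add: Omega_def)

text \<open>The displacement is axisymmetric, with amplitude \<open>A\<close> such that \<open>A\<^sup>2 N = 2 lam\<close>. Then
\<open>\<phi>\<^sub>z = - A\<^sup>2 V / 2\<close> cancels the axial strain of the fold and moves by exactly \<open>- lam\<close> per period, as
admissibility requires. There remain the hoop strain \<open>m + A W\<close> and the bending of the fold, and both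
differ from the state \<open>m\<close> only where \<open>\<bar>z\<bar> \<le> s\<close>.\<close>

lemma single_fold_competitor:
  fixes h lam vrho s :: real
  assumes s: "0 < s" "s \<le> 1" and lam: "0 < lam" and vrho: "1 < vrho"
  obtains \<phi> where "\<phi> \<in> A_vKD lam vrho"
    "E_vKD h \<phi> \<le> ennreal (2 * pi * (vrho - 1)\<^sup>2 + 4 * pi * s *
       (2 * (vrho - 1) * sqrt (2 * lam * s) + 2 * lam * s + h\<^sup>2 * (2 * lam * s) * (480 / s\<^sup>2)\<^sup>2))"
proof -
  define m where "m = vrho - 1"
  have m: "m > 0" using vrho by (simp add: m_def)
  obtain W W' W'' V N where "fold_profile s W W' W'' V N"
    using fold_profile_exists[OF s] by blast
  then have dW: "\<And>z. (W has_real_derivative W' z) (at z)" and dW': "\<And>z. (W' has_real_derivative W'' z) (at z)"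
    and cW'': "continuous_on UNIV W''" and dV: "\<And>z. (V has_real_derivative (W' z)\<^sup>2) (at z)"
    and perW: "\<And>z. W (z + 1) = W z" and perV: "\<And>z. V (z + 1) = V z + N"
    and W0: "\<And>z. 0 \<le> W z" and W1: "\<And>z. W z \<le> 1" and W''b: "\<And>z. \<bar>W'' z\<bar> \<le> 480 / s\<^sup>2"
    and supp: "\<And>z. \<bar>z\<bar> \<le> 1/2 \<Longrightarrow> s < \<bar>z\<bar> \<Longrightarrow> W z = 0 \<and> W'' z = 0" and N: "1 \<le> N * s"
    unfolding fold_profile_def by blast+
  have cW': "continuous_on UNIV W'" by (rule DERIV_continuous_UNIV[OF dW'])
  have N0: "N > 0" using N s by (metis zero_less_mult_pos2 less_le_trans zero_less_one)
  define A where "A = sqrt (2 * lam / N)"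
  have A0: "A \<ge> 0" and A2: "A\<^sup>2 = 2 * lam / N" using lam N0 by (simp_all add: A_def)
  have "2 * lam / N \<le> 2 * lam * s"
    using N N0 lam by (simp add: divide_le_eq) (metis mult.assoc mult.commute mult_left_mono mult.right_neutral less_imp_le)
  then have A2s: "A\<^sup>2 \<le> 2 * lam * s" and As: "A \<le> sqrt (2 * lam * s)"
    unfolding A2 by (auto simp: A_def)
  define \<phi> :: "real \<times> real \<Rightarrow> real^3" where
    "\<phi> p = vector [m + A * W (snd p), 0, - (A\<^sup>2 / 2) * V (snd p)]" for p
  define R where "R z = m + A * W z" for z
  define Z where "Z z = - (A\<^sup>2 / 2) * V z" for z
  have comps: "\<phi> p $ 1 = R (snd p)" "\<phi> p $ 2 = 0" "\<phi> p $ 3 = Z (snd p)" for p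
    by (auto simp: \<phi>_def R_def Z_def)
  have dR: "(R has_real_derivative A * W' z) (at z)" for z
    using DERIV_add[OF DERIV_const[of m] DERIV_cmult[OF dW[of z], of A]] by (simp add: R_def[abs_def])
  have dR': "((\<lambda>z. A * W' z) has_real_derivative A * W'' z) (at z)" for z
    by (rule DERIV_cmult[OF dW'])
  have dZ: "(Z has_real_derivative - (A\<^sup>2 / 2) * (W' z)\<^sup>2) (at z)" for z
    unfolding Z_def[abs_def] by (rule DERIV_cmult[OF dV])
  have cR': "continuous_on UNIV (\<lambda>z. A * W' z)" by (intro continuous_on_mult continuous_on_const cW')
  have cR'': "continuous_on UNIV (\<lambda>z. A * W'' z)" by (intro continuous_on_mult continuous_on_const cW'')
  have cZ': "continuous_on UNIV (\<lambda>z. - (A\<^sup>2 / 2) * (W' z)\<^sup>2)"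
    by (intro continuous_on_mult continuous_on_power continuous_on_const cW')
  have d0: "((\<lambda>_. 0) has_real_derivative 0) (at z)" for z :: real by simp
  have adm: "\<phi> \<in> A_vKD lam vrho"
    unfolding A_vKD_def mem_Collect_eq comps
  proof (intro conjI)
    show "H_per 2 (\<lambda>p. R (snd p))"
      using H_loc_snd_2[OF dR dR' cR''] perW
      by (intro H_per_self) (auto simp: Omega_periodic_def R_def numeral_2_eq_2)
    show "H_per 1 (\<lambda>p. 0)"
      using H_loc_snd_1[OF d0] by (intro H_per_self) (auto simp: Omega_periodic_def)
    have "((\<lambda>z. Z z + lam * z) has_real_derivative - (A\<^sup>2 / 2) * (W' z)\<^sup>2 + lam * 1) (at z)" for z
      by (intro DERIV_add dZ DERIV_cmult DERIV_ident)
    moreover have "continuous_on UNIV (\<lambda>z. - (A\<^sup>2 / 2) * (W' z)\<^sup>2 + lam * 1)"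
      by (intro continuous_on_add continuous_on_const cZ')
    ultimately have "H_loc (Suc 0) (\<lambda>p. Z (snd p) + lam * snd p)" by (rule H_loc_snd_1)
    moreover have "Z (z + 1) + lam * (z + 1) = Z z + lam * z" for z
    proof -
      have "A\<^sup>2 / 2 * N = lam" using N0 by (simp add: A2)
      moreover have "Z (z + 1) = Z z - A\<^sup>2 / 2 * N" unfolding Z_def perV by (simp add: distrib_left)
      ultimately show ?thesis by (simp add: distrib_left)
    qed
    ultimately show "H_per 1 (\<lambda>p. Z (snd p) + lam * snd p)"
      by (intro H_per_self) (auto simp: Omega_periodic_def)
    show "AE p in lebesgue_on Omega. vrho - 1 \<le> R (snd p)"
      using A0 W0 by (intro AE_I2) (simp add: R_def m_def)
  qed
  have B: "(1, 0) \<in> (Basis :: (real \<times> real) set)" "(0, 1) \<in> (Basis :: (real \<times> real) set)"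
    by (auto simp: Basis_real2)
  note wR = weak_derivative_snd[OF dR cR'] and wR' = weak_derivative_snd[OF dR' cR'']
    and wZ = weak_derivative_snd[OF dZ cZ'] and w0 = weak_derivative_snd[OF d0 continuous_on_const]
  note e1 = wderiv_eq[OF wR(1) B(1) AE_I2] and e2 = wderiv_eq[OF wR(2) B(2) AE_I2]
    and e3 = wderiv_eq[OF wZ(1) B(1) AE_I2] and e4 = wderiv_eq[OF wZ(2) B(2) AE_I2]
    and e5 = wderiv_eq[OF w0(1) B(1) AE_I2] and e6 = wderiv_eq[OF w0(2) B(2) AE_I2]
  have E1: "AE p in lebesgue. p \<in> Omega \<longrightarrow> d_theta (\<lambda>p. R (snd p)) p = 0" by (rule e1) simp
  have E2: "AE p in lebesgue. p \<in> Omega \<longrightarrow> d_z (\<lambda>p. R (snd p)) p = A * W' (snd p)" by (rule e2) simp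
  have E3: "AE p in lebesgue. p \<in> Omega \<longrightarrow> d_theta (\<lambda>p. Z (snd p)) p = 0" by (rule e3) simp
  have E4: "AE p in lebesgue. p \<in> Omega \<longrightarrow> d_z (\<lambda>p. Z (snd p)) p = - (A\<^sup>2 / 2) * (W' (snd p))\<^sup>2" by (rule e4) simp
  have E5: "AE p in lebesgue. p \<in> Omega \<longrightarrow> d_theta (\<lambda>p. 0) p = 0" by (rule e5) simp
  have E6: "AE p in lebesgue. p \<in> Omega \<longrightarrow> d_z (\<lambda>p. 0) p = 0" by (rule e6) simp
  note F1 = wderiv_eq[OF w0(1) B(1) E1] and F2 = wderiv_eq[OF w0(2) B(2) E1]
    and F3 = wderiv_eq[OF wR'(1) B(1) E2] and F4 = wderiv_eq[OF wR'(2) B(2) E2]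
  define c where "c = 2 * m * A + A\<^sup>2 + h\<^sup>2 * A\<^sup>2 * (480 / s\<^sup>2)\<^sup>2"
  have c0: "0 \<le> c" using m A0 by (simp add: c_def)
  define S where "S = {0..2 * pi} \<times> {- s..s}"
  have "E_vKD h \<phi> \<le> (\<integral>\<^sup>+ p. ennreal (m\<^sup>2) * indicator Omega p + ennreal c * indicator S p \<partial>lebesgue)"
    unfolding E_vKD_def
  proof (rule nn_integral_mono_AE)
    show "AE p in lebesgue. ennreal ((norm (strain \<phi> p))\<^sup>2 + h\<^sup>2 * (norm (hess (comp_rho \<phi>) p))\<^sup>2) * indicator Omega p
       \<le> ennreal (m\<^sup>2) * indicator Omega p + ennreal c * indicator S p"
      using E1 E2 E3 E4 E5 E6 F1 F2 F3 F4
    proof eventually_elim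
      case (elim p)
      show ?case
      proof (cases "p \<in> Omega")
        case True
        have st: "strain_tt \<phi> p = R (snd p)" "strain_tz \<phi> p = 0" "strain_zz \<phi> p = 0"
          unfolding strain_tt_def strain_tz_def strain_zz_def comps using elim True
          by (simp_all add: power_mult_distrib)
        have "(norm (strain \<phi> p))\<^sup>2 + h\<^sup>2 * (norm (hess (comp_rho \<phi>) p))\<^sup>2 =
            (R (snd p))\<^sup>2 + h\<^sup>2 * (A * W'' (snd p))\<^sup>2"
          unfolding strain_def hess_def norm_matrix_2 st comps using elim True by simp
        also have "\<dots> \<le> m\<^sup>2 + c * indicator S p"
        proof (cases "p \<in> S")
          case True
          have "A * W (snd p) \<le> A" using mult_left_mono[OF W1 A0] by simp
          then have "(R (snd p))\<^sup>2 \<le> (m + A)\<^sup>2"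
            using m A0 W0 by (intro power_mono) (auto simp: R_def)
          moreover have "(W'' (snd p))\<^sup>2 \<le> (480 / s\<^sup>2)\<^sup>2"
            using power_mono[OF W''b[of "snd p"], of 2] by simp
          then have "h\<^sup>2 * (A * W'' (snd p))\<^sup>2 \<le> h\<^sup>2 * A\<^sup>2 * (480 / s\<^sup>2)\<^sup>2"
            by (simp add: power_mult_distrib mult_left_mono mult.assoc)
          ultimately show ?thesis using True by (simp add: c_def power2_sum)
        next
          case False
          then have "\<bar>snd p\<bar> \<le> 1/2" "s < \<bar>snd p\<bar>" using True
            unfolding S_def Omega_def by (auto simp: mem_Times_iff)
          then have "W (snd p) = 0" "W'' (snd p) = 0" using supp by blast+
          then show ?thesis using False by (simp add: R_def)
        qed
        finally have "ennreal ((norm (strain \<phi> p))\<^sup>2 + h\<^sup>2 * (norm (hess (comp_rho \<phi>) p))\<^sup>2)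
            \<le> ennreal (m\<^sup>2 + c * indicator S p)" by (rule ennreal_leI)
        also have "\<dots> = ennreal (m\<^sup>2) + ennreal c * indicator S p"
          using c0 by (cases "p \<in> S") (auto simp: ennreal_plus)
        finally show ?thesis using True by simp
      qed simp
    qed
  qed
  also have "\<dots> = (\<integral>\<^sup>+ p. ennreal (m\<^sup>2) * indicator Omega p + ennreal c * indicator S p \<partial>lborel)"
    by (rule nn_integral_completion)
  also have "\<dots> = ennreal (m\<^sup>2) * emeasure lborel Omega + ennreal c * emeasure lborel S"
  proof -
    have [measurable]: "Omega \<in> sets borel" "S \<in> sets borel"
      unfolding Omega_def S_def by (intro borel_closed closed_Times closed_atLeastAtMost)+
    show ?thesis by (simp add: nn_integral_add nn_integral_cmult_indicator)
  qed
  also have "\<dots> = ennreal (2 * pi * m\<^sup>2 + 4 * pi * s * c)"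
    unfolding Omega_strip S_def using s c0
    by (subst (1 2) emeasure_strip) (auto simp: ennreal_mult[symmetric] ennreal_plus[symmetric] mult_ac simp del: ennreal_plus)
  also have "\<dots> \<le> ennreal (2 * pi * (vrho - 1)\<^sup>2 + 4 * pi * s *
       (2 * (vrho - 1) * sqrt (2 * lam * s) + 2 * lam * s + h\<^sup>2 * (2 * lam * s) * (480 / s\<^sup>2)\<^sup>2))"
  proof (rule ennreal_leI)
    have "2 * m * A \<le> 2 * m * sqrt (2 * lam * s)" using As m by (intro mult_left_mono) auto
    moreover have "h\<^sup>2 * A\<^sup>2 * (480 / s\<^sup>2)\<^sup>2 \<le> h\<^sup>2 * (2 * lam * s) * (480 / s\<^sup>2)\<^sup>2"
      using A2s by (intro mult_right_mono mult_left_mono) auto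
    ultimately have "c \<le> 2 * m * sqrt (2 * lam * s) + 2 * lam * s + h\<^sup>2 * (2 * lam * s) * (480 / s\<^sup>2)\<^sup>2"
      using A2s unfolding c_def by linarith
    then have "4 * pi * s * c \<le> 4 * pi * s * (2 * m * sqrt (2 * lam * s) + 2 * lam * s + h\<^sup>2 * (2 * lam * s) * (480 / s\<^sup>2)\<^sup>2)"
      using s by (intro mult_left_mono) auto
    then show "2 * pi * m\<^sup>2 + 4 * pi * s * c \<le> 2 * pi * (vrho - 1)\<^sup>2 + 4 * pi * s *
       (2 * (vrho - 1) * sqrt (2 * lam * s) + 2 * lam * s + h\<^sup>2 * (2 * lam * s) * (480 / s\<^sup>2)\<^sup>2)"
      by (simp add: m_def)
  qed
  finally show ?thesis using that[OF adm] by blast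
qed

section \<open>Borel representatives\<close>

lemma AE_lborel_translate:
  fixes w :: "'a::euclidean_space"
  assumes "AE x in lborel. P x" shows "AE x in lborel. P (w + x)"
proof (rule AE_measure_preserving[OF _ _ assms])
  show "(+) w \<in> lborel \<rightarrow>\<^sub>M lborel" by simp
  show "distr lborel lborel ((+) w) = lborel"
    using lborel_distr_plus[of w] by (simp cong: distr_cong)
qed

lemma lborel_integral_swap:
  fixes f :: "real \<times> real \<Rightarrow> real"
  assumes "f \<in> borel_measurable borel"
  shows "(LBINT p. f (snd p, fst p)) = (LBINT p. f p)"
    and "integrable lborel (\<lambda>p. f (snd p, fst p)) = integrable lborel f"
proof -
  have "f \<in> borel_measurable (lborel \<Otimes>\<^sub>M lborel)" using assms unfolding lborel_prod by simp
  from lborel_pair.integral_product_swap[OF this] show "(LBINT p. f (snd p, fst p)) = (LBINT p. f p)"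
    unfolding lborel_prod by (simp add: case_prod_beta')
  show "integrable lborel (\<lambda>p. f (snd p, fst p)) = integrable lborel f"
    using lborel_pair.integrable_product_swap_iff[of f] unfolding lborel_prod by (simp add: case_prod_beta')
qed

lemma borel_measurable_swap:
  fixes f :: "real \<times> real \<Rightarrow> real"
  assumes "f \<in> borel_measurable borel" shows "(\<lambda>p. f (snd p, fst p)) \<in> borel_measurable borel"
proof -
  have "(\<lambda>p :: real \<times> real. (snd p, fst p)) \<in> borel_measurable borel"
    by (intro borel_measurable_continuous_onI continuous_on_Pair continuous_on_fst continuous_on_snd continuous_on_id)
  from measurable_compose[OF this assms] show ?thesis .
qed

lemma loc_int_of_locally_integrable:
  assumes F: "locally_integrable_on F UNIV" and b: "Fb \<in> borel_measurable borel" and eq: "AE p in lborel. F p = Fb p"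
  shows "loc_int Fb"
  unfolding loc_int_def
proof (intro conjI allI b)
  fix a b' c d :: real
  define K where "K = {a..b'} \<times> {c..d}"
  have "compact K" unfolding K_def by (intro compact_Times compact_Icc)
  then have i: "integrable lebesgue (\<lambda>p. indicator K p * F p)"
    using F unfolding locally_integrable_on_def set_integrable_def by simp
  have "AE p in lebesgue. indicator K p * F p = indicator K p * Fb p"
    using AE_completion[OF eq] by eventually_elim simp
  then have "integrable lebesgue (\<lambda>p. indicator K p * Fb p)" by (rule lebesgue_integrable_cong_AE[OF i])
  moreover have "K \<in> sets borel" using \<open>compact K\<close> by (rule borel_compact)
  then have "(\<lambda>p. indicator K p * Fb p) \<in> borel_measurable lborel" using b by simp
  ultimately show "integrable lborel (\<lambda>p. indicator ({a..b'} \<times> {c..d}) p * Fb p)"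
    using integrable_completion unfolding K_def by blast
qed

lemma loc_int_swap: assumes "loc_int F" shows "loc_int (\<lambda>p. F (snd p, fst p))"
  unfolding loc_int_def
proof (intro conjI allI)
  have F: "F \<in> borel_measurable borel" using assms by (simp add: loc_int_def)
  then show "(\<lambda>p. F (snd p, fst p)) \<in> borel_measurable borel" by (rule borel_measurable_swap)
  fix a b c d :: real
  have i: "integrable lborel (\<lambda>p. indicator ({c..d} \<times> {a..b}) p * F p)" using assms unfolding loc_int_def by blast
  have "(\<lambda>p. indicator ({c..d} \<times> {a..b}) p * F p) \<in> borel_measurable borel" using i by auto
  from lborel_integral_swap(2)[OF this] i
  have "integrable lborel (\<lambda>p. indicator ({c..d} \<times> {a..b}) (snd p, fst p) * F (snd p, fst p))" by simp
  moreover have "indicator ({c..d} \<times> {a..b}) (snd p, fst p) = (indicator ({a..b} \<times> {c..d}) p :: real)" for p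
    by (cases p) (auto simp: indicator_def)
  ultimately show "integrable lborel (\<lambda>p. indicator ({a..b} \<times> {c..d}) p * F (snd p, fst p))" by simp
qed

lemma tensor_test1: assumes "test1 \<psi>" "test1 \<eta>" shows "test_function UNIV (tensor \<psi> \<eta>)"
proof -
  obtain a b where "\<And>x. x \<notin> {a..b} \<Longrightarrow> \<psi> x = 0" "smooth \<psi>" using assms(1) by (auto simp: test1_def)
  moreover obtain c d where "\<And>x. x \<notin> {c..d} \<Longrightarrow> \<eta> x = 0" "smooth \<eta>" using assms(2) by (auto simp: test1_def)
  ultimately show ?thesis by (intro test_function_tensor[of _ _ a b c d]) auto
qed

lemma tensor_measurable: "test1 \<psi> \<Longrightarrow> test1 \<eta> \<Longrightarrow> tensor \<psi> \<eta> \<in> borel_measurable borel"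
  unfolding tensor_def[abs_def] using test1_measurable[measurable] by measurable

lemma integral_lebesgue_lborel_AE:
  fixes F Fb h :: "real \<times> real \<Rightarrow> real"
  assumes eq: "AE p in lborel. F p = Fb p" and b: "Fb \<in> borel_measurable borel" "h \<in> borel_measurable borel"
    and i: "integrable lborel (\<lambda>p. Fb p * h p)"
  shows "(\<integral>p. F p * h p \<partial>lebesgue) = (\<integral>p. Fb p * h p \<partial>(lborel :: (real \<times> real) measure))"
proof -
  have m: "(\<lambda>p. Fb p * h p) \<in> borel_measurable lborel" using borel_measurable_times[OF b] by simp
  have "integrable lebesgue (\<lambda>p. Fb p * h p)" using i integrable_completion[OF m] by simp
  moreover have "AE p in lebesgue. Fb p * h p = F p * h p"
    using AE_completion[OF eq] by eventually_elim simp
  ultimately have "(\<integral>p. F p * h p \<partial>lebesgue) = (\<integral>p. Fb p * h p \<partial>lebesgue)" by (rule lebesgue_integrable_cong_AE(2))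
  then show ?thesis using integral_completion[OF m] by simp
qed

lemma loc_int_tensor:
  assumes "loc_int F" "test1 \<psi>" "test1 \<eta>" shows "integrable lborel (\<lambda>p. F p * tensor \<psi> \<eta> p)"
proof -
  obtain B where B: "\<And>x. \<bar>\<psi> x\<bar> \<le> B" using test1_bounded[OF assms(2)] by blast
  obtain C where C: "\<And>x. \<bar>\<eta> x\<bar> \<le> C" using test1_bounded[OF assms(3)] by blast
  obtain a b where ab: "\<And>x. x \<notin> {a..b} \<Longrightarrow> \<psi> x = 0" using assms(2) by (auto simp: test1_def)
  obtain c d where cd: "\<And>x. x \<notin> {c..d} \<Longrightarrow> \<eta> x = 0" using assms(3) by (auto simp: test1_def)
  show ?thesis
  proof (rule loc_int_bounded[OF assms(1) tensor_measurable[OF assms(2,3)]])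
    show "\<bar>tensor \<psi> \<eta> p\<bar> \<le> B * C" for p
      unfolding tensor_def abs_mult using B[of "fst p"] C[of "snd p"] by (intro mult_mono) auto
    show "tensor \<psi> \<eta> p = 0" if "p \<notin> {a..b} \<times> {c..d}" for p
      using that ab[of "fst p"] cd[of "snd p"] unfolding tensor_def mem_Times_iff by auto
  qed
qed

lemma weak_derivative_tensor:
  assumes w: "has_weak_derivative UNIV v F G"
    and Fb: "Fb \<in> borel_measurable borel" "AE p in lborel. F p = Fb p"
    and Gb: "Gb \<in> borel_measurable borel" "AE p in lborel. G p = Gb p"
    and t: "test1 \<psi>" "test1 \<eta>" and t': "test1 \<psi>'" "test1 \<eta>'"
    and d: "\<And>p. frechet_derivative (tensor \<psi> \<eta>) (at p) v = tensor \<psi>' \<eta>' p"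
  shows "(LBINT p. Fb p * tensor \<psi>' \<eta>' p) = - (LBINT p. Gb p * tensor \<psi> \<eta> p)"
proof -
  have lF: "loc_int Fb" and lG: "loc_int Gb"
    using w Fb Gb loc_int_of_locally_integrable unfolding has_weak_derivative_def by blast+
  have "(\<integral>p. F p * tensor \<psi>' \<eta>' p \<partial>lebesgue) = - (\<integral>p. G p * tensor \<psi> \<eta> p \<partial>lebesgue)"
    using weak_derivative_integrals[OF w tensor_test1[OF t]] by (simp add: d)
  then show ?thesis
    using integral_lebesgue_lborel_AE[OF Fb(2,1) tensor_measurable[OF t'] loc_int_tensor[OF lF t']]
      integral_lebesgue_lborel_AE[OF Gb(2,1) tensor_measurable[OF t] loc_int_tensor[OF lG t]] by simp
qed

lemma z_weak_of_weak_derivative: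
  assumes w: "has_weak_derivative UNIV (0, 1) F G"
    and Fb: "Fb \<in> borel_measurable borel" "AE p in lborel. F p = Fb p"
    and Gb: "Gb \<in> borel_measurable borel" "AE p in lborel. G p = Gb p"
  shows "z_weak Fb Gb"
  unfolding z_weak_def
proof (intro conjI allI impI)
  show "loc_int Fb" "loc_int Gb"
    using w Fb Gb loc_int_of_locally_integrable unfolding has_weak_derivative_def by blast+
  fix \<psi> \<eta> \<eta>' assume t: "test1 \<psi>" "test1 \<eta>" and d: "\<forall>x. (\<eta> has_real_derivative \<eta>' x) (at x)"
  obtain \<psi>' where d': "\<And>x. (\<psi> has_real_derivative \<psi>' x) (at x)"
    using t(1) smooth_has_derivative[of \<psi>] unfolding test1_def by metis
  show "(LBINT p. Fb p * tensor \<psi> \<eta>' p) = - (LBINT p. Gb p * tensor \<psi> \<eta> p)"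
  proof (rule weak_derivative_tensor[OF w Fb Gb t t(1) test1_deriv[OF t(2)]])
    show "(\<eta> has_real_derivative \<eta>' x) (at x)" for x using d by blast
    show "frechet_derivative (tensor \<psi> \<eta>) (at p) (0, 1) = tensor \<psi> \<eta>' p" for p
      by (rule frechet_derivative_tensor(2)[OF d' d[rule_format]])
  qed
qed

lemma tensor_swap: "tensor \<psi> \<eta> (snd p, fst p) = tensor \<eta> \<psi> p"
  by (simp add: tensor_def)

lemma integral_tensor_swap:
  assumes "F \<in> borel_measurable borel" "tensor \<eta> \<psi> \<in> borel_measurable borel"
  shows "(LBINT p. F (snd p, fst p) * tensor \<psi> \<eta> p) = (LBINT p. F p * tensor \<eta> \<psi> p)"
  using lborel_integral_swap(1)[OF borel_measurable_times[OF assms]] by (simp add: tensor_swap)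

lemma z_weak_of_weak_derivative_swap:
  assumes w: "has_weak_derivative UNIV (1, 0) F G"
    and Fb: "Fb \<in> borel_measurable borel" "AE p in lborel. F p = Fb p"
    and Gb: "Gb \<in> borel_measurable borel" "AE p in lborel. G p = Gb p"
  shows "z_weak (\<lambda>p. Fb (snd p, fst p)) (\<lambda>p. Gb (snd p, fst p))"
  unfolding z_weak_def
proof (intro conjI allI impI loc_int_swap)
  show "loc_int Fb" "loc_int Gb"
    using w Fb Gb loc_int_of_locally_integrable unfolding has_weak_derivative_def by blast+
  fix \<psi> \<eta> \<eta>' assume t: "test1 \<psi>" "test1 \<eta>" and d: "\<forall>x. (\<eta> has_real_derivative \<eta>' x) (at x)"
  have t': "test1 \<eta>'" by (rule test1_deriv[OF t(2)]) (use d in blast)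
  obtain \<psi>' where d': "\<And>x. (\<psi> has_real_derivative \<psi>' x) (at x)"
    using t(1) smooth_has_derivative[of \<psi>] unfolding test1_def by metis
  have "(LBINT p. Fb p * tensor \<eta>' \<psi> p) = - (LBINT p. Gb p * tensor \<eta> \<psi> p)"
  proof (rule weak_derivative_tensor[OF w Fb Gb t(2,1) t' t(1)])
    show "frechet_derivative (tensor \<eta> \<psi>) (at p) (1, 0) = tensor \<eta>' \<psi> p" for p
      by (rule frechet_derivative_tensor(1)[OF d[rule_format] d'])
  qed
  then show "(LBINT p. Fb (snd p, fst p) * tensor \<psi> \<eta>' p) = - (LBINT p. Gb (snd p, fst p) * tensor \<psi> \<eta> p)"
    using integral_tensor_swap[OF Fb(1) tensor_measurable[OF t' t(1)]]
      integral_tensor_swap[OF Gb(1) tensor_measurable[OF t(2,1)]] by simp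
qed

lemma z_per_of_AE_periodic:
  assumes l: "loc_int F" and per: "AE p in lborel. F ((0, T) + p) = F p"
  shows "z_per T F"
  unfolding z_per_def
proof (intro allI impI)
  fix \<psi> \<eta> assume t: "test1 \<psi>" "test1 \<eta>"
  define \<zeta> where "\<zeta> z = \<eta> (z - T)" for z
  have t\<zeta>: "test1 \<zeta>"
  proof -
    obtain a b where ab: "\<And>x. x \<notin> {a..b} \<Longrightarrow> \<eta> x = 0" "smooth \<eta>" using t(2) by (auto simp: test1_def)
    have "smooth (\<lambda>z. \<eta> (1 * z + (- T)))" by (rule smooth_affine[OF ab(2)])
    moreover have "\<zeta> x = 0" if "x \<notin> {a + T..b + T}" for x
      unfolding \<zeta>_def by (rule ab(1)) (use that in auto)
    ultimately show ?thesis unfolding test1_def by (auto simp: \<zeta>_def[abs_def])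
  qed
  note i = loc_int_tensor[OF l t(1) t\<zeta>] loc_int_tensor[OF l t]
  have "(LBINT p. F p * tensor \<psi> \<zeta> p) = (LBINT p. F ((0, T) + p) * tensor \<psi> \<zeta> ((0, T) + p))"
    by (rule lborel_integral_translate(1)[symmetric]) (use i in auto)
  also have "\<dots> = (LBINT p. F p * tensor \<psi> \<eta> p)"
  proof (rule integral_cong_AE)
    show "AE p in lborel. F ((0, T) + p) * tensor \<psi> \<zeta> ((0, T) + p) = F p * tensor \<psi> \<eta> p"
      using per by eventually_elim (simp add: tensor_def \<zeta>_def)
    show "(\<lambda>p. F p * tensor \<psi> \<eta> p) \<in> borel_measurable lborel" using i by auto
    have "(\<lambda>p. (0, T) + p) \<in> borel_measurable (borel :: (real \<times> real) measure)" by simp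
    from measurable_compose[OF this, of "\<lambda>p. F p * tensor \<psi> \<zeta> p" borel]
    show "(\<lambda>p. F ((0, T) + p) * tensor \<psi> \<zeta> ((0, T) + p)) \<in> borel_measurable lborel"
      using i by auto
  qed
  finally have "(LBINT p. F p * tensor \<psi> \<eta> p) - (LBINT p. F p * tensor \<psi> \<zeta> p) = 0" by simp
  then show "(LBINT p. F p * tensor \<psi> (\<lambda>z. \<eta> z - \<eta> (z - T)) p) = 0"
    using i by (simp add: tensor_diff_right right_diff_distrib \<zeta>_def[abs_def])
qed

lemma AE_periodic:
  assumes per: "\<And>p. F (w + p) = F p" and eq: "AE p in lborel. F p = Fb p"
  shows "AE p in (lborel :: (real \<times> real) measure). Fb (w + p) = Fb p"
  using eq AE_lborel_translate[OF eq, of w] by eventually_elim (use per in metis)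

section \<open>Slope and excess energy\<close>

lemma continuous_indefinite_integral:
  fixes k :: "real \<Rightarrow> real"
  assumes k: "integrable lborel k"
  shows "continuous_on UNIV (\<lambda>z. \<integral>s. indicator {a..z} s * k s \<partial>lborel)"
proof (rule continuous_at_imp_continuous_on, intro ballI, unfold continuous_at_sequentially, intro allI impI)
  fix z :: real and x :: "nat \<Rightarrow> real" assume "x \<longlonglongrightarrow> z"
  have [measurable]: "k \<in> borel_measurable borel" using k by auto
  have "(\<lambda>n. \<integral>s. indicator {a..x n} s * k s \<partial>lborel) \<longlonglongrightarrow> (LBINT s. indicator {a..z} s * k s)"
  proof (rule integral_dominated_convergence[where w="\<lambda>s. norm (k s)"])
    show "AE s in lborel. (\<lambda>n. indicator {a..x n} s * k s) \<longlonglongrightarrow> indicator {a..z} s * k s"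
      using AE_lborel_singleton[of z]
    proof eventually_elim
      case (elim s)
      have "\<forall>\<^sub>F n in sequentially. (s \<le> x n) = (s \<le> z)"
      proof (cases "s < z")
        case True
        then show ?thesis using order_tendstoD(1)[OF \<open>x \<longlonglongrightarrow> z\<close> True] by (auto elim: eventually_mono)
      next
        case False
        then have "z < s" using elim by simp
        then show ?thesis using order_tendstoD(2)[OF \<open>x \<longlonglongrightarrow> z\<close>, of s] by (auto elim: eventually_mono)
      qed
      then have "\<forall>\<^sub>F n in sequentially. indicator {a..x n} s * k s = indicator {a..z} s * k s"
        by eventually_elim (auto simp: indicator_def)
      then show ?case by (rule tendsto_eventually)
    qed
    show "AE s in lborel. norm (indicator {a..x n} s * k s) \<le> norm (k s)" for n
      by (auto simp: indicator_def)
  qed (use k in \<open>auto intro: integrable_norm\<close>)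
  then show "((\<lambda>z. \<integral>s. indicator {a..z} s * k s \<partial>lborel) \<circ> x) \<longlonglongrightarrow> (LBINT s. indicator {a..z} s * k s)"
    by (simp add: o_def)
qed

lemma continuous_AE_nonneg:
  fixes f :: "real \<Rightarrow> real"
  assumes c: "continuous_on UNIV f" and ae: "AE z in lborel. z \<in> {a<..<b} \<longrightarrow> 0 \<le> f z"
    and ab: "a < b" and z: "z \<in> {a..b}"
  shows "0 \<le> f z"
proof (rule ccontr)
  assume "\<not> 0 \<le> f z"
  define S where "S = {y. f y < 0}"
  have oS: "open S" unfolding S_def by (intro open_Collect_less c continuous_on_const)
  have "z \<in> S" using \<open>\<not> 0 \<le> f z\<close> by (simp add: S_def)
  moreover have "z \<in> closure {a<..<b}" using z ab by (simp add: closure_greaterThanLessThan)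
  ultimately have ne: "S \<inter> {a<..<b} \<noteq> {}" 
    using open_Int_closure_eq_empty[OF oS, of "{a<..<b}"] by blast
  have "AE y in lebesgue. y \<notin> S \<inter> {a<..<b}"
    using AE_completion[OF ae] by eventually_elim (auto simp: S_def)
  moreover have "S \<inter> {a<..<b} \<in> sets lebesgue" using oS by auto
  ultimately have "S \<inter> {a<..<b} \<in> null_sets lebesgue" by (simp add: AE_iff_null_sets)
  then have "negligible (S \<inter> {a<..<b})" by (simp add: negligible_iff_null_sets)
  then show False using open_not_negligible[of "S \<inter> {a<..<b}"] ne
      open_Int[OF oS open_greaterThanLessThan[of a b]] by blast
qed

text \<open>The interval is longer than one, so \<open>A\<close> cannot exceed \<open>\<delta>\<close> almost everywhere on it.\<close>

lemma exists_small_value: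
  fixes A :: "real \<Rightarrow> real"
  assumes A: "integrable lborel A" and z: "\<And>x. x \<notin> {0..2 * pi} \<Longrightarrow> A x = 0"
    and le: "(LBINT x. A x) \<le> \<delta>" and \<delta>: "0 < \<delta>"
    and Q: "AE x in lborel. x \<in> {0<..<2 * pi} \<longrightarrow> Q x"
  shows "\<exists>x. Q x \<and> A x \<le> \<delta>"
proof (rule ccontr)
  assume n: "\<not> (\<exists>x. Q x \<and> A x \<le> \<delta>)"
  have "(LBINT x. \<delta> * indicator {0..2 * pi} x) \<le> (LBINT x. A x)"
  proof (rule integral_mono_AE[OF _ A])
    show "integrable lborel (\<lambda>x. \<delta> * indicator {0..2 * pi} x)"
      by (intro integrable_mult_right integrable_real_indicator) (auto simp: emeasure_lborel_Icc_eq)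
    show "AE x in lborel. \<delta> * indicator {0..2 * pi} x \<le> A x"
      using Q AE_lborel_singleton[of 0] AE_lborel_singleton[of "2 * pi"]
    proof eventually_elim
      case (elim x)
      show ?case
      proof (cases "x \<in> {0..2 * pi}")
        case True
        then have "Q x" using elim by auto
        then have "\<delta> \<le> A x" using n by force
        then show ?thesis using True by simp
      qed (simp add: z)
    qed
  qed
  then have "\<delta> * (2 * pi) \<le> \<delta>" using le by simp
  then have "2 * pi \<le> 1" using \<delta> by simp
  then show False using pi_gt3 by simp
qed

lemma Omega_borel: "Omega \<in> sets borel"
  unfolding Omega_def by (intro borel_closed closed_Times closed_atLeastAtMost)

lemma indicator_Omega_line:
  "x \<in> {0..2 * pi} \<Longrightarrow> indicator Omega (x, z) = (indicator {- 1/2..1/2} z :: real)"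
  by (auto simp: Omega_def indicator_def)

lemma loc_int_Omega: "loc_int F \<Longrightarrow> integrable lborel (\<lambda>p. indicator Omega p * F p)"
  unfolding loc_int_def Omega_def by blast

text \<open>On a line where \<open>g\<close> and \<open>f\<close> are almost everywhere indefinite integrals of \<open>k\<close> and \<open>g\<close>, they coincide with
a continuous function \<open>g1\<close> and a continuously differentiable function \<open>u\<close>, to which the interpolation
inequality applies. The almost everywhere bounds become bounds everywhere by continuity.\<close>

lemma good_line_estimate:
  fixes L d c :: real and f g k :: "real \<Rightarrow> real"
  defines "a \<equiv> - 1/2 :: real" and "b \<equiv> 1/2 :: real"
  assumes f: "AE z in lborel. z \<in> {a<..<b} \<longrightarrow> f z = c + (LBINT s. indicator {a..z} s * g s)"
    and ik: "integrable lborel (\<lambda>s. indicator {a..b} s * k s)"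
    and g: "AE z in lborel. z \<in> {a<..<b} \<longrightarrow> g z = d + (LBINT s. indicator {a..z} s * k s)"
    and g0: "(LBINT s. indicator {a..b} s * g s) = 0" and k0: "(LBINT s. indicator {a..b} s * k s) = 0"
    and ik2: "integrable lborel (\<lambda>s. indicator {a..b} s * (k s)\<^sup>2)"
    and f0: "AE z in lborel. z \<in> {a<..<b} \<longrightarrow> 0 \<le> f z" and L: "AE z in lborel. z \<in> {a<..<b} \<longrightarrow> \<bar>g z\<bar> \<le> L"
    and fm: "f \<in> borel_measurable borel" and gm: "g \<in> borel_measurable borel"
  shows "(LBINT s. indicator {a..b} s * (g s)\<^sup>2) ^ 4 \<le>
    2 * L * (LBINT s. indicator {a..b} s * f s) ^ 3 * (LBINT s. indicator {a..b} s * (k s)\<^sup>2) ^ 2"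
    and "integrable lborel (\<lambda>s. indicator {a..b} s * (g s)\<^sup>2)"
proof -
  have ab: "a < b" by (simp add: a_def b_def)
  \<comment> \<open>Cut off outside the interval, so that the indefinite integral is continuous on the whole line.\<close>
  define k1 where "k1 s = indicator {a..b} s * k s" for s
  define g1 where "g1 z = d + (LBINT s. indicator {a..z} s * k1 s)" for z
  have cg1: "continuous_on UNIV g1" unfolding g1_def
    by (intro continuous_on_add continuous_on_const continuous_indefinite_integral) (use ik in \<open>simp add: k1_def[abs_def]\<close>)
  have kk1: "indicator {a..z} s * k1 s = indicator {a..z} s * k s" if "z \<le> b" for s z
    using that by (auto simp: k1_def indicator_def)
  have ends: "AE z in lborel. z \<in> {a..b} \<longrightarrow> z \<in> {a<..<b}"
    using AE_lborel_singleton[of a] AE_lborel_singleton[of b] by eventually_elim auto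
  have gg1: "AE z in lborel. z \<in> {a..b} \<longrightarrow> g z = g1 z"
    using g ends by eventually_elim (auto simp: g1_def kk1)
  obtain u0 where u0: "\<And>x. (u0 has_real_derivative g1 x) (at x)" using continuous_antiderivative[OF cg1] by blast
  define u where "u z = c + (u0 z - u0 a)" for z
  have u: "(u has_real_derivative g1 x) (at x)" for x
    unfolding u_def using DERIV_add[OF DERIV_const DERIV_diff[OF u0 DERIV_const]] by simp
  have cu: "continuous_on UNIV u" by (rule DERIV_continuous_UNIV[OF u])
  have uz: "u z = c + (LBINT s. indicator {a..z} s * g s)" if z: "z \<in> {a..b}" for z
  proof -
    have "(LBINT s. indicator {a..z} s * g1 s) = u0 z - u0 a"
      by (rule integral_FTC_real[OF _ u0 cg1]) (use z in auto)
    moreover have "(LBINT s. indicator {a..z} s * g s) = (LBINT s. indicator {a..z} s * g1 s)"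
    proof (rule integral_cong_AE)
      show "AE s in lborel. indicator {a..z} s * g s = indicator {a..z} s * g1 s"
        using gg1 by eventually_elim (use z in \<open>auto simp: indicator_def\<close>)
      show "(\<lambda>s. indicator {a..z} s * g s) \<in> borel_measurable lborel" using gm by simp
      show "(\<lambda>s. indicator {a..z} s * g1 s) \<in> borel_measurable lborel"
        using borel_measurable_continuous_onI[OF cg1] by simp
    qed
    ultimately show ?thesis by (simp add: u_def)
  qed
  have fu: "AE z in lborel. z \<in> {a..b} \<longrightarrow> f z = u z"
    using f ends by eventually_elim (auto simp: uz)
  have pos: "0 \<le> u z" if "z \<in> {a..b}" for z
  proof (rule continuous_AE_nonneg[OF cu _ ab that])
    show "AE z in lborel. z \<in> {a<..<b} \<longrightarrow> 0 \<le> u z" using f0 fu by eventually_elim auto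
  qed
  have Lg: "\<bar>g1 z\<bar> \<le> L" if "z \<in> {a..b}" for z
  proof -
    have "0 \<le> L - \<bar>g1 z\<bar>"
    proof (rule continuous_AE_nonneg[OF _ _ ab that])
      show "continuous_on UNIV (\<lambda>z. L - \<bar>g1 z\<bar>)" by (intro continuous_intros cg1)
      show "AE z in lborel. z \<in> {a<..<b} \<longrightarrow> 0 \<le> L - \<bar>g1 z\<bar>" using L gg1 by eventually_elim auto
    qed
    then show ?thesis by simp
  qed
  have "(LBINT s. indicator {a..b} s * (g1 s)\<^sup>2) ^ 4 \<le>
    2 * L * (LBINT s. indicator {a..b} s * u s) ^ 3 * (LBINT s. indicator {a..b} s * (k s)\<^sup>2) ^ 2"
  proof (rule interpolation_1d[OF ab u cg1 _ _ _ pos Lg ik ik2])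
    show "g1 z = d + (LBINT s. indicator {a..z} s * k s)" if "z \<in> {a..b}" for z
    proof -
      have "(\<lambda>s. indicator {a..z} s * k1 s) = (\<lambda>s. indicator {a..z} s * k s)"
        by (rule ext, rule kk1) (use that in auto)
      then show ?thesis by (simp add: g1_def)
    qed
    then have "g1 b = d" "g1 a = d" using ab k0 integral_indicator_singleton[of a k] by auto
    then show "g1 b = g1 a" by simp
    show "u b = u a" using uz[of a] uz[of b] ab g0 integral_indicator_singleton[of a g] by simp
  qed
  moreover have "(LBINT s. indicator {a..b} s * u s) = (LBINT s. indicator {a..b} s * f s)"
  proof (rule integral_cong_AE)
    show "AE s in lborel. indicator {a..b} s * u s = indicator {a..b} s * f s"
      using fu by eventually_elim (auto simp: indicator_def)
    show "(\<lambda>s. indicator {a..b} s * u s) \<in> borel_measurable lborel"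
      using borel_measurable_continuous_onI[OF cu] by simp
    show "(\<lambda>s. indicator {a..b} s * f s) \<in> borel_measurable lborel" using fm by simp
  qed
  moreover have eq: "AE s in lborel. indicator {a..b} s * (g1 s)\<^sup>2 = indicator {a..b} s * (g s)\<^sup>2"
    using gg1 by eventually_elim (auto simp: indicator_def)
  have m1: "(\<lambda>s. indicator {a..b} s * (g1 s)\<^sup>2) \<in> borel_measurable lborel"
    using borel_measurable_continuous_onI[OF cg1] by simp
  have m2: "(\<lambda>s. indicator {a..b} s * (g s)\<^sup>2) \<in> borel_measurable lborel" using gm by simp
  have "(LBINT s. indicator {a..b} s * (g1 s)\<^sup>2) = (LBINT s. indicator {a..b} s * (g s)\<^sup>2)"
    by (rule integral_cong_AE[OF m1 m2 eq])
  ultimately show "(LBINT s. indicator {a..b} s * (g s)\<^sup>2) ^ 4 \<le>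
    2 * L * (LBINT s. indicator {a..b} s * f s) ^ 3 * (LBINT s. indicator {a..b} s * (k s)\<^sup>2) ^ 2" by simp
  show "integrable lborel (\<lambda>s. indicator {a..b} s * (g s)\<^sup>2)"
    using integrable_cong_AE[OF m1 m2 eq] integrable_Icc_continuous[OF continuous_on_power[OF cg1, of 2]] by simp
qed

text \<open>Here \<open>F\<close>, \<open>G\<close>, \<open>K\<close> are the radial displacement and its first two \<open>z\<close>-derivatives, and \<open>Y\<close> is the
\<open>z\<close>-derivative of \<open>\<phi>\<^sub>z + lam z\<close>, so that \<open>Y - lam + G\<^sup>2 / 2\<close> is the axial strain. A single line is selected on
which all three parts of the excess are at most \<open>\<delta>\<close>; on it \<open>Y\<close> has mean zero, and the bound
\<open>4 \<delta> \<le> lam\<^sup>2\<close> turns the smallness of the axial strain into \<open>P \<ge> lam\<close>.\<close>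

lemma slope_bound_from_excess:
  fixes F G K Z Y :: "real \<times> real \<Rightarrow> real"
  assumes m: "0 < m" and h: "0 < h" and lam: "0 < lam" and \<delta>: "0 < \<delta>" "4 * \<delta> \<le> lam\<^sup>2" and L0: "0 \<le> L"
    and FG: "z_weak F G" and GK: "z_weak G K" and perF: "z_per 1 F"
    and ZY: "z_weak Z Y" and perZ: "z_per 1 Z"
    and Fm: "AE p in lborel. p \<in> Omega \<longrightarrow> m \<le> F p" and GL: "AE p in lborel. p \<in> Omega \<longrightarrow> \<bar>G p\<bar> \<le> L"
    and iK: "integrable lborel (\<lambda>p. indicator Omega p * (K p)\<^sup>2)"
    and iE: "integrable lborel (\<lambda>p. indicator Omega p * (Y p - lam + (G p)\<^sup>2 / 2)\<^sup>2)"
    and le: "(LBINT p. indicator Omega p * (2 * m * (F p - m) + (Y p - lam + (G p)\<^sup>2 / 2)\<^sup>2 + h\<^sup>2 * (K p)\<^sup>2)) \<le> \<delta>"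
  shows "lam ^ 4 \<le> 2 * L * (\<delta> / (2 * m)) ^ 3 * (\<delta> / h\<^sup>2)\<^sup>2"
proof -
  define S :: "real set" where "S = {- 1/2..1/2}"
  define e where "e p = Y p - lam + (G p)\<^sup>2 / 2" for p
  have meas [measurable]: "F \<in> borel_measurable borel" "G \<in> borel_measurable borel" "K \<in> borel_measurable borel" "Y \<in> borel_measurable borel"
    using FG GK ZY by (auto simp: z_weak_def loc_int_def)
  have em [measurable]: "e \<in> borel_measurable borel" unfolding e_def[abs_def] by measurable
  have iF: "integrable lborel (\<lambda>p. indicator Omega p * (F p - m))"
  proof -
    have "integrable lborel (\<lambda>p. indicator Omega p * F p)"
      using FG by (intro loc_int_Omega) (simp add: z_weak_def)
    moreover have "integrable lborel (\<lambda>p. m * indicator Omega p)"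
      using emeasure_strip[of "1/2"] Omega_borel
      by (intro integrable_mult_right integrable_real_indicator) (auto simp: Omega_strip)
    ultimately have "integrable lborel (\<lambda>p. indicator Omega p * F p - m * indicator Omega p)" by simp
    then show ?thesis by (simp add: algebra_simps)
  qed
  note iE = iE[folded e_def]
  define r where "r p = indicator Omega p * (2 * m * (F p - m) + (e p)\<^sup>2 + h\<^sup>2 * (K p)\<^sup>2)" for p
  have r: "r p = 2 * m * (indicator Omega p * (F p - m)) + indicator Omega p * (e p)\<^sup>2 + h\<^sup>2 * (indicator Omega p * (K p)\<^sup>2)" for p
    by (simp add: r_def algebra_simps)
  have ir: "integrable lborel r" unfolding r using iF iE iK by simp
  define A where "A x = (LBINT z. r (x, z))" for x
  have iA: "integrable lborel A" unfolding A_def[abs_def] by (rule lborel_Fubini(1)[OF ir])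
  have leA: "(LBINT x. A x) \<le> \<delta>"
    unfolding A_def lborel_Fubini(2)[OF ir] using le by (simp add: r_def[abs_def] e_def)
  have zA: "A x = 0" if "x \<notin> {0..2 * pi}" for x
  proof -
    have "(x, z) \<notin> Omega" for z using that by (auto simp: Omega_def)
    then have "r (x, z) = 0" for z by (simp add: r_def)
    then show ?thesis by (simp add: A_def)
  qed
  have aep: "AE x in lborel. AE z in lborel. (x, z) \<in> Omega \<longrightarrow> P (x, z)" if "AE p in lborel. p \<in> Omega \<longrightarrow> P p" for P
  proof -
    have "AE p in lborel \<Otimes>\<^sub>M lborel. p \<in> Omega \<longrightarrow> P p" unfolding lborel_prod by (rule that)
    then show ?thesis by (rule lborel_pair.AE_pair)
  qed
  have half: "- 1/2 + 1 = (1/2 :: real)" by simp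
  have hl: "- 1/2 < (1/2 :: real)" by simp
  note l1 = line_representation[OF FG hl, of 0 "2 * pi"]
    and l2 = line_representation[OF GK hl, of 0 "2 * pi"]
    and l3 = z_mean_zero_line[OF FG perF zero_less_one, of 0 "2 * pi" "- 1/2", unfolded half]
    and l4 = z_mean_zero_line[OF GK z_per_weak_derivative[OF FG perF] zero_less_one, of 0 "2 * pi" "- 1/2", unfolded half]
    and l5 = z_mean_zero_line[OF ZY perZ zero_less_one, of 0 "2 * pi" "- 1/2", unfolded half]
    and l6 = line_representation[OF ZY hl, of 0 "2 * pi"]
  define Q where "Q x \<longleftrightarrow> x \<in> {0<..<2 * pi} \<and>
    (\<exists>c. AE z in lborel. z \<in> {- 1/2<..<1/2} \<longrightarrow> F (x, z) = c + (LBINT s. indicator {- 1/2..z} s * G (x, s))) \<and>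
    integrable lborel (\<lambda>s. indicator S s * K (x, s)) \<and>
    (\<exists>d. AE z in lborel. z \<in> {- 1/2<..<1/2} \<longrightarrow> G (x, z) = d + (LBINT s. indicator {- 1/2..z} s * K (x, s))) \<and>
    (LBINT z. indicator S z * G (x, z)) = 0 \<and> (LBINT z. indicator S z * K (x, z)) = 0 \<and>
    (LBINT z. indicator S z * Y (x, z)) = 0 \<and> integrable lborel (\<lambda>s. indicator S s * Y (x, s)) \<and>
    (AE z in lborel. (x, z) \<in> Omega \<longrightarrow> m \<le> F (x, z)) \<and> (AE z in lborel. (x, z) \<in> Omega \<longrightarrow> \<bar>G (x, z)\<bar> \<le> L) \<and>
    integrable lborel (\<lambda>z. indicator Omega (x, z) * (F (x, z) - m)) \<and>
    integrable lborel (\<lambda>z. indicator Omega (x, z) * (e (x, z))\<^sup>2) \<and>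
    integrable lborel (\<lambda>z. indicator Omega (x, z) * (K (x, z))\<^sup>2)" for x
  have "AE x in lborel. x \<in> {0<..<2 * pi} \<longrightarrow> Q x"
    using l1 l2 l3 l4 l5 l6 aep[OF Fm] aep[OF GL] lborel_Fubini(3)[OF iF] lborel_Fubini(3)[OF iE] lborel_Fubini(3)[OF iK]
    by eventually_elim (simp add: Q_def S_def)
  then obtain x where x: "Q x" "A x \<le> \<delta>" using exists_small_value[OF iA zA leA \<delta>(1)] by blast
  have x0: "x \<in> {0<..<2 * pi}" using x(1) by (simp add: Q_def)
  then have ind: "indicator Omega (x, z) = (indicator S z :: real)" for z
    unfolding S_def by (intro indicator_Omega_line) auto
  have inO: "(x, z) \<in> Omega" if "z \<in> {- 1/2<..<1/2}" for z
    using that x0 by (auto simp: Omega_def)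
  define P where "P = (LBINT s. indicator S s * (G (x, s))\<^sup>2)"
  define a where "a = (LBINT s. indicator S s * (F (x, s) - m))"
  define b where "b = (LBINT s. indicator S s * (K (x, s))\<^sup>2)"
  define w where "w = (LBINT s. indicator S s * (e (x, s))\<^sup>2)"
  obtain c where c: "AE z in lborel. z \<in> {- 1/2<..<1/2} \<longrightarrow> F (x, z) = c + (LBINT s. indicator {- 1/2..z} s * G (x, s))"
    using x(1) unfolding Q_def by blast
  obtain d where d: "AE z in lborel. z \<in> {- 1/2<..<1/2} \<longrightarrow> G (x, z) = d + (LBINT s. indicator {- 1/2..z} s * K (x, s))"
    using x(1) unfolding Q_def by blast
  note lm = borel_measurable_Pair_right[OF meas(1), of x] borel_measurable_Pair_right[OF meas(2), of x]
    borel_measurable_Pair_right[OF em, of x]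
  have F0: "AE z in lborel. z \<in> {- 1/2<..<1/2} \<longrightarrow> 0 \<le> F (x, z) - m"
  proof -
    have "AE z in lborel. (x, z) \<in> Omega \<longrightarrow> m \<le> F (x, z)" using x(1) by (simp add: Q_def)
    then show ?thesis by eventually_elim (use inO in auto)
  qed
  have GLx: "AE z in lborel. z \<in> {- 1/2<..<1/2} \<longrightarrow> \<bar>G (x, z)\<bar> \<le> L"
  proof -
    have "AE z in lborel. (x, z) \<in> Omega \<longrightarrow> \<bar>G (x, z)\<bar> \<le> L" using x(1) by (simp add: Q_def)
    then show ?thesis by eventually_elim (use inO in auto)
  qed
  have c': "AE z in lborel. z \<in> {- 1/2<..<1/2} \<longrightarrow> F (x, z) - m = (c - m) + (LBINT s. indicator {- 1/2..z} s * G (x, s))"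
    using c by eventually_elim auto
  have line: "P ^ 4 \<le> 2 * L * a ^ 3 * b\<^sup>2" and iG2: "integrable lborel (\<lambda>s. indicator S s * (G (x, s))\<^sup>2)"
    unfolding P_def a_def b_def S_def
    using good_line_estimate[where f="\<lambda>z. F (x, z) - m" and g="\<lambda>z. G (x, z)" and k="\<lambda>z. K (x, z)"
      and c="c - m" and d=d and L=L, OF c' _ d _ _ _ F0 GLx] x(1) lm
    unfolding Q_def S_def by (auto simp: ind[unfolded S_def])
  have i3: "integrable lborel (\<lambda>z. indicator S z * (F (x, z) - m))"
      "integrable lborel (\<lambda>z. indicator S z * (e (x, z))\<^sup>2)" "integrable lborel (\<lambda>z. indicator S z * (K (x, z))\<^sup>2)"
    using x(1) unfolding Q_def ind by auto
  have Ax: "A x = 2 * m * a + w + h\<^sup>2 * b"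
    unfolding A_def r ind a_def b_def w_def using i3 by simp
  have a0: "0 \<le> a" unfolding a_def
  proof (rule integral_nonneg_AE)
    show "AE z in lborel. 0 \<le> indicator S z * (F (x, z) - m)"
      using F0 AE_lborel_singleton[of "- 1/2"] AE_lborel_singleton[of "1/2"]
      by eventually_elim (auto simp: S_def indicator_def)
  qed
  have b0: "0 \<le> b" and w0: "0 \<le> w" unfolding b_def w_def by simp_all
  have "2 * m * a \<le> \<delta>" "w \<le> \<delta>" "h\<^sup>2 * b \<le> \<delta>"
  proof -
    have "0 \<le> 2 * m * a" "0 \<le> h\<^sup>2 * b" using m a0 b0 by simp_all
    moreover have "2 * m * a + w + h\<^sup>2 * b \<le> \<delta>" using x(2) Ax by simp
    ultimately show "2 * m * a \<le> \<delta>" "w \<le> \<delta>" "h\<^sup>2 * b \<le> \<delta>" using w0 by linarith+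
  qed
  then have bnd: "a \<le> \<delta> / (2 * m)" "w \<le> \<delta>" "b \<le> \<delta> / h\<^sup>2"
    using m h by (simp_all add: le_divide_eq mult.commute)
  have iY: "integrable lborel (\<lambda>s. indicator S s * Y (x, s))" and Y0: "(LBINT z. indicator S z * Y (x, z)) = 0"
    using x(1) by (auto simp: Q_def)
  have iS: "integrable lborel (indicator S :: real \<Rightarrow> real)" and S1: "(LBINT z. indicator S z) = (1 :: real)"
    unfolding S_def by (auto intro!: integrable_real_indicator simp: emeasure_lborel_Icc_eq)
  have "(LBINT z. indicator S z * e (x, z)) =
     (LBINT z. indicator S z * Y (x, z) - lam * indicator S z + (indicator S z * (G (x, z))\<^sup>2) / 2)"
    by (simp add: e_def algebra_simps)
  also have "\<dots> = - lam + P / 2" using iY iS iG2 Y0 S1 by (simp add: P_def)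
  finally have mean: "(LBINT z. indicator S z * e (x, z)) = - lam + P / 2" .
  have ind2: "(indicator S z * y)\<^sup>2 = indicator S z * y\<^sup>2" "(indicator S z)\<^sup>2 = (indicator S z :: real)"
    "indicator S z * (indicator S z * y) = indicator S z * y" for z y :: real
    by (simp_all add: indicator_def)
  have "(LBINT z. indicator S z * (indicator S z * e (x, z)))\<^sup>2 \<le>
      (LBINT z. (indicator S z)\<^sup>2) * (LBINT z. (indicator S z * e (x, z))\<^sup>2)"
  proof (rule Cauchy_Schwarz_integral(2))
    show "(indicator S :: real \<Rightarrow> real) \<in> borel_measurable lborel" using iS by (rule borel_measurable_integrable)
    show "(\<lambda>z. indicator S z * e (x, z)) \<in> borel_measurable lborel" using lm(3) by (simp add: S_def)
  qed (use i3 iS in \<open>simp_all add: ind2\<close>)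
  then have "(- lam + P / 2)\<^sup>2 \<le> w" unfolding ind2 mean S1 by (simp add: w_def)
  also have "\<dots> \<le> (lam / 2)\<^sup>2" using bnd(2) \<delta>(2) by (simp add: power2_eq_square)
  finally have "\<bar>- lam + P / 2\<bar> \<le> lam / 2" using lam by (simp add: power2_le_iff_abs_le abs_le_square_iff)
  then have "lam \<le> P" by linarith
  then have "lam ^ 4 \<le> P ^ 4" using lam by (intro power_mono) auto
  also note line
  also have "2 * L * a ^ 3 * b\<^sup>2 \<le> 2 * L * (\<delta> / (2 * m)) ^ 3 * (\<delta> / h\<^sup>2)\<^sup>2"
    using bnd a0 b0 L0 by (intro mult_mono power_mono mult_nonneg_nonneg zero_le_power) auto
  finally show ?thesis .
qed

lemma AE_lborel_swap:
  assumes "AE p in (lborel :: (real \<times> real) measure). P p"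
  shows "AE p in (lborel :: (real \<times> real) measure). P (snd p, fst p)"
proof (rule AE_measure_preserving[OF _ _ assms])
  have "(\<lambda>p :: real \<times> real. (snd p, fst p)) \<in> borel \<rightarrow>\<^sub>M borel"
    by (intro borel_measurable_continuous_onI continuous_on_Pair continuous_on_fst continuous_on_snd continuous_on_id)
  then show "(\<lambda>p :: real \<times> real. (snd p, fst p)) \<in> lborel \<rightarrow>\<^sub>M lborel" by simp
  show "distr lborel lborel (\<lambda>p :: real \<times> real. (snd p, fst p)) = lborel"
    using lborel_pair.distr_pair_swap[where ?'a = real and ?'b = real] unfolding lborel_prod
    by (simp add: case_prod_beta')
qed

lemma H_loc_L2: "H_loc k F \<Longrightarrow> L2_loc F"
  by (cases k) auto

lemma H_loc_derivative:
  assumes "H_loc (Suc k) F" "v \<in> Basis"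
  obtains G where "has_weak_derivative UNIV v F G" "H_loc k G"
  using assms by auto

lemma L2_loc_borel:
  assumes "L2_loc F"
  obtains Fb where "Fb \<in> borel_measurable borel" "AE p in lborel. F p = Fb p"
proof -
  have "F \<in> borel_measurable lebesgue" using assms by (simp add: L2_loc_def)
  from completion_ex_borel_measurable_real[OF this] that show ?thesis by auto
qed

lemma AE_lebesgue_on_Omega: "(AE x in lebesgue_on Omega. P x) \<longleftrightarrow> (AE x in lebesgue. x \<in> Omega \<longrightarrow> P x)"
proof -
  have "Omega \<in> sets lebesgue" using Omega_borel by simp
  then show ?thesis by (subst AE_restrict_space_iff) auto
qed

lemma H_perE:
  assumes "H_per k f"
  obtains F where "Omega_periodic F" "H_loc k F" "AE x in lebesgue. x \<in> Omega \<longrightarrow> f x = F x"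
  using assms unfolding H_per_def AE_lebesgue_on_Omega by blast

lemma z_per_Omega_periodic:
  assumes per: "Omega_periodic F" and Fb: "AE p in lborel. F p = Fb p" and l: "loc_int Fb"
  shows "z_per 1 Fb" and "z_per (2 * pi) (\<lambda>p. Fb (snd p, fst p))"
proof -
  have "F ((0, 1) + p) = F p" for p
    using per by (cases p) (simp add: Omega_periodic_def add.commute[of 1])
  then show "z_per 1 Fb" by (intro z_per_of_AE_periodic[OF l] AE_periodic[OF _ Fb])
  have "F (snd ((0, 2 * pi) + p), fst ((0, 2 * pi) + p)) = F (snd p, fst p)" for p
    using per by (cases p) (simp add: Omega_periodic_def add.commute[of "2 * pi"])
  from AE_periodic[of "\<lambda>p. F (snd p, fst p)", OF this AE_lborel_swap[OF Fb]]
  show "z_per (2 * pi) (\<lambda>p. Fb (snd p, fst p))"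
    by (rule z_per_of_AE_periodic[OF loc_int_swap[OF l]])
qed

text \<open>After an exchange of the coordinates this is the vanishing of the mean over lines, integrated over all
lines.\<close>

lemma theta_derivative_mean_zero:
  assumes w: "z_weak (\<lambda>p. T (snd p, fst p)) (\<lambda>p. T' (snd p, fst p))" and per: "z_per (2 * pi) (\<lambda>p. T (snd p, fst p))"
    and l: "loc_int T'"
  shows "(LBINT p. indicator Omega p * T' p) = 0"
proof -
  have i: "integrable lborel (\<lambda>p. indicator Omega p * T' p)" by (rule loc_int_Omega[OF l])
  have m: "(\<lambda>p. indicator Omega p * T' p) \<in> borel_measurable borel" using i by auto
  have i': "integrable lborel (\<lambda>p. indicator Omega (snd p, fst p) * T' (snd p, fst p))"
    using lborel_integral_swap(2)[OF m] i by simp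
  have "(LBINT p. indicator Omega p * T' p) = (LBINT p. indicator Omega (snd p, fst p) * T' (snd p, fst p))"
    using lborel_integral_swap(1)[OF m] by simp
  also have "\<dots> = (LBINT x. (LBINT z. indicator Omega (z, x) * T' (z, x)))"
    using lborel_Fubini(2)[OF i'] by simp
  also have "\<dots> = (\<integral>x. 0 \<partial>(lborel :: real measure))"
  proof (rule integral_cong_AE)
    show "(\<lambda>x. \<integral>z. indicator Omega (z, x) * T' (z, x) \<partial>lborel) \<in> borel_measurable lborel"
      using borel_measurable_integrable[OF lborel_Fubini(1)[OF i']] by simp
    have "AE x in lborel. x \<in> {-1<..<1} \<longrightarrow> (LBINT z. indicator {0..0 + 2 * pi} z * T' (z, x)) = 0"
      using z_mean_zero_line[OF w per, of "-1" 1 0] by simp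
    then show "AE x in lborel. (LBINT z. indicator Omega (z, x) * T' (z, x)) = 0"
    proof eventually_elim
      case (elim x)
      show ?case
      proof (cases "x \<in> {- 1/2..1/2}")
        case True
        then have "indicator Omega (z, x) = (indicator {0..0 + 2 * pi} z :: real)" for z
          by (auto simp: Omega_def indicator_def)
        then show ?thesis using elim True by simp
      next
        case False
        then have "(z, x) \<notin> Omega" for z by (auto simp: Omega_def)
        then show ?thesis by simp
      qed
    qed
  qed simp
  finally show ?thesis by simp
qed

lemma integral_le_nn_integral:
  fixes f :: "'a \<Rightarrow> real"
  assumes f: "integrable M f" and le: "(\<integral>\<^sup>+ x. ennreal (f x) \<partial>M) \<le> ennreal c" and c: "0 \<le> c"
  shows "(\<integral>x. f x \<partial>M) \<le> c"
proof -
  have i: "integrable M (\<lambda>x. max 0 (f x))" using f by simp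
  have "ennreal (\<integral>x. max 0 (f x) \<partial>M) = (\<integral>\<^sup>+ x. ennreal (max 0 (f x)) \<partial>M)"
    by (rule nn_integral_eq_integral[symmetric, OF i]) simp
  also have "\<dots> = (\<integral>\<^sup>+ x. ennreal (f x) \<partial>M)"
    by (rule nn_integral_cong) (simp add: max_def ennreal_neg)
  finally have "ennreal (\<integral>x. max 0 (f x) \<partial>M) \<le> ennreal c" using le by simp
  then have "(\<integral>x. max 0 (f x) \<partial>M) \<le> c" using c by simp
  moreover have "(\<integral>x. f x \<partial>M) \<le> (\<integral>x. max 0 (f x) \<partial>M)" by (rule integral_mono[OF f i]) simp
  ultimately show ?thesis by simp
qed

text \<open>The square of the hoop strain \<open>t\<close> is bounded below by its tangent \<open>2 m t - m\<^sup>2\<close>, which is integrable and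
linear in the \<open>\<theta>\<close>-derivative of \<open>\<phi>\<^sub>\<theta>\<close>. Integration over \<open>Omega\<close> removes this derivative and leaves the excess.\<close>

lemma slope_bound:
  assumes adm: "\<phi> \<in> A_vKD lam vrho" and vrho: "1 < vrho" and h: "0 < h" and lam: "0 < lam"
    and \<delta>: "0 < \<delta>" "4 * \<delta> \<le> lam\<^sup>2" and L0: "0 \<le> L"
    and E: "E_vKD h \<phi> \<le> ennreal (2 * pi * (vrho - 1)\<^sup>2 + \<delta>)"
    and slope: "AE x in lebesgue. x \<in> Omega \<longrightarrow> norm (grad (comp_rho \<phi>) x) \<le> L"
  shows "lam ^ 4 \<le> 2 * L * (\<delta> / (2 * (vrho - 1))) ^ 3 * (\<delta> / h\<^sup>2)\<^sup>2"
proof -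
  define m where "m = vrho - 1"
  have m: "0 < m" using vrho by (simp add: m_def)
  have Bt: "(1, 0) \<in> (Basis :: (real \<times> real) set)" and Bz: "(0, 1) \<in> (Basis :: (real \<times> real) set)"
    by (auto simp: Basis_real2)
  have adm': "H_per 2 (comp_rho \<phi>)" "H_per 1 (comp_theta \<phi>)" "H_per 1 (\<lambda>x. comp_z \<phi> x + lam * snd x)"
    "AE x in lebesgue. x \<in> Omega \<longrightarrow> comp_rho \<phi> x \<ge> vrho - 1"
    using adm by (simp_all add: A_vKD_def AE_lebesgue_on_Omega)
  obtain F where F: "Omega_periodic F" "H_loc (Suc (Suc 0)) F" "AE x in lebesgue. x \<in> Omega \<longrightarrow> comp_rho \<phi> x = F x"
    using adm'(1) unfolding numeral_2_eq_2 by (rule H_perE)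
  obtain T where T: "Omega_periodic T" "H_loc (Suc 0) T" "AE x in lebesgue. x \<in> Omega \<longrightarrow> comp_theta \<phi> x = T x"
    using adm'(2) unfolding One_nat_def by (rule H_perE)
  obtain Z where Z: "Omega_periodic Z" "H_loc (Suc 0) Z" "AE x in lebesgue. x \<in> Omega \<longrightarrow> comp_z \<phi> x + lam * snd x = Z x"
    using adm'(3) unfolding One_nat_def by (rule H_perE)
  obtain F1 where F1: "has_weak_derivative UNIV (1, 0) F F1" "H_loc (Suc 0) F1" by (rule H_loc_derivative[OF F(2) Bt])
  obtain G where G: "has_weak_derivative UNIV (0, 1) F G" "H_loc (Suc 0) G" by (rule H_loc_derivative[OF F(2) Bz])
  obtain K where K: "has_weak_derivative UNIV (0, 1) G K" "H_loc 0 K" by (rule H_loc_derivative[OF G(2) Bz])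
  obtain T1 where T1: "has_weak_derivative UNIV (1, 0) T T1" "H_loc 0 T1" by (rule H_loc_derivative[OF T(2) Bt])
  obtain Y where Y: "has_weak_derivative UNIV (0, 1) Z Y" "H_loc 0 Y" by (rule H_loc_derivative[OF Z(2) Bz])
  obtain Fb where Fb: "Fb \<in> borel_measurable borel" "AE p in lborel. F p = Fb p" by (rule L2_loc_borel[OF H_loc_L2[OF F(2)]])
  obtain F1b where F1b: "F1b \<in> borel_measurable borel" "AE p in lborel. F1 p = F1b p" by (rule L2_loc_borel[OF H_loc_L2[OF F1(2)]])
  obtain Gb where Gb: "Gb \<in> borel_measurable borel" "AE p in lborel. G p = Gb p" by (rule L2_loc_borel[OF H_loc_L2[OF G(2)]])
  obtain Kb where Kb: "Kb \<in> borel_measurable borel" "AE p in lborel. K p = Kb p" by (rule L2_loc_borel[OF H_loc_L2[OF K(2)]])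
  obtain Tb where Tb: "Tb \<in> borel_measurable borel" "AE p in lborel. T p = Tb p" by (rule L2_loc_borel[OF H_loc_L2[OF T(2)]])
  obtain T1b where T1b: "T1b \<in> borel_measurable borel" "AE p in lborel. T1 p = T1b p" by (rule L2_loc_borel[OF H_loc_L2[OF T1(2)]])
  obtain Zb where Zb: "Zb \<in> borel_measurable borel" "AE p in lborel. Z p = Zb p" by (rule L2_loc_borel[OF H_loc_L2[OF Z(2)]])
  obtain Yb where Yb: "Yb \<in> borel_measurable borel" "AE p in lborel. Y p = Yb p" by (rule L2_loc_borel[OF H_loc_L2[OF Y(2)]])
  note zFG = z_weak_of_weak_derivative[OF G(1) Fb Gb]
  note zGK = z_weak_of_weak_derivative[OF K(1) Gb Kb]
  note zZY = z_weak_of_weak_derivative[OF Y(1) Zb Yb]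
  note zT = z_weak_of_weak_derivative_swap[OF T1(1) Tb T1b]
  have lT: "loc_int Tb" "loc_int T1b"
    using T1(1) Tb T1b loc_int_of_locally_integrable unfolding has_weak_derivative_def by blast+
  have lF: "loc_int Fb" and lZ: "loc_int Zb" using zFG zZY by (auto simp: z_weak_def)
  note perF = z_per_Omega_periodic(1)[OF F(1) Fb(2) lF]
  note perZ = z_per_Omega_periodic(1)[OF Z(1) Zb(2) lZ]
  note T0 = theta_derivative_mean_zero[OF zT z_per_Omega_periodic(2)[OF T(1) Tb(2) lT(1)] lT(2)]
  have wZ: "has_weak_derivative UNIV (0, 1) (\<lambda>p. Z p - lam * snd p) (\<lambda>p. Y p - lam)"
  proof (rule has_weak_derivative_diff[OF Y(1) _ Bz])
    have "((\<lambda>z. lam * z) has_real_derivative lam) (at z)" for z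
      using DERIV_cmult[OF DERIV_ident, of lam z] by simp
    then show "has_weak_derivative UNIV (0, 1) (\<lambda>p. lam * snd p) (\<lambda>p. lam)"
      by (rule weak_derivative_snd(2)) (rule continuous_on_const)
  qed
  have Z': "AE x in lebesgue. x \<in> Omega \<longrightarrow> comp_z \<phi> x = Z x - lam * snd x"
    using Z(3) by eventually_elim auto
  note W1 = wderiv_eq[OF F1(1) Bt F(3)] and W2 = wderiv_eq[OF G(1) Bz F(3)]
  note W3 = wderiv_eq[OF K(1) Bz W2] and W4 = wderiv_eq[OF T1(1) Bt T(3)] and W5 = wderiv_eq[OF wZ Bz Z']
  define e where "e p = Yb p - lam + (Gb p)\<^sup>2 / 2" for p
  define D where "D p = (norm (strain \<phi> p))\<^sup>2 + h\<^sup>2 * (norm (hess (comp_rho \<phi>) p))\<^sup>2" for p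
  have D: "AE p in lebesgue. p \<in> Omega \<longrightarrow>
      (T1b p + (F1b p)\<^sup>2 / 2 + Fb p)\<^sup>2 + (e p)\<^sup>2 + h\<^sup>2 * (Kb p)\<^sup>2 \<le> D p"
    using W1 W2 W3 W4 W5 F(3) AE_completion[OF Fb(2)] AE_completion[OF F1b(2)] AE_completion[OF Gb(2)]
      AE_completion[OF Kb(2)] AE_completion[OF T1b(2)] AE_completion[OF Yb(2)]
  proof eventually_elim
    case (elim p)
    show ?case
    proof
      assume p: "p \<in> Omega"
      have st: "strain_tt \<phi> p = T1b p + (F1b p)\<^sup>2 / 2 + Fb p" "strain_zz \<phi> p = e p"
        unfolding strain_tt_def strain_zz_def e_def using elim p by simp_all
      have "d_z (d_z (comp_rho \<phi>)) p = Kb p" using elim p by simp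
      then show "(T1b p + (F1b p)\<^sup>2 / 2 + Fb p)\<^sup>2 + (e p)\<^sup>2 + h\<^sup>2 * (Kb p)\<^sup>2 \<le> D p"
        unfolding D_def strain_def hess_def norm_matrix_2 st by (simp add: distrib_left)
    qed
  qed
  have Eb: "(\<integral>\<^sup>+ p. ennreal (q p) \<partial>lborel) \<le> E_vKD h \<phi>"
    if q: "AE p in lebesgue. p \<in> Omega \<longrightarrow> q p \<le> D p" and q0: "\<And>p. p \<notin> Omega \<Longrightarrow> q p = 0" for q
  proof -
    have "(\<integral>\<^sup>+ p. ennreal (q p) \<partial>lborel) = (\<integral>\<^sup>+ p. ennreal (q p) \<partial>lebesgue)"
      by (rule nn_integral_completion[symmetric])
    also have "\<dots> \<le> (\<integral>\<^sup>+ p. ennreal (D p) * indicator Omega p \<partial>lebesgue)"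
    proof (rule nn_integral_mono_AE)
      show "AE p in lebesgue. ennreal (q p) \<le> ennreal (D p) * indicator Omega p"
        using q
      proof eventually_elim
        case (elim p)
        then show ?case using q0[of p] by (cases "p \<in> Omega") (auto simp: ennreal_leI)
      qed
    qed
    finally show ?thesis by (simp add: E_vKD_def D_def)
  qed
  have Efin: "E_vKD h \<phi> < \<infinity>" using E by (simp add: le_less_trans)
  note [measurable] = Gb(1) Yb(1)
  have [measurable]: "e \<in> borel_measurable borel" unfolding e_def[abs_def] by measurable
  have fin: "integrable lborel (\<lambda>p. indicator Omega p * f p)"
    if f: "f \<in> borel_measurable borel" "\<And>p. 0 \<le> f p" and le: "AE p in lebesgue. p \<in> Omega \<longrightarrow> f p \<le> D p" for f
  proof (rule integrableI_nonneg)
    have "(\<integral>\<^sup>+ p. ennreal (indicator Omega p * f p) \<partial>lborel) \<le> E_vKD h \<phi>"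
      by (rule Eb) (use le in \<open>auto elim!: eventually_mono\<close>)
    then show "(\<integral>\<^sup>+ p. ennreal (indicator Omega p * f p) \<partial>lborel) < \<infinity>" using Efin by (rule le_less_trans)
    show "(\<lambda>p. indicator Omega p * f p) \<in> borel_measurable lborel"
      using Omega_borel f(1) by (auto intro!: borel_measurable_times borel_measurable_indicator)
  qed (use f(2) in simp)
  have Dle: "AE p in lebesgue. p \<in> Omega \<longrightarrow> (e p)\<^sup>2 \<le> D p \<and> h\<^sup>2 * (Kb p)\<^sup>2 \<le> D p"
    using D
  proof eventually_elim
    case (elim p)
    have "0 \<le> (T1b p + (F1b p)\<^sup>2 / 2 + Fb p)\<^sup>2" "0 \<le> (e p)\<^sup>2" "0 \<le> h\<^sup>2 * (Kb p)\<^sup>2" by simp_all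
    then show ?case using elim by linarith
  qed
  have ie: "integrable lborel (\<lambda>p. indicator Omega p * (e p)\<^sup>2)"
    by (rule fin) (use Dle in \<open>auto elim!: eventually_mono\<close>)
  have "integrable lborel (\<lambda>p. indicator Omega p * (h\<^sup>2 * (Kb p)\<^sup>2))"
    by (rule fin) (use Dle Kb(1) in \<open>auto elim!: eventually_mono\<close>)
  then have "integrable lborel (\<lambda>p. inverse (h\<^sup>2) * (indicator Omega p * (h\<^sup>2 * (Kb p)\<^sup>2)))" by (rule integrable_mult_right)
  then have iK: "integrable lborel (\<lambda>p. indicator Omega p * (Kb p)\<^sup>2)" using h by (simp add: field_simps)
  define r where "r p = indicator Omega p * (2 * m * (Fb p - m) + (e p)\<^sup>2 + h\<^sup>2 * (Kb p)\<^sup>2)" for p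
  have iO: "integrable lborel (indicator Omega :: real \<times> real \<Rightarrow> real)" and mO: "(LBINT p. indicator Omega p) = 2 * pi"
    using emeasure_strip[of "1/2"] Omega_borel by (auto intro!: integrable_real_indicator simp: Omega_strip[symmetric] measure_def)
  have ir: "integrable lborel r"
  proof -
    have "r = (\<lambda>p. 2 * m * (indicator Omega p * Fb p) - (2 * m * m) * indicator Omega p
        + indicator Omega p * (e p)\<^sup>2 + h\<^sup>2 * (indicator Omega p * (Kb p)\<^sup>2))"
      by (rule ext) (simp add: r_def algebra_simps)
    then show ?thesis using loc_int_Omega[OF lF] iO ie iK by simp
  qed
  define q where "q p = 2 * m * (indicator Omega p * T1b p) + m\<^sup>2 * indicator Omega p + r p" for p
  note iT = loc_int_Omega[OF lT(2)]
  have iq: "integrable lborel q" unfolding q_def[abs_def] using iT iO ir by simp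
  have "(\<integral>\<^sup>+ p. ennreal (q p) \<partial>lborel) \<le> E_vKD h \<phi>"
  proof (rule Eb)
    show "AE p in lebesgue. p \<in> Omega \<longrightarrow> q p \<le> D p"
      using D
    proof eventually_elim
      case (elim p)
      show ?case
      proof
        assume p: "p \<in> Omega"
        define t where "t = T1b p + (F1b p)\<^sup>2 / 2 + Fb p"
        have "0 \<le> (t - m)\<^sup>2" by simp
        then have "2 * m * t - m\<^sup>2 \<le> t\<^sup>2" by (simp add: power2_diff algebra_simps)
        moreover have "2 * m * t = 2 * m * T1b p + m * (F1b p)\<^sup>2 + 2 * m * Fb p" by (simp add: t_def algebra_simps)
        moreover have "0 \<le> m * (F1b p)\<^sup>2" using m by simp
        moreover have "q p = 2 * m * T1b p + 2 * m * Fb p - m\<^sup>2 + (e p)\<^sup>2 + h\<^sup>2 * (Kb p)\<^sup>2"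
          using p by (simp add: q_def r_def algebra_simps power2_eq_square)
        moreover have "t\<^sup>2 + (e p)\<^sup>2 + h\<^sup>2 * (Kb p)\<^sup>2 \<le> D p" using elim p by (simp add: t_def)
        ultimately show "q p \<le> D p" by linarith
      qed
    qed
  qed (simp add: q_def r_def)
  also note E
  finally have "(LBINT p. q p) \<le> 2 * pi * m\<^sup>2 + \<delta>"
    using \<delta>(1) by (intro integral_le_nn_integral[OF iq]) (auto simp: m_def)
  moreover have "(LBINT p. q p) = m\<^sup>2 * (2 * pi) + (LBINT p. r p)"
    unfolding q_def using iT iO ir T0 mO by simp
  ultimately have le: "(LBINT p. r p) \<le> \<delta>" by (simp add: mult.commute)
  have Fm: "AE p in lborel. p \<in> Omega \<longrightarrow> m \<le> Fb p"
  proof -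
    have "AE p in lebesgue. p \<in> Omega \<longrightarrow> m \<le> Fb p"
      using adm'(4) F(3) AE_completion[OF Fb(2)] by eventually_elim (auto simp: m_def)
    then show ?thesis by (simp only: AE_completion_iff)
  qed
  have GL: "AE p in lborel. p \<in> Omega \<longrightarrow> \<bar>Gb p\<bar> \<le> L"
  proof -
    have "AE p in lebesgue. p \<in> Omega \<longrightarrow> \<bar>Gb p\<bar> \<le> L"
      using slope W2 AE_completion[OF Gb(2)]
    proof eventually_elim
      case (elim p)
      have "\<bar>d_z (comp_rho \<phi>) p\<bar> \<le> norm (grad (comp_rho \<phi>) p)"
        unfolding grad_def using norm_snd_le[of "d_z (comp_rho \<phi>) p" "d_theta (comp_rho \<phi>) p"] by simp
      then show ?case using elim by auto
    qed
    then show ?thesis by (simp only: AE_completion_iff)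
  qed
  show ?thesis
    using slope_bound_from_excess[OF m h lam \<delta> L0 zFG zGK perF zZY perZ Fm GL iK ie[unfolded e_def] le[unfolded r_def e_def]]
    by (simp add: m_def)
qed

section \<open>Fold width and slope of minimizers\<close>

text \<open>The width \<open>s\<close> for which the hoop energy \<open>m lam\<^sup>1\<^sup>/\<^sup>2 s\<^sup>3\<^sup>/\<^sup>2\<close> of a single fold balances its bending energy
\<open>h\<^sup>2 lam / s\<^sup>2\<close>, that is, \<open>m\<^sup>2 s\<^sup>7 = h\<^sup>4 lam\<close>.\<close>

definition fold_width :: "real \<Rightarrow> real \<Rightarrow> real \<Rightarrow> real" where
  "fold_width h lam m = h powr (4/7) * lam powr (1/7) * m powr (- 2/7)"

lemma powr_power: "0 < x \<Longrightarrow> (x powr a) ^ n = x powr (real n * a)" for x a :: real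
  by (simp add: powr_realpow[symmetric] powr_powr mult.commute)

lemma fold_width_pos: "0 < h \<Longrightarrow> 0 < lam \<Longrightarrow> 0 < m \<Longrightarrow> 0 < fold_width h lam m"
  by (simp add: fold_width_def)

lemma fold_width_power_7:
  assumes "0 < h" "0 < lam" "0 < m"
  shows "m\<^sup>2 * fold_width h lam m ^ 7 = h ^ 4 * lam"
proof -
  have "fold_width h lam m ^ 7 = h ^ 4 * lam * m powr (- 2)"
    unfolding fold_width_def power_mult_distrib using assms by (simp add: powr_power powr_numeral)
  moreover have "m powr (- 2) = inverse (m\<^sup>2)" using assms by (simp add: powr_minus powr_numeral)
  ultimately show ?thesis using assms by simp
qed

lemma fold_width_le_1:
  assumes h: "0 < h" "h \<le> 1/2" and lam: "0 < lam" and m: "lam powr (1/2) * h powr (1/4) \<le> m"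
  shows "(fold_width h lam m)\<^sup>2 \<le> h" "fold_width h lam m \<le> 1"
proof -
  define s where "s = fold_width h lam m"
  have m0: "0 < m" by (rule less_le_trans[OF _ m]) (use h lam in simp)
  have s0: "0 < s" using h lam m0 by (simp add: s_def fold_width_pos)
  have "(lam powr (1/2) * h powr (1/4)) ^ 4 \<le> m ^ 4" using m by (rule power_mono) simp
  then have m4: "lam\<^sup>2 * h \<le> m ^ 4" using h lam by (simp add: power_mult_distrib powr_power powr_numeral)
  have "lam\<^sup>2 * h * s ^ 14 \<le> m ^ 4 * s ^ 14" using m4 s0 by (intro mult_right_mono) auto
  also have "\<dots> = (m\<^sup>2 * s ^ 7)\<^sup>2" by (simp add: power_mult_distrib flip: power_mult)
  also have "\<dots> = h ^ 8 * lam\<^sup>2" unfolding s_def fold_width_power_7[OF h(1) lam m0]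
    by (simp add: power_mult_distrib flip: power_mult)
  finally have "(lam\<^sup>2 * h) * s ^ 14 \<le> (lam\<^sup>2 * h) * h ^ 7"
    by (simp add: power_numeral_reduce mult_ac)
  then have "s ^ 14 \<le> h ^ 7" using h lam by (simp add: mult_le_cancel_left_pos)
  then have "(s\<^sup>2) ^ 7 \<le> h ^ 7" by (simp flip: power_mult)
  then show le: "(fold_width h lam m)\<^sup>2 \<le> h" using h power_mono_iff[of "s\<^sup>2" h 7] by (simp add: s_def)
  then have "s\<^sup>2 \<le> 1\<^sup>2" using h by (simp add: s_def)
  then show "fold_width h lam m \<le> 1" unfolding s_def by (rule power2_le_imp_le) simp
qed

lemma target_slope_squared:
  assumes "0 < h" "0 < lam" "0 < m"
  shows "(m powr (1/7) * h powr (- 2/7) * lam powr (3/7))\<^sup>2 = lam / fold_width h lam m"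
proof -
  have "(m powr (1/7) * h powr (- 2/7) * lam powr (3/7))\<^sup>2 = m powr (2/7) * h powr (- 4/7) * lam powr (6/7)"
    using assms by (simp add: power_mult_distrib powr_power)
  moreover have "m powr (2/7) * h powr (- 4/7) * lam powr (6/7) * fold_width h lam m = lam"
  proof -
    have "m powr (2/7) * h powr (- 4/7) * lam powr (6/7) * fold_width h lam m =
        (m powr (2/7) * m powr (- 2/7)) * (h powr (- 4/7) * h powr (4/7)) * (lam powr (6/7) * lam powr (1/7))"
      by (simp add: fold_width_def mult_ac)
    also have "\<dots> = lam" using assms by (simp flip: powr_add)
    finally show ?thesis .
  qed
  ultimately show ?thesis using fold_width_pos[OF assms] by (simp add: eq_divide_eq)
qed

text \<open>The quotient of the excess \<open>h\<^sup>2 lam / s\<^sup>2\<close> by \<open>lam\<^sup>2\<close> is a power of the quotient that the hypothesis of the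
theorem sends to zero.\<close>

lemma excess_ratio:
  assumes "0 < h" "0 < lam" "0 < m"
  shows "(h\<^sup>2 / ((fold_width h lam m)\<^sup>2 * lam)) ^ 7 = (h / (m powr (- 2/3) * lam powr (3/2))) ^ 6"
proof -
  define s where "s = fold_width h lam m"
  have s7: "s ^ 7 = h ^ 4 * lam / m\<^sup>2"
    using fold_width_power_7[OF assms] assms by (simp add: s_def eq_divide_eq mult.commute)
  have "(h\<^sup>2 / (s\<^sup>2 * lam)) ^ 7 = h ^ 14 / ((s ^ 7)\<^sup>2 * lam ^ 7)"
    by (simp add: power_divide power_mult_distrib flip: power_mult)
  also have "\<dots> = h ^ 6 * m ^ 4 / lam ^ 9"
    unfolding s7 using assms by (simp add: power_divide power_mult_distrib field_simps flip: power_mult power_add)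
  also have "\<dots> = (h / (m powr (- 2/3) * lam powr (3/2))) ^ 6"
  proof -
    have "(m powr (- 2/3)) ^ 6 = m powr (- 4)" using powr_power[OF assms(3), of "- 2/3" 6] by simp
    then have "(m powr (- 2/3)) ^ 6 = inverse (m ^ 4)" using assms by (simp add: powr_minus powr_numeral)
    moreover have "(lam powr (3/2)) ^ 6 = lam ^ 9"
      using powr_power[OF assms(2), of "3/2" 6] assms by (simp add: powr_numeral)
    ultimately show ?thesis using assms by (simp add: power_divide power_mult_distrib field_simps)
  qed
  finally show ?thesis by (simp add: s_def)
qed

text \<open>The first of the three terms equals a multiple of \<open>h\<^sup>2 lam / s\<^sup>2\<close> by the choice of \<open>s\<close>, the last one by its
form, and the middle one is dominated because \<open>s\<^sup>2 \<le> h\<close>. The constant collects 64, 32 and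
\<open>32 * 480\<^sup>2\<close>.\<close>

lemma fold_excess_bound:
  assumes h: "0 < h" "h \<le> 1/2" and lam: "0 < lam" and m: "lam powr (1/2) * h powr (1/4) \<le> m"
  defines "s \<equiv> fold_width h lam m"
  shows "4 * pi * s * (2 * m * sqrt (2 * lam * s) + 2 * lam * s + h\<^sup>2 * (2 * lam * s) * (480 / s\<^sup>2)\<^sup>2)
     \<le> 8000000 * (h\<^sup>2 * lam / s\<^sup>2)"
proof -
  have m0: "0 < m" by (rule less_le_trans[OF _ m]) (use h lam in simp)
  have s0: "0 < s" using h lam m0 by (simp add: s_def fold_width_pos)
  have s2: "s\<^sup>2 \<le> h" unfolding s_def by (rule fold_width_le_1[OF h lam m])
  have s7: "m\<^sup>2 * s ^ 7 = h ^ 4 * lam" unfolding s_def by (rule fold_width_power_7[OF h(1) lam m0])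
  define D where "D = h\<^sup>2 * lam / s\<^sup>2"
  have D0: "0 < D" using h lam s0 by (simp add: D_def)
  have Ds: "D * s\<^sup>2 = h\<^sup>2 * lam" using s0 by (simp add: D_def)
  have 1: "m * s * sqrt (lam * s) = D"
  proof (rule power2_eq_imp_eq)
    have "(m * s * sqrt (lam * s))\<^sup>2 * (s\<^sup>2)\<^sup>2 = (m\<^sup>2 * s ^ 7) * lam"
      using lam s0 by (simp add: power_mult_distrib power_numeral_reduce mult_ac)
    also have "\<dots> = (D * s\<^sup>2)\<^sup>2" unfolding s7 Ds by (simp add: power_mult_distrib power_numeral_reduce mult_ac)
    finally have "(m * s * sqrt (lam * s))\<^sup>2 * (s\<^sup>2)\<^sup>2 = D\<^sup>2 * (s\<^sup>2)\<^sup>2" by (simp add: power_mult_distrib)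
    then show "(m * s * sqrt (lam * s))\<^sup>2 = D\<^sup>2" using s0 by simp
  qed (use D0 m0 s0 lam in auto)
  have "sqrt 2 \<le> 2" by (rule real_le_lsqrt) auto
  have "sqrt (2 * lam * s) = sqrt 2 * sqrt (lam * s)" by (simp add: real_sqrt_mult mult.assoc)
  then have "4 * pi * s * (2 * m * sqrt (2 * lam * s)) = 8 * pi * sqrt 2 * D"
    unfolding 1[symmetric] by simp
  also have "\<dots> \<le> 8 * 4 * 2 * D"
    using \<open>sqrt 2 \<le> 2\<close> pi_less_4 D0 by (intro mult_right_mono mult_mono) auto
  finally have a: "4 * pi * s * (2 * m * sqrt (2 * lam * s)) \<le> 64 * D" by simp
  have "lam * s\<^sup>2 * s\<^sup>2 \<le> lam * h * h" using s2 lam h by (intro mult_mono) auto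
  then have "(lam * s\<^sup>2) * s\<^sup>2 \<le> D * s\<^sup>2" unfolding Ds by (simp add: power2_eq_square mult_ac)
  then have ls: "lam * s\<^sup>2 \<le> D" using s0 by (simp add: mult_le_cancel_right)
  have "4 * pi * s * (2 * lam * s) = 8 * pi * (lam * s\<^sup>2)" by (simp add: power2_eq_square)
  also have "\<dots> \<le> 8 * 4 * D" using ls pi_less_4 lam by (intro mult_mono) auto
  finally have b: "4 * pi * s * (2 * lam * s) \<le> 32 * D" by simp
  have "4 * pi * s * (h\<^sup>2 * (2 * lam * s) * (480 / s\<^sup>2)\<^sup>2) = 8 * 230400 * pi * D"
    using s0 by (simp add: D_def power_divide power2_eq_square)
  also have "\<dots> \<le> 8 * 230400 * 4 * D" using pi_less_4 D0 by (intro mult_right_mono mult_left_mono) auto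
  finally have c: "4 * pi * s * (h\<^sup>2 * (2 * lam * s) * (480 / s\<^sup>2)\<^sup>2) \<le> 7372800 * D" by simp
  show ?thesis unfolding D_def[symmetric] distrib_left using a b c D0 by linarith
qed

lemma slope_from_quartic:
  assumes h: "0 < h" and lam: "0 < lam" and m: "0 < m" and C: "0 < C" and L: "0 \<le> L"
  defines "s \<equiv> fold_width h lam m"
  assumes q: "lam ^ 4 \<le> 2 * L * (C * (h\<^sup>2 * lam / s\<^sup>2) / (2 * m)) ^ 3 * (C * (h\<^sup>2 * lam / s\<^sup>2) / h\<^sup>2)\<^sup>2"
  shows "m powr (1/7) * h powr (- 2/7) * lam powr (3/7) \<le> C ^ 5 * L"
proof -
  have s0: "0 < s" using assms by (simp add: s_def fold_width_pos)
  have s7: "m\<^sup>2 * s ^ 7 = h ^ 4 * lam" unfolding s_def by (rule fold_width_power_7[OF h lam m])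
  define t where "t = m powr (1/7) * h powr (- 2/7) * lam powr (3/7)"
  have t0: "0 \<le> t" by (simp add: t_def)
  have t2: "t\<^sup>2 * s = lam" using target_slope_squared[OF h lam m] s0 by (simp add: t_def s_def)
  have "2 * L * (C * (h\<^sup>2 * lam / s\<^sup>2) / (2 * m)) ^ 3 * (C * (h\<^sup>2 * lam / s\<^sup>2) / h\<^sup>2)\<^sup>2
      = L * C ^ 5 * h ^ 6 * lam ^ 5 / (4 * m ^ 3 * s ^ 10)"
    using h m s0 by (simp add: field_simps power_numeral_reduce)
  with q have "lam ^ 4 * (4 * m ^ 3 * s ^ 10) \<le> L * C ^ 5 * h ^ 6 * lam ^ 5"
    using m s0 by (simp add: pos_le_divide_eq)
  then have "lam ^ 4 * (4 * (m ^ 3 * s ^ 10)) \<le> lam ^ 4 * (L * C ^ 5 * (h ^ 6 * lam))"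
    by (simp add: power_numeral_reduce mult_ac)
  then have main: "4 * (m ^ 3 * s ^ 10) \<le> L * C ^ 5 * (h ^ 6 * lam)" using lam by (simp add: mult_le_cancel_left_pos)
  have "m ^ 3 * s ^ 10 = t * (h ^ 6 * lam)"
  proof (rule power2_eq_imp_eq)
    have "(m ^ 3 * s ^ 10)\<^sup>2 * s = (m\<^sup>2 * s ^ 7) ^ 3" by (simp add: power_numeral_reduce mult_ac)
    also have "\<dots> = (h ^ 6 * lam)\<^sup>2 * lam" unfolding s7 by (simp add: power_numeral_reduce mult_ac)
    also have "\<dots> = (t * (h ^ 6 * lam))\<^sup>2 * s" 
    proof -
      have "(t * (h ^ 6 * lam))\<^sup>2 * s = (h ^ 6 * lam)\<^sup>2 * (t\<^sup>2 * s)" by (simp add: power_mult_distrib mult_ac)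
      then show ?thesis unfolding t2 by simp
    qed
    finally show "(m ^ 3 * s ^ 10)\<^sup>2 = (t * (h ^ 6 * lam))\<^sup>2" using s0 by simp
  qed (use m s0 t0 h lam in auto)
  with main have "(4 * t) * (h ^ 6 * lam) \<le> (L * C ^ 5) * (h ^ 6 * lam)" by simp
  then have "4 * t \<le> L * C ^ 5" using h lam by (simp add: mult_le_cancel_right)
  then show ?thesis using t0 unfolding t_def[symmetric] by (simp add: mult.commute)
qed

text \<open>The smallness of the ratio only serves to guarantee \<open>4 \<delta> \<le> lam\<^sup>2\<close> for \<open>\<delta> = 8000000 h\<^sup>2 lam / s\<^sup>2\<close>. The
seventh power of \<open>\<delta> / lam\<^sup>2\<close> is a multiple of the sixth power of the ratio, so the square of
\<open>1 / (4 * 8000000)\<close> is small enough.\<close>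

lemma minimizer_slope_bound:
  assumes h: "h \<in> {0<..1/2}" and lam: "lam \<in> {0<..1/2}"
    and vrho: "vrho \<ge> 1 + lam powr (1/2) * h powr (1/4)"
    and ratio: "h / ((vrho - 1) powr (- 2/3) * lam powr (3/2)) \<le> (1 / 32000000)\<^sup>2"
    and min: "is_arg_min (E_vKD h) (\<lambda>\<psi>. \<psi> \<in> A_vKD lam vrho) \<phi>"
  shows "ennreal ((vrho - 1) powr (1/7) * h powr (- 2/7) * lam powr (3/7))
     \<le> ennreal (8000000 ^ 5) * Linf_norm (grad (comp_rho \<phi>))"
proof (cases "Linf_norm (grad (comp_rho \<phi>))")
  case top
  then show ?thesis by (simp add: ennreal_mult_top)
next
  case (real L)
  define m where "m = vrho - 1"
  have h': "0 < h" "h \<le> 1/2" and lam': "0 < lam" using h lam by auto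
  have m: "lam powr (1/2) * h powr (1/4) \<le> m" using vrho by (simp add: m_def)
  have m0: "0 < m" by (rule less_le_trans[OF _ m]) (use h' lam' in simp)
  then have vrho1: "1 < vrho" by (simp add: m_def)
  define s where "s = fold_width h lam m"
  have s0: "0 < s" "s \<le> 1"
    unfolding s_def by (rule fold_width_pos[OF h'(1) lam' m0], rule fold_width_le_1(2)[OF h' lam' m])
  define \<delta> where "\<delta> = 8000000 * (h\<^sup>2 * lam / s\<^sup>2)"
  have \<delta>0: "0 < \<delta>" using h' lam' s0 by (simp add: \<delta>_def)
  obtain \<phi>' where comp: "\<phi>' \<in> A_vKD lam vrho"
    "E_vKD h \<phi>' \<le> ennreal (2 * pi * (vrho - 1)\<^sup>2 + 4 * pi * s *
       (2 * (vrho - 1) * sqrt (2 * lam * s) + 2 * lam * s + h\<^sup>2 * (2 * lam * s) * (480 / s\<^sup>2)\<^sup>2))"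
    using single_fold_competitor[OF s0 lam' vrho1, of h] by blast
  have adm: "\<phi> \<in> A_vKD lam vrho" and "\<not> E_vKD h \<phi>' < E_vKD h \<phi>"
    using min comp(1) unfolding is_arg_min_def by blast+
  then have "E_vKD h \<phi> \<le> E_vKD h \<phi>'" by simp
  also note comp(2)
  also have "ennreal (2 * pi * (vrho - 1)\<^sup>2 + 4 * pi * s *
       (2 * (vrho - 1) * sqrt (2 * lam * s) + 2 * lam * s + h\<^sup>2 * (2 * lam * s) * (480 / s\<^sup>2)\<^sup>2))
      \<le> ennreal (2 * pi * (vrho - 1)\<^sup>2 + \<delta>)"
    using fold_excess_bound[OF h' lam' m] by (intro ennreal_leI) (simp add: s_def \<delta>_def m_def)
  finally have E: "E_vKD h \<phi> \<le> ennreal (2 * pi * (vrho - 1)\<^sup>2 + \<delta>)" .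
  have small: "4 * \<delta> \<le> lam\<^sup>2"
  proof -
    define x where "x = h\<^sup>2 / (s\<^sup>2 * lam)"
    define y where "y = h / (m powr (- 2/3) * lam powr (3/2))"
    have "0 \<le> y" using h' lam' m0 by (simp add: y_def)
    have "x ^ 7 = y ^ 6" unfolding x_def y_def s_def by (rule excess_ratio[OF h'(1) lam' m0])
    also have "\<dots> \<le> ((1 / 32000000)\<^sup>2) ^ 6"
      using ratio \<open>0 \<le> y\<close> by (intro power_mono) (simp_all add: y_def m_def)
    also have "\<dots> \<le> (1 / 32000000 :: real) ^ 7" unfolding power_mult[symmetric] by (rule power_decreasing) auto
    finally have "x ^ 7 \<le> (1 / 32000000) ^ 7" .
    moreover have "0 \<le> x" using lam' by (simp add: x_def)
    ultimately have "x \<le> 1 / 32000000" using power_mono_iff[of x "1 / 32000000" 7] by simp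
    then have "32000000 * x * lam\<^sup>2 \<le> 1 * lam\<^sup>2" by (intro mult_right_mono) auto
    moreover have "4 * \<delta> = 32000000 * x * lam\<^sup>2"
      using lam' by (simp add: \<delta>_def x_def power2_eq_square)
    ultimately show ?thesis by simp
  qed
  have slope: "AE x in lebesgue. x \<in> Omega \<longrightarrow> norm (grad (comp_rho \<phi>) x) \<le> L"
  proof -
    have "AE x in lebesgue_on Omega. ennreal (norm (grad (comp_rho \<phi>) x)) \<le> ennreal L"
      using esssup_AE[of "\<lambda>x. ennreal (norm (grad (comp_rho \<phi>) x))" "lebesgue_on Omega"] real
      by (simp add: Linf_norm_def)
    then have "AE x in lebesgue_on Omega. norm (grad (comp_rho \<phi>) x) \<le> L"
      by eventually_elim (use real in simp)
    then show ?thesis by (simp only: AE_lebesgue_on_Omega)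
  qed
  have "lam ^ 4 \<le> 2 * L * (\<delta> / (2 * (vrho - 1))) ^ 3 * (\<delta> / h\<^sup>2)\<^sup>2"
    by (rule slope_bound[OF adm vrho1 h'(1) lam' \<delta>0 small _ E slope]) (use real in simp)
  then have "m powr (1/7) * h powr (- 2/7) * lam powr (3/7) \<le> 8000000 ^ 5 * L"
    using real by (intro slope_from_quartic[OF h'(1) lam' m0]) (simp_all add: \<delta>_def s_def m_def)
  then have "ennreal (m powr (1/7) * h powr (- 2/7) * lam powr (3/7)) \<le> ennreal (8000000 ^ 5 * L)"
    by (rule ennreal_leI)
  also have "\<dots> = ennreal (8000000 ^ 5) * ennreal L" using real by (intro ennreal_mult) auto
  finally show ?thesis using real by (simp add: m_def)
qed

theorem corollary3p5:
  shows "\<exists>C>0. \<forall>(h :: real \<Rightarrow> real) (lam :: real \<Rightarrow> real) (vrho :: real \<Rightarrow> real)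
           (\<phi> :: real \<Rightarrow> real \<times> real \<Rightarrow> real^3).
    (\<forall>\<alpha>>0. h \<alpha> \<in> {0<..1/2} \<and> lam \<alpha> \<in> {0<..1/2} \<and>
            vrho \<alpha> \<ge> 1 + lam \<alpha> powr (1/2) * h \<alpha> powr (1/4)) \<longrightarrow>
    ((\<lambda>\<alpha>. h \<alpha> / ((vrho \<alpha> - 1) powr (- 2/3) * lam \<alpha> powr (3/2))) \<longlongrightarrow> 0) at_top \<longrightarrow>
    (\<forall>\<alpha>>0. \<phi> \<alpha> \<in> A_vKD (lam \<alpha>) (vrho \<alpha>) \<and>
            is_arg_min (E_vKD (h \<alpha>)) (\<lambda>\<psi>. \<psi> \<in> A_vKD (lam \<alpha>) (vrho \<alpha>)) (\<phi> \<alpha>)) \<longrightarrow>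
    (\<forall>\<^sub>F \<alpha> in at_top.
       ennreal ((vrho \<alpha> - 1) powr (1/7) * h \<alpha> powr (- 2/7) * lam \<alpha> powr (3/7))
         \<le> ennreal C * Linf_norm (grad (comp_rho (\<phi> \<alpha>))))"
proof (rule exI[of _ "8000000 ^ 5"], intro conjI allI impI)
  fix h lam vrho :: "real \<Rightarrow> real" and \<phi> :: "real \<Rightarrow> real \<times> real \<Rightarrow> real^3"
  assume par: "\<forall>\<alpha>>0. h \<alpha> \<in> {0<..1/2} \<and> lam \<alpha> \<in> {0<..1/2} \<and>
            vrho \<alpha> \<ge> 1 + lam \<alpha> powr (1/2) * h \<alpha> powr (1/4)"
    and lim: "((\<lambda>\<alpha>. h \<alpha> / ((vrho \<alpha> - 1) powr (- 2/3) * lam \<alpha> powr (3/2))) \<longlongrightarrow> 0) at_top"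
    and min: "\<forall>\<alpha>>0. \<phi> \<alpha> \<in> A_vKD (lam \<alpha>) (vrho \<alpha>) \<and>
            is_arg_min (E_vKD (h \<alpha>)) (\<lambda>\<psi>. \<psi> \<in> A_vKD (lam \<alpha>) (vrho \<alpha>)) (\<phi> \<alpha>)"
  have "\<forall>\<^sub>F \<alpha> in at_top. h \<alpha> / ((vrho \<alpha> - 1) powr (- 2/3) * lam \<alpha> powr (3/2)) < (1 / 32000000)\<^sup>2"
    by (rule order_tendstoD(2)[OF lim]) simp
  moreover have "\<forall>\<^sub>F \<alpha> in at_top. (0::real) < \<alpha>" by (rule eventually_gt_at_top)
  ultimately show "\<forall>\<^sub>F \<alpha> in at_top.
       ennreal ((vrho \<alpha> - 1) powr (1/7) * h \<alpha> powr (- 2/7) * lam \<alpha> powr (3/7))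
         \<le> ennreal (8000000 ^ 5) * Linf_norm (grad (comp_rho (\<phi> \<alpha>)))"
  proof eventually_elim
    case (elim \<alpha>)
    then show ?case using par min by (intro minimizer_slope_bound) auto
  qed
qed simp

end
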